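(* Let $n\geq 4$, let $m$ be a natural number, and let $X$ be a $\mathrm{CAT}(0)$ cube complex such that every vertex of $X$ has at most $m$ neighbours. Let $\Phi:\mathrm{SAut}(F_n)\rightarrow\mathrm{Isom}(X)$ be a strongly simplicial action. If $m<n$, then $\Phi$ is trivial, i.e. $\Phi(g)=\mathrm{id}_X$ for all $g\in\mathrm{SAut}(F_n)$.
   Context: $F_n$ denotes the free group of rank $n$ and $\mathrm{Aut}(F_n)$ its automorphism group. The abelianization map $F_n\twoheadrightarrow\mathbb{Z}^n$ induces a natural epimorphism $\pi:\mathrm{Aut}(F_n)\twoheadrightarrow\mathrm{GL}_n(\mathbb{Z})$, and $\mathrm{SAut}(F_n):=\pi^{-1}(\mathrm{SL}_n(\mathbb{Z}))$, a subgroup of index two in $\mathrm{Aut}(F_n)$. A $d$-dimensional cube is a copy of the unit cube $[0,1]^d$ (a point if $d=0$). A face of $[0,1]^d$ is a product $F^1\times\cdots\times F^d$ in which each $F^i$ is $\{0\}$, $\{1\}$ or $[0,1]$. A glueing of two cubes $C_1,C_2$ along faces $F_1\subset C_1$, $F_2\subset C_2$ is a bijective isometry $\psi_{C_1,C_2}:F_1\to F_2$. Let $\mathcal{K}$ be a family of cubes and $\mathcal{F}$ a family of glueings of elements of $\mathcal{K}$ such that no cube is glued with itself and for all cubes $C_1,C_2$ there is at most one glueing $\psi_{C_1,C_2}$. A cube complex is the quotient of the disjoint union $\bigsqcup\mathcal{K}$ by the equivalence relation generated by $x\sim\psi_{C_1,C_2}(x)$ for $\psi_{C_1,C_2}\in\mathcal{F}$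 and $x$ in the domain of $\psi_{C_1,C_2}$. As usual, each cube is understood to embed in the quotient, and any two cubes of the quotient intersect either in the empty set or in a single common face. A cube complex is $\mathrm{CAT}(0)$ if, with its length metric, it is a $\mathrm{CAT}(0)$ space. Vertices are the $0$-dimensional cubes (and faces); two distinct vertices are neighbours if they are joined by an edge (a $1$-dimensional cube or face). $\mathrm{Isom}(X)$ is the isometry group of $X$. A simplicial action of a group on a $\mathrm{CAT}(0)$ cube complex is an action by isometries that map cubes (isometrically) onto cubes. A simplicial action is called strongly simplicial if the stabilizer group of any cube fixes that cube pointwise. *)

theory Defs
  imports
    "HOL-Analysis.Analysis"
    "HOL-Algebra.Bij"
    "Jordan_Normal_Form.Determinant"
begin

section \<open>The free group of rank n and its special automorphism group\<close>

text \<open>A letter \<open>(i, True)\<close> stands for the generator \<open>x\<^sub>i\<close> and \<open>(i, False)\<close> for its inverse. The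
  elements of the free group on \<open>x\<^sub>0, \<dots>, x\<^sub>n\<^sub>-\<^sub>1\<close> are the reduced words.\<close>

type_synonym letter = "nat \<times> bool"
type_synonym word = "letter list"

definition letter_inv :: "letter \<Rightarrow> letter" where
  "letter_inv a = (fst a, \<not> snd a)"

fun reduced_word :: "word \<Rightarrow> bool" where
  "reduced_word [] \<longleftrightarrow> True"
| "reduced_word [a] \<longleftrightarrow> True"
| "reduced_word (a # b # w) \<longleftrightarrow> b \<noteq> letter_inv a \<and> reduced_word (b # w)"

fun letter_mult :: "letter \<Rightarrow> word \<Rightarrow> word" where
  "letter_mult a [] = [a]"
| "letter_mult a (b # w) = (if b = letter_inv a then w else a # b # w)"

definition word_mult :: "word \<Rightarrow> word \<Rightarrow> word" where
  "word_mult u v = foldr letter_mult u v"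

definition free_group :: "nat \<Rightarrow> word monoid" where
  "free_group n =
     \<lparr>carrier = {w. reduced_word w \<and> fst ` set w \<subseteq> {..<n}}, mult = word_mult, one = []\<rparr>"

definition exponent_sum :: "nat \<Rightarrow> word \<Rightarrow> int" where
  "exponent_sum i w = (\<Sum>a\<leftarrow>w. if fst a = i then (if snd a then 1 else - 1) else 0)"

definition abelianization :: "nat \<Rightarrow> word \<Rightarrow> int vec" where
  "abelianization n w = vec n (\<lambda>i. exponent_sum i w)"

text \<open>The matrix of the automorphism of \<open>\<int>\<^sup>n\<close> induced by an automorphism of the free group.\<close>

definition aut_matrix :: "nat \<Rightarrow> (word \<Rightarrow> word) \<Rightarrow> int mat" where
  "aut_matrix n \<phi> = mat_of_cols n (map (\<lambda>j. abelianization n (\<phi> [(j, True)])) [0..<n])"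

definition SL_mat :: "nat \<Rightarrow> int mat set" where
  "SL_mat n = {A \<in> carrier_mat n n. Determinant.det A = 1}"

definition SAut :: "nat \<Rightarrow> (word \<Rightarrow> word) monoid" where
  "SAut n = AutoGroup (free_group n)
     \<lparr>carrier := {\<phi> \<in> carrier (AutoGroup (free_group n)). aut_matrix n \<phi> \<in> SL_mat n}\<rparr>"

lemma letter_inv_inv [simp]: "letter_inv (letter_inv a) = a"
  by (simp add: letter_inv_def)

lemma letter_inv_neq [simp]: "letter_inv a \<noteq> a" "a \<noteq> letter_inv a"
  by (auto simp: letter_inv_def prod_eq_iff)

lemma fst_letter_inv [simp]: "fst (letter_inv a) = fst a"
  by (simp add: letter_inv_def)

lemma reduced_tl: "reduced_word (a # w) \<Longrightarrow> reduced_word w"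
  by (cases w) auto

lemma reduced_letter_mult: "reduced_word w \<Longrightarrow> reduced_word (letter_mult a w)"
  by (cases w) (auto dest: reduced_tl)

lemma set_letter_mult: "set (letter_mult a w) \<subseteq> insert a (set w)"
  by (cases w) auto

lemma letter_mult_reduced: "reduced_word (a # w) \<Longrightarrow> letter_mult a w = a # w"
  by (cases w) auto

lemma letter_mult_inv: "reduced_word w \<Longrightarrow> letter_mult a (letter_mult (letter_inv a) w) = w"
  by (cases w rule: reduced_word.cases) auto

lemma reduced_word_mult: "reduced_word v \<Longrightarrow> reduced_word (word_mult u v)"
  unfolding word_mult_def by (induction u) (auto intro: reduced_letter_mult)

lemma set_word_mult: "set (word_mult u v) \<subseteq> set u \<union> set v"
  unfolding word_mult_def by (induction u) (use set_letter_mult in fastforce)+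

lemma word_mult_letter_mult:
  assumes "reduced_word w"
  shows "word_mult (letter_mult a u) w = letter_mult a (word_mult u w)"
proof (cases u)
  case (Cons b v)
  have "reduced_word (word_mult v w)"
    using assms by (rule reduced_word_mult)
  then show ?thesis
    using Cons letter_mult_inv by (auto simp: word_mult_def)
qed (simp add: word_mult_def)

lemma word_mult_assoc:
  "reduced_word w \<Longrightarrow> word_mult (word_mult u v) w = word_mult u (word_mult v w)"
proof (induction u)
  case (Cons a u)
  have "word_mult (word_mult (a # u) v) w = word_mult (letter_mult a (word_mult u v)) w"
    by (simp add: word_mult_def)
  then show ?case
    using Cons by (simp add: word_mult_letter_mult) (simp add: word_mult_def)
qed (simp add: word_mult_def)

lemma word_mult_Nil_right: "reduced_word u \<Longrightarrow> word_mult u [] = u"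
proof (induction u)
  case (Cons a u)
  then show ?case
    using letter_mult_reduced[of a u] reduced_tl[of a u] by (simp add: word_mult_def)
qed (simp add: word_mult_def)

lemma word_inverse_exists:
  assumes "reduced_word u"
  shows "\<exists>v. reduced_word v \<and> fst ` set v \<subseteq> fst ` set u \<and> word_mult v u = []"
  using assms
proof (induction u)
  case (Cons a u)
  then obtain v where v: "reduced_word v" "fst ` set v \<subseteq> fst ` set u" "word_mult v u = []"
    using reduced_tl by blast
  let ?v = "word_mult v [letter_inv a]"
  have "word_mult ?v (a # u) = word_mult v (word_mult [letter_inv a] (a # u))"
    using Cons.prems by (rule word_mult_assoc)
  also have "word_mult [letter_inv a] (a # u) = u"
    by (simp add: word_mult_def)
  finally have "word_mult ?v (a # u) = []"
    using v(3) by simp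
  moreover have "reduced_word ?v"
    by (rule reduced_word_mult) simp
  moreover have "fst ` set ?v \<subseteq> fst ` set (a # u)"
  proof -
    have "fst ` set ?v \<subseteq> fst ` (set v \<union> set [letter_inv a])"
      by (intro image_mono set_word_mult)
    also have "\<dots> = insert (fst a) (fst ` set v)"
      by simp
    also have "\<dots> \<subseteq> fst ` set (a # u)"
      using v(2) by auto
    finally show ?thesis .
  qed
  ultimately show ?case
    by blast
qed (auto simp: word_mult_def)

lemma group_free_group: "group (free_group n)"
proof (rule groupI)
  fix x y
  assume x: "x \<in> carrier (free_group n)" and y: "y \<in> carrier (free_group n)"
  have "fst ` set (word_mult x y) \<subseteq> fst ` (set x \<union> set y)"
    by (intro image_mono set_word_mult)
  also have "\<dots> = fst ` set x \<union> fst ` set y"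
    by (rule image_Un)
  also have "\<dots> \<subseteq> {..<n}"
    using x y by (simp add: free_group_def)
  finally show "x \<otimes>\<^bsub>free_group n\<^esub> y \<in> carrier (free_group n)"
    using y by (simp add: free_group_def reduced_word_mult)
next
  fix x
  assume x: "x \<in> carrier (free_group n)"
  then obtain v where "reduced_word v" "fst ` set v \<subseteq> fst ` set x" "word_mult v x = []"
    using word_inverse_exists[of x] by (auto simp: free_group_def)
  moreover have "fst ` set x \<subseteq> {..<n}"
    using x by (simp add: free_group_def)
  ultimately show "\<exists>y\<in>carrier (free_group n). y \<otimes>\<^bsub>free_group n\<^esub> x = \<one>\<^bsub>free_group n\<^esub>"
    by (intro bexI[of _ v]) (simp_all add: free_group_def)
next
  fix x y z
  assume "z \<in> carrier (free_group n)"
  then show "x \<otimes>\<^bsub>free_group n\<^esub> y \<otimes>\<^bsub>free_group n\<^esub> z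
             = x \<otimes>\<^bsub>free_group n\<^esub> (y \<otimes>\<^bsub>free_group n\<^esub> z)"
    by (simp add: free_group_def word_mult_assoc)
qed (simp_all add: free_group_def word_mult_def)


section \<open>CAT(0) spaces\<close>

text \<open>\<open>c\<close> is a geodesic segment joining \<open>p\<close> to \<open>q\<close>, i.e. the image of a geodesic path.\<close>

definition geodesic_segment ::
    "'a set \<Rightarrow> ('a \<Rightarrow> 'a \<Rightarrow> real) \<Rightarrow> 'a \<Rightarrow> 'a \<Rightarrow> 'a set \<Rightarrow> bool" where
  "geodesic_segment M d p q c \<longleftrightarrow>
     (\<exists>\<gamma>. \<gamma> ` {0..d p q} = c \<and> c \<subseteq> M \<and> \<gamma> 0 = p \<and> \<gamma> (d p q) = q \<and>
          (\<forall>s\<in>{0..d p q}. \<forall>t\<in>{0..d p q}. d (\<gamma> s) (\<gamma> t) = \<bar>s - t\<bar>))"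

text \<open>The Euclidean plane is \<open>\<real> \<times> \<real>\<close>, on which \<open>dist\<close> is the Euclidean metric. The point \<open>x'\<close> is a
  comparison point on the side \<open>[p', q']\<close> for the point \<open>x\<close> on the side \<open>c\<close> joining \<open>p\<close> to \<open>q\<close>.\<close>

definition comparison_point ::
    "('a \<Rightarrow> 'a \<Rightarrow> real) \<Rightarrow> 'a \<Rightarrow> 'a set \<Rightarrow> real \<times> real \<Rightarrow> real \<times> real \<Rightarrow> 'a \<Rightarrow> real \<times> real \<Rightarrow> bool" where
  "comparison_point d p c p' q' x x' \<longleftrightarrow>
     x \<in> c \<and> x' \<in> closed_segment p' q' \<and> dist p' x' = d p x"

definition CAT0_space :: "'a set \<Rightarrow> ('a \<Rightarrow> 'a \<Rightarrow> real) \<Rightarrow> bool" where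
  "CAT0_space M d \<longleftrightarrow>
     Metric_space M d \<and>
     (\<forall>p\<in>M. \<forall>q\<in>M. \<exists>c. geodesic_segment M d p q c) \<and>
     (\<forall>p\<in>M. \<forall>q\<in>M. \<forall>r\<in>M. \<forall>a b c p' q' r'.
        geodesic_segment M d p q a \<and> geodesic_segment M d q r b \<and> geodesic_segment M d r p c \<and>
        dist p' q' = d p q \<and> dist q' r' = d q r \<and> dist r' p' = d r p \<longrightarrow>
        (let comp = (\<lambda>x x'. comparison_point d p a p' q' x x' \<or>
                            comparison_point d q b q' r' x x' \<or>
                            comparison_point d r c r' p' x x')
         in \<forall>x x' y y'. comp x x' \<and> comp y y' \<longrightarrow> d x y \<le> dist x' y'))"

text \<open>The isometry group; as in \<^const>\<open>BijGroup\<close>, its elements are extensional functions.\<close>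

definition isom_group :: "'a set \<Rightarrow> ('a \<Rightarrow> 'a \<Rightarrow> real) \<Rightarrow> ('a \<Rightarrow> 'a) monoid" where
  "isom_group M d = BijGroup M
     \<lparr>carrier := {f \<in> Bij M. \<forall>x\<in>M. \<forall>y\<in>M. d (f x) (f y) = d x y}\<rparr>"


section \<open>Cube complexes\<close>

text \<open>Points of \<open>[0,1]\<^sup>d\<close> are functions on \<open>{..<d}\<close>, extended by \<^const>\<open>undefined\<close>.\<close>

type_synonym pt = "nat \<Rightarrow> real"

definition unit_cube :: "nat \<Rightarrow> pt set" where
  "unit_cube d = (\<Pi>\<^sub>E i\<in>{..<d}. {0..1})"

definition cube_dist :: "nat \<Rightarrow> pt \<Rightarrow> pt \<Rightarrow> real" where
  "cube_dist d x y = L2_set (\<lambda>i. x i - y i) {..<d}"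

text \<open>\<open>F\<close> is a \<open>k\<close>-dimensional face of \<open>[0,1]\<^sup>d\<close>; the cube is a face of itself.\<close>

definition cube_face :: "nat \<Rightarrow> nat \<Rightarrow> pt set \<Rightarrow> bool" where
  "cube_face d k F \<longleftrightarrow>
     (\<exists>S. (\<forall>i<d. S i = {0} \<or> S i = {1} \<or> S i = {0..1}) \<and>
          k = card {i. i < d \<and> S i = {0..1}} \<and> F = (\<Pi>\<^sub>E i\<in>{..<d}. S i))"

definition cube_isometry :: "nat \<Rightarrow> nat \<Rightarrow> pt set \<Rightarrow> pt set \<Rightarrow> (pt \<Rightarrow> pt) \<Rightarrow> bool" where
  "cube_isometry d e F F' \<psi> \<longleftrightarrow>
     bij_betw \<psi> F F' \<and> (\<forall>x\<in>F. \<forall>y\<in>F. cube_dist e (\<psi> x) (\<psi> y) = cube_dist d x y)"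

text \<open>The glueing data: a family of cubes \<open>[0,1]\<^bsup>cdim i\<^esup>\<close> indexed by \<open>i \<in> cubes\<close>, and a family of
  glueings \<open>(i, j, \<psi>)\<close> of the cube \<open>i\<close> with the cube \<open>j\<close>. The partial function \<open>\<psi>\<close> carries the two
  faces as its domain and range.\<close>

record 'i cube_data =
  cubes :: "'i set"
  cdim :: "'i \<Rightarrow> nat"
  glueings :: "('i \<times> 'i \<times> (pt \<rightharpoonup> pt)) set"

definition is_glueing :: "nat \<Rightarrow> nat \<Rightarrow> (pt \<rightharpoonup> pt) \<Rightarrow> bool" where
  "is_glueing d e \<psi> \<longleftrightarrow>
     (\<exists>k. cube_face d k (dom \<psi>)) \<and> (\<exists>k. cube_face e k (ran \<psi>)) \<and>
     cube_isometry d e (dom \<psi>) (ran \<psi>) (\<lambda>x. the (\<psi> x))"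

definition disjoint_cubes :: "'i cube_data \<Rightarrow> ('i \<times> pt) set" where
  "disjoint_cubes X = (SIGMA i:cubes X. unit_cube (cdim X i))"

definition glue_step :: "'i cube_data \<Rightarrow> (('i \<times> pt) \<times> ('i \<times> pt)) set" where
  "glue_step X = {((i, x), (j, y)) | i j x y. \<exists>\<psi>. (i, j, \<psi>) \<in> glueings X \<and> \<psi> x = Some y}"

definition glue_rel :: "'i cube_data \<Rightarrow> (('i \<times> pt) \<times> ('i \<times> pt)) set" where
  "glue_rel X = (glue_step X \<union> (glue_step X)\<inverse>)\<^sup>* \<inter> disjoint_cubes X \<times> disjoint_cubes X"

definition points :: "'i cube_data \<Rightarrow> ('i \<times> pt) set set" where
  "points X = disjoint_cubes X // glue_rel X"

definition proj :: "'i cube_data \<Rightarrow> 'i \<Rightarrow> pt \<Rightarrow> ('i \<times> pt) set" where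
  "proj X i x = glue_rel X `` {(i, x)}"

text \<open>The last two conjuncts say that every cube embeds in the quotient and that two cubes of the
  quotient are disjoint or meet in a single common face.\<close>

definition cube_complex :: "'i cube_data \<Rightarrow> bool" where
  "cube_complex X \<longleftrightarrow>
     (\<forall>(i, j, \<psi>) \<in> glueings X.
        i \<in> cubes X \<and> j \<in> cubes X \<and> i \<noteq> j \<and> is_glueing (cdim X i) (cdim X j) \<psi>) \<and>
     (\<forall>i j \<psi> \<psi>'. (i, j, \<psi>) \<in> glueings X \<and> (i, j, \<psi>') \<in> glueings X \<longrightarrow> \<psi> = \<psi>') \<and>
     (\<forall>i \<in> cubes X. inj_on (proj X i) (unit_cube (cdim X i))) \<and>
     (\<forall>i \<in> cubes X. \<forall>j \<in> cubes X.
        let D = proj X i ` unit_cube (cdim X i) \<inter> proj X j ` unit_cube (cdim X j)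
        in D = {} \<or>
           (\<exists>k l F F'. cube_face (cdim X i) k F \<and> cube_face (cdim X j) l F' \<and>
              D = proj X i ` F \<and> D = proj X j ` F'))"

text \<open>The length pseudometric: the infimum of the lengths of the piecewise linear paths, i.e. of
  the finite chains of segments each of which lies in a single cube.\<close>

inductive pl_path :: "'i cube_data \<Rightarrow> ('i \<times> pt) set \<Rightarrow> ('i \<times> pt) set \<Rightarrow> real \<Rightarrow> bool"
  for X :: "'i cube_data" where
  pl_refl: "p \<in> points X \<Longrightarrow> pl_path X p p 0"
| pl_step: "\<lbrakk>pl_path X p (proj X i x) L; i \<in> cubes X;
             x \<in> unit_cube (cdim X i); y \<in> unit_cube (cdim X i)\<rbrakk>
    \<Longrightarrow> pl_path X p (proj X i y) (L + cube_dist (cdim X i) x y)"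

text \<open>The value \<open>0\<close> in the absence of a path is a dummy: \<open>CAT0_cube_complex\<close> requires paths between
  all points, and \<^locale>\<open>Metric_space\<close> requires a nonnegative distance even off the carrier.\<close>

definition length_dist :: "'i cube_data \<Rightarrow> ('i \<times> pt) set \<Rightarrow> ('i \<times> pt) set \<Rightarrow> real" where
  "length_dist X p q = (if \<exists>L. pl_path X p q L then Inf {L. pl_path X p q L} else 0)"

definition CAT0_cube_complex :: "'i cube_data \<Rightarrow> bool" where
  "CAT0_cube_complex X \<longleftrightarrow>
     cube_complex X \<and>
     (\<forall>p\<in>points X. \<forall>q\<in>points X. \<exists>L. pl_path X p q L) \<and>
     CAT0_space (points X) (length_dist X)"

text \<open>The \<open>k\<close>-dimensional cubes of the quotient: images of the glued cubes and of their faces.\<close>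

definition cells :: "'i cube_data \<Rightarrow> nat \<Rightarrow> ('i \<times> pt) set set set" where
  "cells X k = {proj X i ` F | i F. i \<in> cubes X \<and> cube_face (cdim X i) k F}"

definition vertices :: "'i cube_data \<Rightarrow> ('i \<times> pt) set set" where
  "vertices X = {p. {p} \<in> cells X 0}"

definition neighbours :: "'i cube_data \<Rightarrow> ('i \<times> pt) set \<Rightarrow> ('i \<times> pt) set set" where
  "neighbours X v = {w \<in> vertices X. w \<noteq> v \<and> (\<exists>e\<in>cells X 1. v \<in> e \<and> w \<in> e)}"

definition maps_cubes_to_cubes ::
    "'i cube_data \<Rightarrow> (('i \<times> pt) set \<Rightarrow> ('i \<times> pt) set) \<Rightarrow> bool" where
  "maps_cubes_to_cubes X f \<longleftrightarrow>
     (\<forall>i\<in>cubes X. \<forall>k F. cube_face (cdim X i) k F \<longrightarrow>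
        (\<exists>j\<in>cubes X. \<exists>l F' \<psi>. cube_face (cdim X j) l F' \<and>
           cube_isometry (cdim X i) (cdim X j) F F' \<psi> \<and>
           (\<forall>x\<in>F. f (proj X i x) = proj X j (\<psi> x))))"

abbreviation Isom :: "'i cube_data \<Rightarrow> (('i \<times> pt) set \<Rightarrow> ('i \<times> pt) set) monoid" where
  "Isom X \<equiv> isom_group (points X) (length_dist X)"

definition simplicial_action ::
    "('g, 'b) monoid_scheme \<Rightarrow> 'i cube_data \<Rightarrow> ('g \<Rightarrow> ('i \<times> pt) set \<Rightarrow> ('i \<times> pt) set) \<Rightarrow> bool" where
  "simplicial_action G X \<Phi> \<longleftrightarrow>
     \<Phi> \<in> hom G (Isom X) \<and> (\<forall>g\<in>carrier G. maps_cubes_to_cubes X (\<Phi> g))"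

definition strongly_simplicial_action ::
    "('g, 'b) monoid_scheme \<Rightarrow> 'i cube_data \<Rightarrow> ('g \<Rightarrow> ('i \<times> pt) set \<Rightarrow> ('i \<times> pt) set) \<Rightarrow> bool" where
  "strongly_simplicial_action G X \<Phi> \<longleftrightarrow>
     simplicial_action G X \<Phi> \<and>
     (\<forall>k. \<forall>c\<in>cells X k. \<forall>g\<in>carrier G. \<Phi> g ` c = c \<longrightarrow> (\<forall>p\<in>c. \<Phi> g p = p))"

end

theory Submission
  imports Defs "HOL-Algebra.Sym_Groups"
begin

text \<open>
  Permuting the \<open>n + 1\<close> edges of the graph with two vertices embeds the alternating group of degree
  \<open>n + 1\<close> into \<open>SAut(F\<^sub>n)\<close>, where \<open>F\<^sub>n\<close> is the fundamental group of the graph. The proof shows that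
  this finite group acts trivially on \<open>X\<close> and that this is enough.

  The finite group acts trivially for the following reasons. The sum of the squared distances from
  an orbit has a unique minimum, which is a fixed point (\<open>fixed_point\<close>). Uniqueness is the
  convexity of CAT(0) spaces. For existence, a ball of radius \<open>1/2\<close> lies in the star of a vertex
  (\<open>short_path_in_star\<close>), and stars are finite unions of cubes because vertices have finitely many
  neighbours (\<open>finite_star\<close>). As the action is strongly simplicial, the cell around a fixed point
  is fixed pointwise, so there is a fixed vertex. The group permutes the neighbours of a fixed
  vertex. There are fewer than \<open>n + 1\<close> of them, and \<open>n + 1\<close> is at least \<open>5\<close>, so this permutation
  action is trivial, since the alternating group is simple and too large to act faithfully
  (\<open>alternating_action_trivial\<close>). Hence the neighbours are fixed vertices, too, and by
  connectedness everything is fixed (\<open>fixes_everything\<close>).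

  It remains to pass to the whole group. Let \<open>K\<close> be the kernel of the action. Modulo \<open>K\<close> a
  three-cycle of generators is trivial, which identifies the transvection \<open>x\<^sub>i \<mapsto> x\<^sub>i x\<^sub>j\<close> with \<open>x\<^sub>j
  \<mapsto> x\<^sub>j x\<^sub>k\<close> (\<open>transvection_conjugate\<close>). Their commutator is essentially \<open>x\<^sub>i \<mapsto> x\<^sub>i x\<^sub>k\<close>
  (\<open>transvection_commutator\<close>), so this one is in \<open>K\<close>, and in the same way all transvections are. By
  Nielsen reduction they generate \<open>SAut(F\<^sub>n)\<close> (\<open>transvections_generate_SAut\<close>).

  The geometry of a cube complex is accessible only through the glueings. The basic fact is that
  two cubes that meet induce the same metric on their intersection (\<open>transition_isometric\<close>). The
  relation \<open>between\<close> on points of a cube is determined by distances and therefore passes from cube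
  to cube; corners and smallest faces are expressed by it.
\<close>

section \<open>Actions of the alternating group on few points\<close>

abbreviation three_cycle :: "nat \<Rightarrow> nat \<Rightarrow> nat \<Rightarrow> nat \<Rightarrow> nat" where
  "three_cycle a b c \<equiv> cycle_of_list [a, b, c]"

lemma three_cycle_rotate: "distinct [a, b, c] \<Longrightarrow> three_cycle b c a = three_cycle a b c"
  by (auto simp: fun_eq_iff Transposition.transpose_def)

lemma three_cycle_comp_self:
  "distinct [a, b, c] \<Longrightarrow> three_cycle a b c \<circ> three_cycle a b c = three_cycle a c b"
  by (auto simp: fun_eq_iff Transposition.transpose_def)

lemma three_cycle_comp_reverse:
  "distinct [a, b, c] \<Longrightarrow> three_cycle a b c \<circ> three_cycle a c b = id"
  by (auto simp: fun_eq_iff Transposition.transpose_def)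

lemma three_cycle_comp_shared:
  assumes "distinct [a, b, c, d]"
  shows "three_cycle a d b \<circ> three_cycle a b c = three_cycle b c d"
proof
  fix x
  consider "x = a" | "x = b" | "x = c" | "x = d" | "x \<noteq> a" "x \<noteq> b" "x \<noteq> c" "x \<noteq> d"
    by blast
  then show "(three_cycle a d b \<circ> three_cycle a b c) x = three_cycle b c d x"
    by cases (use assms in \<open>simp_all add: Transposition.transpose_def\<close>)
qed

lemma three_cycle_alt:
  "distinct [a, b, c] \<Longrightarrow> {a, b, c} \<subseteq> {1..N} \<Longrightarrow> three_cycle a b c \<in> carrier (alt_group N)"
  by (rule subsetD[OF three_cycles_incl]) (auto intro!: exI[of _ "[a, b, c]"])

lemma three_cycle_inverse:
  assumes d: "distinct [a, b, c]" and sub: "{a, b, c} \<subseteq> {1..N}"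
  shows "inv\<^bsub>alt_group N\<^esub> (three_cycle a b c) = three_cycle a c b"
proof (rule group.inv_equality[OF alt_group_is_group])
  have d': "distinct [a, c, b]" and sub': "{a, c, b} \<subseteq> {1..N}"
    using d sub by auto
  show "three_cycle a c b \<otimes>\<^bsub>alt_group N\<^esub> three_cycle a b c = \<one>\<^bsub>alt_group N\<^esub>"
    unfolding alt_group_mult alt_group_one by (rule three_cycle_comp_reverse[OF d'])
  show "three_cycle a b c \<in> carrier (alt_group N)" "three_cycle a c b \<in> carrier (alt_group N)"
    by (rule three_cycle_alt[OF d sub], rule three_cycle_alt[OF d' sub'])
qed

lemma double_transposition_alt:
  assumes "distinct [a, b, c, d]" "{a, b, c, d} \<subseteq> {1..N}"
  shows "Transposition.transpose a b \<circ> Transposition.transpose c d \<in> carrier (alt_group N)"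
  using assms
  by (auto simp: alt_group_carrier permutes_compose permutes_swap_id evenperm_comp
      permutation_swap_id evenperm_swap)

lemma three_cycle_conj:
  assumes "\<sigma> \<in> carrier (alt_group N)" "distinct [a, b, c]"
  shows "\<sigma> \<circ> three_cycle a b c \<circ> inv' \<sigma> = three_cycle (\<sigma> a) (\<sigma> b) (\<sigma> c)"
proof -
  have "bij \<sigma>"
    using assms permutes_bij by (auto simp: alt_group_carrier)
  then show ?thesis
    using conjugation_of_cycle[of "[a, b, c]" \<sigma>] assms(2) by simp
qed

lemma alt_group_closed:
  assumes "\<sigma> \<in> carrier (alt_group N)"
  shows "\<tau> \<in> carrier (alt_group N) \<Longrightarrow> \<sigma> \<circ> \<tau> \<in> carrier (alt_group N)"
    and "inv' \<sigma> \<in> carrier (alt_group N)"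
    and "\<sigma> \<circ> inv' \<sigma> = id" "inv' \<sigma> \<circ> \<sigma> = id" "inj \<sigma>"
  using assms group.is_monoid[OF alt_group_is_group, THEN monoid.m_closed, of \<sigma> N \<tau>]
    alt_group_inv_closed[OF assms] permutes_inv_o permutes_inj
  by (auto simp: alt_group_mult alt_group_carrier)

text \<open>The values of \<open>f\<close> lie in any set with a binary operation. If \<open>f \<alpha> = f \<beta>\<close>, then conjugating
  \<open>\<alpha>\<close> and \<open>\<beta>\<close> by the same permutation, or multiplying both with it, still gives equal values.\<close>

locale alt_hom =
  fixes N :: nat and f :: "(nat \<Rightarrow> nat) \<Rightarrow> 'b" and mul :: "'b \<Rightarrow> 'b \<Rightarrow> 'b"
  assumes N: "N \<ge> 5"
    and hom: "\<And>\<sigma> \<tau>. \<sigma> \<in> carrier (alt_group N) \<Longrightarrow> \<tau> \<in> carrier (alt_group N) \<Longrightarrow>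
           f (\<sigma> \<circ> \<tau>) = mul (f \<sigma>) (f \<tau>)"
begin

lemma id_alt: "id \<in> carrier (alt_group N)"
  by (simp add: alt_group_carrier permutes_id evenperm_id)

text \<open>Conjugating an identity between the images of two three-cycles relabels both of them. Below,
  \<open>\<sigma>\<close> is chosen so that one of the two cycles is fixed or inverted while the other one changes.\<close>

lemma conj_eq:
  assumes "f (three_cycle a b c) = f (three_cycle a' b' c')"
    and "\<sigma> \<in> carrier (alt_group N)"
    and "distinct [a, b, c]" "{a, b, c} \<subseteq> {1..N}" "distinct [a', b', c']" "{a', b', c'} \<subseteq> {1..N}"
  shows "f (three_cycle (\<sigma> a) (\<sigma> b) (\<sigma> c)) = f (three_cycle (\<sigma> a') (\<sigma> b') (\<sigma> c'))"
proof -
  have "f (\<sigma> \<circ> three_cycle a b c \<circ> inv' \<sigma>) = f (\<sigma> \<circ> three_cycle a' b' c' \<circ> inv' \<sigma>)"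
    using assms alt_group_closed[OF assms(2)] three_cycle_alt
    by (simp only: hom alt_group_closed(1))
  then show ?thesis
    using three_cycle_conj[OF assms(2)] assms(3,5) by metis
qed

lemma reverse_eq:
  assumes "f (three_cycle a b c) = f (three_cycle a' b' c')"
    and "distinct [a, b, c]" "{a, b, c} \<subseteq> {1..N}" "distinct [a', b', c']" "{a', b', c'} \<subseteq> {1..N}"
  shows "f (three_cycle a c b) = f (three_cycle a' c' b')"
  using hom[OF three_cycle_alt[OF assms(2,3)] three_cycle_alt[OF assms(2,3)]]
    hom[OF three_cycle_alt[OF assms(4,5)] three_cycle_alt[OF assms(4,5)]]
    three_cycle_comp_self[OF assms(2)] three_cycle_comp_self[OF assms(4)] assms(1)
  by simp

definition "in_kernel a b c \<longleftrightarrow>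
  distinct [a, b, c] \<and> {a, b, c} \<subseteq> {1..N} \<and> f (three_cycle a b c) = f id"

text \<open>Two three-cycles \<open>(a b c)\<close> and \<open>(a b d)\<close> differ by the three-cycle \<open>(b c d)\<close>. Most cases of
  the argument below end in this way.\<close>

lemma shared_eq:
  assumes "f (three_cycle a b c) = f (three_cycle a b d)"
    and d: "distinct [a, b, c, d]" and sub: "{a, b, c, d} \<subseteq> {1..N}"
  shows "in_kernel b c d"
proof -
  have alt: "three_cycle a d b \<in> carrier (alt_group N)" "three_cycle a b c \<in> carrier (alt_group N)"
    "three_cycle a b d \<in> carrier (alt_group N)"
    using d sub by (auto intro!: three_cycle_alt simp del: cycle_of_list.simps)
  have "f (three_cycle b c d) = f (three_cycle a d b \<circ> three_cycle a b c)"
    using three_cycle_comp_shared[OF d] by simp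
  also have "\<dots> = f (three_cycle a d b \<circ> three_cycle a b d)"
    using hom alt assms(1) by (simp del: cycle_of_list.simps)
  also have "three_cycle a d b \<circ> three_cycle a b d = id"
    using three_cycle_comp_reverse[of a d b] d by auto
  finally have "f (three_cycle b c d) = f id" .
  moreover have "distinct [b, c, d]" "{b, c, d} \<subseteq> {1..N}"
    using d sub by auto
  ultimately show ?thesis
    unfolding in_kernel_def by blast
qed

lemma fifth_letter:
  assumes "finite S" "card S \<le> 4"
  obtains g where "g \<in> {1..N}" "g \<notin> S"
proof -
  have "\<not> {1..N} \<subseteq> S"
    using card_mono[OF assms(1), of "{1..N}"] assms(2) N by auto
  then show thesis
    using that by blast
qed

text \<open>The simplicity argument. Let \<open>\<sigma>\<close> be a nontrivial element of the kernel and let \<open>\<sigma>\<close> move \<open>a\<close>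
  to \<open>b\<close>. Then \<open>(a b c)\<close> and its conjugate \<open>(b d e)\<close> under \<open>\<sigma>\<close> have the same image. How many of the
  letters coincide depends on \<open>\<sigma>\<close>. Either the two three-cycles are inverse to each other, so that
  the first one is in the kernel, or a further conjugation, which may need a fifth letter, gives
  two three-cycles with the same image which share two letters in the same cyclic order.\<close>

lemma kernel_three_cycle:
  assumes \<sigma>: "\<sigma> \<in> carrier (alt_group N)" "f \<sigma> = f id" "\<sigma> \<noteq> id"
  shows "\<exists>a b c. in_kernel a b c"
proof -
  note [simp del] = cycle_of_list.simps and [[linarith_neq_limit = 0]]
  have perm: "\<sigma> permutes {1..N}"
    using \<sigma>(1) by (simp add: alt_group_carrier)
  obtain a where a: "\<sigma> a \<noteq> a"
    using \<sigma>(3) by fastforce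
  define b where "b = \<sigma> a"
  define d where "d = \<sigma> b"
  have aN: "a \<in> {1..N}"
    using a perm by (auto simp: permutes_def)
  then have bN: "b \<in> {1..N}"
    unfolding b_def using permutes_in_image[OF perm] by blast
  then have dN: "d \<in> {1..N}"
    unfolding d_def using permutes_in_image[OF perm] by blast
  \<comment> \<open>Excluding \<open>d\<close> and the preimage of \<open>a\<close> gives \<open>c \<noteq> d\<close> and \<open>e \<noteq> a\<close>; this leaves four cases.\<close>
  have "card {a, b, d, inv' \<sigma> a} \<le> 4"
    by (simp add: card_insert_if)
  then obtain c where cN: "c \<in> {1..N}" and c: "c \<notin> {a, b, d, inv' \<sigma> a}"
    using fifth_letter[of "{a, b, d, inv' \<sigma> a}"] by auto
  define e where "e = \<sigma> c"
  have eN: "e \<in> {1..N}"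
    unfolding e_def using permutes_in_image[OF perm] cN by blast
  have ea: "e \<noteq> a"
    using c perm by (auto simp: e_def permutes_inverses)
  have neq: "b \<noteq> a" "c \<noteq> a" "c \<noteq> b" "d \<noteq> c" "d \<noteq> b" "e \<noteq> b" "e \<noteq> d"
    using a c injD[OF permutes_inj[OF perm]] by (auto simp: b_def d_def e_def)
  have eq: "f (three_cycle a b c) = f (three_cycle b d e)"
  proof -
    have alt: "three_cycle a b c \<in> carrier (alt_group N)"
      using neq aN bN cN by (auto intro!: three_cycle_alt)
    have "f (inv' \<sigma>) = f (id \<circ> inv' \<sigma>)"
      by simp
    also have "\<dots> = f (\<sigma> \<circ> inv' \<sigma>)"
      by (simp only: hom id_alt alt_group_closed(2)[OF \<sigma>(1)] \<sigma>(1,2))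
    finally have inv: "f (inv' \<sigma>) = f id"
      using alt_group_closed(3)[OF \<sigma>(1)] by simp
    have "three_cycle b d e = \<sigma> \<circ> three_cycle a b c \<circ> inv' \<sigma>"
      using three_cycle_conj[OF \<sigma>(1), of a b c] neq by (auto simp: b_def d_def e_def)
    then have "f (three_cycle b d e) = f (id \<circ> three_cycle a b c \<circ> id)"
      by (simp only: hom id_alt alt_group_closed alt \<sigma> inv)
    then show ?thesis
      by simp
  qed
  show ?thesis
  proof (cases "d = a")
    case da: True
    show ?thesis
    proof (cases "e = c")
      case True
      have "f (three_cycle a b c) = f (three_cycle a c b)"
        using eq da True three_cycle_rotate[of b a c] three_cycle_rotate[of a c b] neq by simp
      moreover have "three_cycle a b c \<in> carrier (alt_group N)" "three_cycle a c b \<in> carrier (alt_group N)"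
        using neq aN bN cN by (auto intro!: three_cycle_alt)
      ultimately have "f (three_cycle a b c \<circ> three_cycle a b c) =
          f (three_cycle a b c \<circ> three_cycle a c b)"
        by (simp only: hom)
      then have "in_kernel a c b"
        using neq aN bN cN three_cycle_comp_self[of a b c] three_cycle_comp_reverse[of a b c]
        by (auto simp: in_kernel_def)
      then show ?thesis
        by blast
    next
      case False
      have "card {a, b, c, e} \<le> 4"
        by (simp add: card_insert_if)
      then obtain g where gN: "g \<in> {1..N}" and g: "g \<notin> {a, b, c, e}"
        using fifth_letter[of "{a, b, c, e}"] by auto
      let ?s = "Transposition.transpose a b \<circ> Transposition.transpose c g"
      have "f (three_cycle (?s a) (?s b) (?s c)) = f (three_cycle (?s b) (?s a) (?s e))"
        by (rule conj_eq[OF eq[unfolded da] double_transposition_alt])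
          (use g gN aN bN cN eN neq False ea in auto)
      moreover have "?s a = b" "?s b = a" "?s c = g" "?s e = e"
        using g neq False ea by (auto simp: Transposition.transpose_def)
      ultimately have 1: "f (three_cycle b a g) = f (three_cycle a b e)"
        by simp
      have "f (three_cycle a c b) = f (three_cycle b e a)"
        by (rule reverse_eq[OF eq[unfolded da]]) (use aN bN cN eN neq ea in auto)
      moreover have "three_cycle a c b = three_cycle b a c" "three_cycle b e a = three_cycle a b e"
        using three_cycle_rotate[of b a c] three_cycle_rotate[of a b e] neq ea False
        by auto
      ultimately have "in_kernel a c g"
        using shared_eq[of b a c g] 1 g gN aN bN cN eN neq by auto
      then show ?thesis
        by blast
    qed
  next
    case da: False
    show ?thesis
    proof (cases "e = c")
      case True
      have "card {a, b, c, d} \<le> 4"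
        by (simp add: card_insert_if)
      then obtain g where gN: "g \<in> {1..N}" and g: "g \<notin> {a, b, c, d}"
        using fifth_letter[of "{a, b, c, d}"] by auto
      let ?s = "Transposition.transpose b c \<circ> Transposition.transpose d g"
      have "f (three_cycle (?s a) (?s b) (?s c)) = f (three_cycle (?s b) (?s d) (?s c))"
        by (rule conj_eq[OF eq[unfolded True] double_transposition_alt])
          (use g gN aN bN cN dN neq da in auto)
      moreover have "?s a = a" "?s b = c" "?s c = b" "?s d = g"
        using g neq da by (auto simp: Transposition.transpose_def)
      ultimately have 1: "f (three_cycle a c b) = f (three_cycle c g b)"
        by simp
      have "f (three_cycle a c b) = f (three_cycle b c d)"
        by (rule reverse_eq[OF eq[unfolded True]]) (use aN bN cN dN neq da in auto)
      moreover have "three_cycle c g b = three_cycle b c g"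
        using three_cycle_rotate[of b c g] g neq by auto
      ultimately have "in_kernel c d g"
        using shared_eq[of b c d g] 1 g gN aN bN cN dN neq by auto
      then show ?thesis
        by blast
    next
      case False
      let ?s = "three_cycle a b c"
      have s: "?s a = b" "?s b = c" "?s c = a" "?s d = d" "?s e = e"
        using neq da ea False by (auto simp: Transposition.transpose_def cycle_of_list.simps)
      have "f (three_cycle (?s a) (?s b) (?s c)) = f (three_cycle (?s b) (?s d) (?s e))"
        by (rule conj_eq[OF eq three_cycle_alt])
          (use aN bN cN dN eN neq da ea in auto)
      then have "f (three_cycle b c a) = f (three_cycle c d e)"
        by (simp only: s)
      moreover have "three_cycle b c a = three_cycle a b c" "three_cycle b d e = three_cycle d e b"
          "three_cycle c d e = three_cycle d e c"
        using three_cycle_rotate[of a b c] three_cycle_rotate[of b d e]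
          three_cycle_rotate[of c d e] neq False
        by auto
      ultimately have "in_kernel e b c"
        using shared_eq[of d e b c] eq aN bN cN dN eN neq False by auto
      then show ?thesis
        by blast
    qed
  qed
qed

lemma in_kernel_rotate: "in_kernel a b c \<Longrightarrow> in_kernel b c a"
  using three_cycle_rotate[of a b c] by (auto simp: in_kernel_def simp del: cycle_of_list.simps)

lemma in_kernel_reverse:
  assumes "in_kernel a b c"
  shows "in_kernel a c b"
proof -
  have d: "distinct [a, b, c]" and sub: "{a, b, c} \<subseteq> {1..N}"
    using assms by (auto simp: in_kernel_def)
  have "f (three_cycle a c b) = f (three_cycle a b c \<circ> three_cycle a b c)"
    using three_cycle_comp_self[OF d] by simp
  also have "\<dots> = f (id \<circ> id)"
    using hom[OF three_cycle_alt[OF d sub] three_cycle_alt[OF d sub]] hom[OF id_alt id_alt] assms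
    by (simp add: in_kernel_def del: cycle_of_list.simps)
  finally show ?thesis
    using d sub by (auto simp: in_kernel_def)
qed

text \<open>Conjugation by the even permutation \<open>(a b)(c d)\<close> replaces \<open>c\<close> by \<open>d\<close> and reverses the cycle.\<close>

lemma in_kernel_exchange:
  assumes "in_kernel a b c" "d \<in> {1..N}" "d \<noteq> a" "d \<noteq> b"
  shows "in_kernel a b d"
proof (cases "d = c")
  case False
  let ?s = "Transposition.transpose a b \<circ> Transposition.transpose c d"
  have d: "distinct [a, b, c]" and sub: "{a, b, c} \<subseteq> {1..N}"
    and k: "f (three_cycle a b c) = f id"
    using assms by (auto simp: in_kernel_def)
  have s: "?s \<in> carrier (alt_group N)"
    by (rule double_transposition_alt) (use d sub False assms in auto)
  have 1: "f (?s \<circ> three_cycle a b c \<circ> inv' ?s) = f (?s \<circ> id \<circ> inv' ?s)"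
    by (simp only: hom s alt_group_closed[OF s] alt_group_closed(1) id_alt k three_cycle_alt[OF d sub])
  have "?s a = b" "?s b = a" "?s c = d"
    using d False assms(3,4) by (auto simp: Transposition.transpose_def)
  then have "?s \<circ> three_cycle a b c \<circ> inv' ?s = three_cycle b a d"
    using three_cycle_conj[OF s d] by (simp only:)
  with 1 have "f (three_cycle b a d) = f id"
    using alt_group_closed(3)[OF s] by simp
  then have "in_kernel b a d"
    using d sub assms by (auto simp: in_kernel_def)
  then show ?thesis
    using in_kernel_reverse in_kernel_rotate by blast
qed (use assms in simp)

text \<open>Any three letters are reached by exchanging one letter at a time.\<close>

lemma all_in_kernel:
  assumes "in_kernel a b c" "distinct [x, y, z]" "{x, y, z} \<subseteq> {1..N}"
  shows "in_kernel x y z"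
proof -
  have "\<exists>b c. in_kernel x b c"
    using assms in_kernel_exchange[OF assms(1), of x] in_kernel_rotate by (metis insert_subset)
  then obtain b c where x: "in_kernel x b c"
    by blast
  have "\<exists>c. in_kernel x y c"
    using assms in_kernel_exchange[OF x, of y] in_kernel_rotate[of x y] in_kernel_reverse x
    by (metis distinct_length_2_or_more insert_subset)
  then show ?thesis
    using assms in_kernel_exchange by auto
qed

lemma trivial_if_not_inj:
  assumes "\<not> inj_on f (carrier (alt_group N))" and "\<sigma> \<in> carrier (alt_group N)"
  shows "f \<sigma> = f id"
proof -
  obtain \<alpha> \<beta> where ab: "\<alpha> \<in> carrier (alt_group N)" "\<beta> \<in> carrier (alt_group N)"
      "f \<alpha> = f \<beta>" "\<alpha> \<noteq> \<beta>"
    using assms(1) by (auto simp: inj_on_def)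
  define \<gamma> where "\<gamma> = inv' \<alpha> \<circ> \<beta>"
  have "f \<gamma> = f (inv' \<alpha> \<circ> \<alpha>)"
    unfolding \<gamma>_def by (simp only: hom alt_group_closed(2)[OF ab(1)] ab)
  then have "f \<gamma> = f id"
    using alt_group_closed(4)[OF ab(1)] by simp
  moreover have "\<gamma> \<noteq> id"
  proof
    assume "\<gamma> = id"
    then have "\<alpha> \<circ> (inv' \<alpha> \<circ> \<beta>) = \<alpha>"
      by (simp add: \<gamma>_def)
    then show False
      using alt_group_closed(3)[OF ab(1)] ab(4) by (simp add: o_assoc)
  qed
  moreover have "\<gamma> \<in> carrier (alt_group N)"
    unfolding \<gamma>_def using alt_group_closed ab by blast
  ultimately obtain a b c where abc: "in_kernel a b c"
    using kernel_three_cycle by blast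
  have "\<sigma> \<in> generate (alt_group N) (three_cycles N)"
    using assms(2) alt_group_carrier_as_three_cycles by blast
  then show ?thesis
  proof induction
    case one
    then show ?case by (simp add: alt_group_one)
  next
    case (incl h)
    then obtain x y z where "h = three_cycle x y z" "distinct [x, y, z]" "{x, y, z} \<subseteq> {1..N}"
      by (auto simp: length_Suc_conv eval_nat_numeral simp del: cycle_of_list.simps)
    then show ?case
      using all_in_kernel[OF abc, of x y z] unfolding in_kernel_def by blast
  next
    case (inv h)
    then obtain x y z where h: "h = three_cycle x y z" "distinct [x, y, z]" "{x, y, z} \<subseteq> {1..N}"
      by (auto simp: length_Suc_conv eval_nat_numeral simp del: cycle_of_list.simps)
    have "inv\<^bsub>alt_group N\<^esub> h = three_cycle x z y"
      using three_cycle_inverse[OF h(2,3)] unfolding h(1) .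
    then show ?case
      using all_in_kernel[OF abc, of x z y] h unfolding in_kernel_def
      by (metis distinct_length_2_or_more insert_commute)
  next
    case (eng h1 h2)
    then have "h1 \<in> carrier (alt_group N)" "h2 \<in> carrier (alt_group N)"
      using alt_group_carrier_as_three_cycles by blast+
    then show ?case
      using eng.IH hom hom[OF id_alt id_alt] unfolding alt_group_mult by (metis id_comp)
  qed
qed

end

text \<open>The alternating group on \<open>N\<close> letters has \<open>N! / 2\<close> elements, more than the symmetric group on
  fewer than \<open>N\<close> points, so the action is not faithful, and then it is trivial by simplicity.\<close>

theorem alternating_action_trivial:
  fixes act :: "(nat \<Rightarrow> nat) \<Rightarrow> 'a \<Rightarrow> 'a"
  assumes "N \<ge> 5" "finite \<Omega>" "card \<Omega> < N"
    and closed: "\<And>\<sigma> x. \<sigma> \<in> carrier (alt_group N) \<Longrightarrow> x \<in> \<Omega> \<Longrightarrow> act \<sigma> x \<in> \<Omega>"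
    and comp: "\<And>\<sigma> \<tau> x. \<sigma> \<in> carrier (alt_group N) \<Longrightarrow> \<tau> \<in> carrier (alt_group N) \<Longrightarrow> x \<in> \<Omega> \<Longrightarrow>
       act (\<sigma> \<circ> \<tau>) x = act \<sigma> (act \<tau> x)"
    and id: "\<And>x. x \<in> \<Omega> \<Longrightarrow> act id x = x"
    and "\<sigma> \<in> carrier (alt_group N)" "x \<in> \<Omega>"
  shows "act \<sigma> x = x"
proof -
  let ?f = "\<lambda>\<sigma> x. if x \<in> \<Omega> then act \<sigma> x else x"
  interpret alt_hom N ?f "(\<circ>)"
    by unfold_locales (use assms in \<open>auto simp: fun_eq_iff\<close>)
  have perm: "?f \<sigma> permutes \<Omega>" if \<sigma>: "\<sigma> \<in> carrier (alt_group N)" for \<sigma>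
  proof (rule bij_imp_permutes)
    show "bij_betw (?f \<sigma>) \<Omega> \<Omega>"
    proof (rule bij_betw_byWitness[where f' = "act (inv' \<sigma>)"])
      show "\<forall>x\<in>\<Omega>. act (inv' \<sigma>) (?f \<sigma> x) = x"
        using comp[OF alt_group_closed(2)[OF \<sigma>] \<sigma>] alt_group_closed(4)[OF \<sigma>] id by simp
      show "\<forall>x\<in>\<Omega>. ?f \<sigma> (act (inv' \<sigma>) x) = x"
        using comp[OF \<sigma> alt_group_closed(2)[OF \<sigma>]] alt_group_closed(3)[OF \<sigma>] id
          closed alt_group_closed(2)[OF \<sigma>] by simp
    qed (use closed \<sigma> alt_group_closed(2)[OF \<sigma>] in auto)
  qed simp
  have "\<not> inj_on ?f (carrier (alt_group N))"
  proof
    assume inj: "inj_on ?f (carrier (alt_group N))"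
    have "card (carrier (alt_group N)) \<le> card {p. p permutes \<Omega>}"
      by (rule card_inj_on_le[OF inj]) (use perm finite_permutations[OF assms(2)] in auto)
    then have "fact N \<le> 2 * (fact (card \<Omega>) :: nat)"
      using alt_group_card_carrier[of N] assms(1) card_permutations[OF refl assms(2)] by linarith
    also have "\<dots> \<le> 2 * fact (N - 1)"
      using assms(3) by (intro mult_left_mono fact_mono) auto
    also have "\<dots> < N * fact (N - 1)"
      using assms(1) by (intro mult_strict_right_mono) auto
    also have "\<dots> = fact N"
      using assms(1) fact_reduce[of N, where 'a = nat] by simp
    finally show False
      by simp
  qed
  then have "?f \<sigma> = ?f id"
    using trivial_if_not_inj assms by blast
  then show ?thesis
    using assms(8) id by metis
qed

section \<open>Points and faces of a cube\<close>

text \<open>The point \<open>y\<close> divides the segment from \<open>u\<close> to \<open>z\<close> in the ratio \<open>s\<close> to \<open>1 - s\<close>. By strict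
  convexity of the Euclidean norm this is a statement about the three distances, so isometries
  preserve it; all transfer of information between cubes below goes through this relation.\<close>

definition between :: "nat \<Rightarrow> real \<Rightarrow> pt \<Rightarrow> pt \<Rightarrow> pt \<Rightarrow> bool" where
  "between d s u y z \<longleftrightarrow> (\<forall>i<d. y i = u i + s * (z i - u i))"

definition corner :: "nat \<Rightarrow> pt \<Rightarrow> bool" where
  "corner d u \<longleftrightarrow> u \<in> unit_cube d \<and> (\<forall>i<d. u i = 0 \<or> u i = 1)"

lemma unit_cube_iff:
  "x \<in> unit_cube d \<longleftrightarrow> (\<forall>i<d. 0 \<le> x i \<and> x i \<le> 1) \<and> x \<in> extensional {..<d}"
  by (auto simp: unit_cube_def PiE_def)

lemma unit_cube_eqI:
  "x \<in> unit_cube d \<Longrightarrow> y \<in> unit_cube d \<Longrightarrow> (\<And>i. i < d \<Longrightarrow> x i = y i) \<Longrightarrow> x = y"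
  by (auto simp: unit_cube_iff intro: extensionalityI)

lemma cube_dist_nonneg [simp]: "0 \<le> cube_dist d x y"
  by (simp add: cube_dist_def L2_set_nonneg)

lemma cube_dist_commute: "cube_dist d x y = cube_dist d y x"
  by (simp add: cube_dist_def L2_set_def power2_commute)

lemma cube_dist_square: "(cube_dist d x y)\<^sup>2 = (\<Sum>i<d. (x i - y i)\<^sup>2)"
  by (simp add: cube_dist_def L2_set_def sum_nonneg)

lemma coordinate_le_cube_dist:
  assumes "i < d"
  shows "\<bar>x i - y i\<bar> \<le> cube_dist d x y"
proof (rule power2_le_imp_le)
  show "\<bar>x i - y i\<bar>\<^sup>2 \<le> (cube_dist d x y)\<^sup>2"
    using member_le_sum[of i "{..<d}" "\<lambda>i. (x i - y i)\<^sup>2"] assms by (simp add: cube_dist_square)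
qed simp

lemma between_dist:
  assumes "0 \<le> s" "s \<le> 1" "between d s u y z"
  shows "cube_dist d u y = s * cube_dist d u z" "cube_dist d y z = (1 - s) * cube_dist d u z"
proof -
  have uy: "u i - y i = s * (u i - z i)" if "i < d" for i
    using assms(3) that by (simp add: between_def algebra_simps)
  have "(cube_dist d u y)\<^sup>2 = (s * cube_dist d u z)\<^sup>2"
    by (simp add: cube_dist_square power_mult_distrib sum_distrib_left uy)
  then show "cube_dist d u y = s * cube_dist d u z"
    using assms(1) by (subst (asm) power2_eq_iff_nonneg) auto
  have "y i - z i = (1 - s) * (u i - z i)" if "i < d" for i
    using assms(3) that by (simp add: between_def algebra_simps)
  then have "(cube_dist d y z)\<^sup>2 = ((1 - s) * cube_dist d u z)\<^sup>2"
    by (simp add: cube_dist_square power_mult_distrib sum_distrib_left)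
  then show "cube_dist d y z = (1 - s) * cube_dist d u z"
    using assms(2) by (subst (asm) power2_eq_iff_nonneg) auto
qed

text \<open>Stewart's identity, summed over the coordinates, expresses the squared distance of \<open>y\<close> from
  the dividing point by the three given distances, and the result is \<open>0\<close>.\<close>

lemma dist_between:
  assumes "cube_dist d u y = s * cube_dist d u z" "cube_dist d y z = (1 - s) * cube_dist d u z"
  shows "between d s u y z"
proof -
  have stewart: "(y i - u i - s * (z i - u i))\<^sup>2 =
      (1 - s) * (u i - y i)\<^sup>2 + s * (y i - z i)\<^sup>2 - s * (1 - s) * (u i - z i)\<^sup>2" for i
    by (simp add: power2_eq_square algebra_simps)
  have "(\<Sum>i<d. (y i - u i - s * (z i - u i))\<^sup>2) =
      (1 - s) * (cube_dist d u y)\<^sup>2 + s * (cube_dist d y z)\<^sup>2 - s * (1 - s) * (cube_dist d u z)\<^sup>2"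
    by (simp add: stewart cube_dist_square sum.distrib sum_subtractf sum_distrib_left)
  also have "\<dots> = 0"
    by (simp add: assms power2_eq_square algebra_simps)
  finally show ?thesis
    by (subst (asm) sum_nonneg_eq_0_iff) (auto simp: between_def algebra_simps)
qed

lemma between_isometric:
  assumes "between d s u y z" "0 \<le> s" "s \<le> 1"
    and "cube_dist e u' y' = cube_dist d u y" "cube_dist e y' z' = cube_dist d y z"
    and "cube_dist e u' z' = cube_dist d u z"
  shows "between e s u' y' z'"
  using between_dist[OF assms(2,3,1)] assms by (intro dist_between) auto

lemma cube_faceE:
  assumes "cube_face d k F"
  obtains S where "\<forall>i<d. S i = {0} \<or> S i = {1} \<or> S i = {0..1}"
    "k = card {i. i < d \<and> S i = {0..1}}" "F = (\<Pi>\<^sub>E i\<in>{..<d}. S i)"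
  using assms unfolding cube_face_def by (elim exE conjE)

lemma cube_face_subset:
  assumes "cube_face d k F"
  shows "F \<subseteq> unit_cube d"
proof -
  obtain S where S0: "\<forall>i<d. S i = {0} \<or> S i = {1} \<or> S i = {0..1}"
    and k: "k = card {i. i < d \<and> S i = {0..1}}" and FS: "F = (\<Pi>\<^sub>E i\<in>{..<d}. S i)"
    using cube_faceE[OF assms] by blast
  note S = S0[rule_format]
  have "S i \<subseteq> {0..1}" if "i \<in> {..<d}" for i
  proof -
    have "S i = {0} \<or> S i = {1} \<or> S i = {0..1}"
      using S that by simp
    then show ?thesis
      by (elim disjE) simp_all
  qed
  then show ?thesis
    unfolding FS unit_cube_def by (rule PiE_mono)
qed

lemma cube_face_unit_cube: "cube_face d d (unit_cube d)"
  unfolding cube_face_def unit_cube_def by (intro exI[of _ "\<lambda>_. {0..1}"]) auto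

text \<open>Faces are extreme subsets: a coordinate that is \<open>0\<close> or \<open>1\<close> on the face attains its minimum
  or maximum at \<open>y\<close>, hence also at the two endpoints.\<close>

lemma cube_face_extreme:
  assumes F: "cube_face d k F" and "y \<in> F" "u \<in> unit_cube d" "z \<in> unit_cube d"
    and s: "0 < s" "s < 1" and b: "between d s u y z"
  shows "u \<in> F" "z \<in> F"
proof -
  obtain S where S0: "\<forall>i<d. S i = {0} \<or> S i = {1} \<or> S i = {0..1}"
    and k: "k = card {i. i < d \<and> S i = {0..1}}" and FS: "F = (\<Pi>\<^sub>E i\<in>{..<d}. S i)"
    using cube_faceE[OF F] by blast
  note S = S0[rule_format]
  have "u i \<in> S i \<and> z i \<in> S i" if i: "i < d" for i
  proof -
    have uz: "0 \<le> u i" "u i \<le> 1" "0 \<le> z i" "z i \<le> 1"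
      using assms(3,4) i by (auto simp: unit_cube_iff)
    have y: "y i = (1 - s) * u i + s * z i"
      using b i by (simp add: between_def algebra_simps)
    have yS: "y i \<in> S i"
      using assms(2) i by (auto simp: FS)
    consider "S i = {0}" | "S i = {1}" | "S i = {0..1}"
      using S[OF i] by blast
    then show ?thesis
    proof cases
      case 1
      then have "(1 - s) * u i + s * z i = 0"
        using y yS by simp
      moreover have "0 \<le> (1 - s) * u i" "0 \<le> s * z i"
        using uz s by auto
      ultimately have "(1 - s) * u i = 0" "s * z i = 0"
        by linarith+
      then show ?thesis
        using 1 s by simp
    next
      case 2
      then have "(1 - s) * (1 - u i) + s * (1 - z i) = 0"
        using y yS by (simp add: algebra_simps)
      moreover have "0 \<le> (1 - s) * (1 - u i)" "0 \<le> s * (1 - z i)"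
        using uz s by auto
      ultimately have "(1 - s) * (1 - u i) = 0" "s * (1 - z i) = 0"
        by linarith+
      then show ?thesis
        using 2 s by simp
    next
      case 3
      then show ?thesis using uz by simp
    qed
  qed
  then show "u \<in> F" "z \<in> F"
    using assms(3,4) by (auto simp: FS unit_cube_def PiE_iff)
qed

text \<open>The set \<open>S\<close> is symmetric about its point \<open>b\<close>. Together with extremality this forces every
  face that contains \<open>b\<close> to contain \<open>S\<close>.\<close>

definition centred :: "nat \<Rightarrow> pt \<Rightarrow> pt set \<Rightarrow> bool" where
  "centred d b S \<longleftrightarrow> b \<in> S \<and> S \<subseteq> unit_cube d \<and> (\<forall>x\<in>S. \<exists>x'\<in>S. between d (1/2) x b x')"

lemma cube_face_centred:
  assumes "cube_face d k F"
  shows "\<exists>b. centred d b F"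
proof -
  obtain S where S0: "\<forall>i<d. S i = {0} \<or> S i = {1} \<or> S i = {0..1}"
    and k: "k = card {i. i < d \<and> S i = {0..1}}" and FS: "F = (\<Pi>\<^sub>E i\<in>{..<d}. S i)"
    using cube_faceE[OF assms] by blast
  note S = S0[rule_format]
  define b :: pt where "b = (\<lambda>i\<in>{..<d}. if S i = {0} then 0 else if S i = {1} then 1 else 1/2)"
  have "b \<in> F"
    using S by (force simp: FS b_def PiE_iff)
  moreover have "\<exists>x'\<in>F. between d (1/2) x b x'" if x: "x \<in> F" for x
  proof (intro bexI)
    let ?x' = "\<lambda>i\<in>{..<d}. 2 * b i - x i"
    show "between d (1/2) x b ?x'"
      by (simp add: between_def field_simps)
    have "2 * b i - x i \<in> S i" if i: "i < d" for i
    proof -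
      have xi: "x i \<in> S i"
        using x i by (auto simp: FS)
      consider "S i = {0}" | "S i = {1}" | "S i = {0..1}" "S i \<noteq> {0}" "S i \<noteq> {1}"
        using S[OF i] by argo
      then show ?thesis
        using xi i by cases (simp_all add: b_def)
    qed
    then show "?x' \<in> F"
      by (auto simp: FS)
  qed
  ultimately show ?thesis
    using cube_face_subset[OF assms] by (auto simp: centred_def)
qed

lemma cornerD: "corner d u \<Longrightarrow> u \<in> unit_cube d" "corner d u \<Longrightarrow> l < d \<Longrightarrow> u l = 0 \<or> u l = 1"
  by (auto simp: corner_def)

text \<open>The metric description of corners, which makes them invariant under changing the cube.\<close>

lemma corner_iff_extreme:
  assumes "u \<in> unit_cube d"
  shows "corner d u \<longleftrightarrow> (\<forall>a\<in>unit_cube d. \<forall>b\<in>unit_cube d. between d (1/2) a u b \<longrightarrow> a = b)"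
proof
  assume u: "corner d u"
  show "\<forall>a\<in>unit_cube d. \<forall>b\<in>unit_cube d. between d (1/2) a u b \<longrightarrow> a = b"
  proof (intro ballI impI unit_cube_eqI)
    fix a b l
    assume ab: "a \<in> unit_cube d" "b \<in> unit_cube d" "between d (1/2) a u b" and l: "l < d"
    have "0 \<le> a l" "a l \<le> 1" "0 \<le> b l" "b l \<le> 1" "u l = (a l + b l) / 2"
      using ab l by (auto simp: unit_cube_iff between_def field_simps)
    then show "a l = b l"
      using cornerD(2)[OF u l] by auto
  qed
next
  assume ext: "\<forall>a\<in>unit_cube d. \<forall>b\<in>unit_cube d. between d (1/2) a u b \<longrightarrow> a = b"
  show "corner d u"
  proof (rule ccontr)
    assume "\<not> corner d u"
    then obtain l where l: "l < d" "u l \<noteq> 0" "u l \<noteq> 1"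
      using assms by (auto simp: corner_def)
    have ul: "0 \<le> u l" "u l \<le> 1"
      using assms l(1) by (auto simp: unit_cube_iff)
    define e where "e = min (u l) (1 - u l)"
    have e: "0 < e" "e \<le> u l" "e \<le> 1 - u l"
      using ul l by (auto simp: e_def)
    have "u(l := u l - e) \<in> unit_cube d" "u(l := u l + e) \<in> unit_cube d"
      using assms l(1) e ul by (auto simp: unit_cube_iff extensional_def)
    moreover have "between d (1/2) (u(l := u l - e)) u (u(l := u l + e))"
      by (auto simp: between_def)
    ultimately have "u(l := u l - e) = u(l := u l + e)"
      using ext by blast
    then have "(u(l := u l - e)) l = (u(l := u l + e)) l"
      by (rule fun_cong)
    then show False
      using e(1) by simp
  qed
qed

text \<open>The smallest face of the cube that contains \<open>x\<close>.\<close>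

definition min_face :: "nat \<Rightarrow> pt \<Rightarrow> pt set" where
  "min_face d x = (\<Pi>\<^sub>E l\<in>{..<d}. if x l = 0 then {0} else if x l = 1 then {1} else {0..1})"

lemma min_face_subset: "min_face d x \<subseteq> unit_cube d"
  unfolding min_face_def unit_cube_def by (rule PiE_mono) simp

lemma min_face_cube_face: "\<exists>k. cube_face d k (min_face d x)"
  unfolding cube_face_def min_face_def
  by (rule exI[of _ "card {l. l < d \<and> (if x l = 0 then {0} else if x l = 1 then {1} else {0..1::real}) = {0..1}}"],
      rule exI[of _ "\<lambda>l. if x l = 0 then {0} else if x l = 1 then {1} else {0..1}"]) simp

lemma min_face_self: "x \<in> unit_cube d \<Longrightarrow> x \<in> min_face d x"
  by (auto simp: min_face_def unit_cube_iff PiE_iff)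

text \<open>The segments that pass through \<open>x\<close> fill its smallest face: from any \<open>u\<close> in this face the
  segment to \<open>x\<close> can be prolonged a little, because the coordinates that vary on the face are
  strictly between \<open>0\<close> and \<open>1\<close> at \<open>x\<close>. The right hand side only speaks of distances, so it can be
  carried from one cube to another one.\<close>

lemma min_face_iff:
  assumes x: "x \<in> unit_cube d"
  shows "u \<in> min_face d x \<longleftrightarrow>
    u \<in> unit_cube d \<and> (\<exists>s z. 0 < s \<and> s < 1 \<and> z \<in> unit_cube d \<and> between d s u x z)"
proof (intro iffI conjI)
  assume u: "u \<in> min_face d x"
  then show uc: "u \<in> unit_cube d"
    using min_face_subset by blast
  \<comment> \<open>The least distance of the free coordinates of \<open>x\<close> from \<open>0\<close> and \<open>1\<close>; the \<open>1\<close> covers the case that there are none.\<close>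
  define \<delta> where "\<delta> = Min (insert 1 ((\<lambda>l. min (x l) (1 - x l)) ` {l. l < d \<and> x l \<noteq> 0 \<and> x l \<noteq> 1}))"
  have fin: "finite (insert 1 ((\<lambda>l. min (x l) (1 - x l)) ` {l. l < d \<and> x l \<noteq> 0 \<and> x l \<noteq> 1}))"
    by simp
  have xl: "0 \<le> x l" "x l \<le> 1" if "l < d" for l
    using x that by (auto simp: unit_cube_iff)
  have \<delta>0: "0 < \<delta>"
    unfolding \<delta>_def using fin xl by (subst Min_gr_iff) (auto simp: less_le)
  have \<delta>l: "\<delta> \<le> x l" "\<delta> \<le> 1 - x l" if "l < d" "x l \<noteq> 0" "x l \<noteq> 1" for l
  proof -
    have "\<delta> \<le> min (x l) (1 - x l)"
      unfolding \<delta>_def by (rule Min_le[OF fin]) (use that in blast)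
    then show "\<delta> \<le> x l" "\<delta> \<le> 1 - x l"
      by simp_all
  qed
  define z where "z = (\<lambda>l\<in>{..<d}. x l + \<delta> * (x l - u l))"
  have "0 \<le> x l + \<delta> * (x l - u l) \<and> x l + \<delta> * (x l - u l) \<le> 1" if l: "l < d" for l
  proof -
    have ul: "0 \<le> u l" "u l \<le> 1"
      using uc l by (auto simp: unit_cube_iff)
    have um: "u l \<in> (if x l = 0 then {0} else if x l = 1 then {1} else {0..1})"
      using u l unfolding min_face_def by blast
    show ?thesis
    proof (cases "x l = 0 \<or> x l = 1")
      case True
      then have "u l = x l"
        using um by (auto split: if_splits)
      then show ?thesis
        using xl[OF l] by simp
    next
      case False
      have "\<bar>\<delta> * (x l - u l)\<bar> \<le> \<delta> * 1"
        unfolding abs_mult using \<delta>0 ul xl[OF l] by (intro mult_mono) auto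
      then show ?thesis
        using \<delta>l[OF l] False by auto
    qed
  qed
  then have "z \<in> unit_cube d"
    by (auto simp: unit_cube_iff z_def)
  moreover have "between d (1 / (1 + \<delta>)) u x z"
    using \<delta>0 by (simp add: between_def z_def field_simps)
  ultimately show "\<exists>s z. 0 < s \<and> s < 1 \<and> z \<in> unit_cube d \<and> between d s u x z"
    using \<delta>0 by (intro exI[of _ "1 / (1 + \<delta>)"] exI[of _ z]) (simp add: field_simps)
next
  assume "u \<in> unit_cube d \<and> (\<exists>s z. 0 < s \<and> s < 1 \<and> z \<in> unit_cube d \<and> between d s u x z)"
  then obtain s z where u: "u \<in> unit_cube d" and z: "z \<in> unit_cube d"
    and s: "0 < s" "s < 1" and b: "between d s u x z"
    by blast
  obtain k where k: "cube_face d k (min_face d x)"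
    using min_face_cube_face by blast
  have "x \<in> min_face d x"
    using x by (rule min_face_self)
  then show "u \<in> min_face d x"
    by (rule cube_face_extreme(1)[OF k _ u z s b])
qed

lemma min_face_corner:
  assumes "x \<in> unit_cube d"
  shows "\<exists>u\<in>min_face d x. corner d u"
proof
  let ?u = "\<lambda>l\<in>{..<d}. if x l = 1 then 1 else 0"
  show "?u \<in> min_face d x"
    by (auto simp: min_face_def)
  show "corner d ?u"
    by (auto simp: corner_def unit_cube_iff)
qed

lemma min_face_interior:
  assumes "\<And>l. l < d \<Longrightarrow> 0 < x l \<and> x l < 1"
  shows "min_face d x = unit_cube d"
  unfolding min_face_def unit_cube_def using assms by (intro PiE_cong) fastforce

text \<open>For \<open>t = 0\<close> and \<open>t = 1\<close> these are two opposite corners, for \<open>t = 1/2\<close> the centre of the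
  cube.\<close>

definition cube_const :: "nat \<Rightarrow> real \<Rightarrow> pt" where
  "cube_const d t = (\<lambda>l\<in>{..<d}. t)"

lemma cube_const_in: "0 \<le> t \<Longrightarrow> t \<le> 1 \<Longrightarrow> cube_const d t \<in> unit_cube d"
  by (auto simp: cube_const_def unit_cube_iff)

text \<open>For a corner \<open>u\<close>, the other end of the edge at \<open>u\<close> in direction \<open>l\<close>.\<close>

definition flip :: "nat \<Rightarrow> pt \<Rightarrow> pt" where
  "flip l u = u(l := 1 - u l)"

lemma corner_flip: "corner d u \<Longrightarrow> l < d \<Longrightarrow> corner d (flip l u)"
  by (auto simp: corner_def flip_def unit_cube_iff extensional_def)

lemma flip_neq: "corner d u \<Longrightarrow> l < d \<Longrightarrow> flip l u \<noteq> u"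
  by (auto simp: corner_def flip_def fun_eq_iff intro!: exI[of _ l])

lemma corner_0_face: "corner d u \<Longrightarrow> cube_face d 0 {u}"
  unfolding cube_face_def
proof (intro exI conjI allI impI)
  assume u: "corner d u"
  show "{u l} = {0} \<or> {u l} = {1} \<or> {u l} = {0..1}" if "l < d" for l
    using cornerD(2)[OF u that] by auto
  have "{u l} \<noteq> {0..1}" for l
    by (metis atLeastAtMost_iff le_numeral_extra(1) order_refl singletonD zero_neq_one)
  then show "0 = card {i. i < d \<and> {u i} = {0..1}}"
    by simp
  have "u \<in> extensional {..<d}"
    using u by (auto simp: corner_def unit_cube_iff)
  then show "{u} = (\<Pi>\<^sub>E i\<in>{..<d}. {u i})"
    by (simp add: PiE_singleton)
qed

lemma edge_1_face:
  assumes u: "corner d u" and l: "l < d"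
  shows "\<exists>e. cube_face d 1 e \<and> u \<in> e \<and> flip l u \<in> e"
proof (intro exI conjI)
  let ?S = "\<lambda>i. if i = l then {0..1} else {u i}"
  let ?e = "\<Pi>\<^sub>E i\<in>{..<d}. ?S i"
  have ext: "u \<in> extensional {..<d}"
    using u by (auto simp: corner_def unit_cube_iff)
  have ul: "u l = 0 \<or> u l = 1"
    by (rule cornerD(2)[OF u l])
  show "cube_face d 1 ?e"
    unfolding cube_face_def
  proof (intro exI conjI allI impI)
    show "?S i = {0} \<or> ?S i = {1} \<or> ?S i = {0..1}" if "i < d" for i
      using cornerD(2)[OF u that] by auto
    have "{u i} \<noteq> {0..1}" for i
      by (metis atLeastAtMost_iff le_numeral_extra(1) order_refl singletonD zero_neq_one)
    then have "{i. i < d \<and> ?S i = {0..1}} = {l}"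
      using l by auto
    then show "1 = card {i. i < d \<and> ?S i = {0..1}}"
      by simp
  qed simp
  show "u \<in> ?e"
    using ext ul by (auto simp: PiE_iff)
  show "flip l u \<in> ?e"
    using ext ul l by (auto simp: PiE_iff flip_def extensional_def)
qed

lemma face_all_corners:
  assumes F: "cube_face d k F" and "u \<in> F" "corner d u" "\<And>l. l < d \<Longrightarrow> flip l u \<in> F"
  shows "F = unit_cube d"
proof -
  obtain S where S0: "\<forall>i<d. S i = {0} \<or> S i = {1} \<or> S i = {0..1}"
    and card: "k = card {i. i < d \<and> S i = {0..1}}" and FS: "F = (\<Pi>\<^sub>E i\<in>{..<d}. S i)"
    using cube_faceE[OF F] by blast
  have "S l = {0..1}" if l: "l < d" for l
  proof -
    have "u l \<in> S l"
      using assms(2) l unfolding FS by blast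
    moreover have "flip l u l \<in> S l"
      using assms(4)[OF l] l unfolding FS by blast
    moreover have "flip l u l = 1 - u l"
      by (simp add: flip_def)
    moreover have "S l = {0} \<or> S l = {1} \<or> S l = {0..1}"
      using S0 l by blast
    ultimately show ?thesis
      using cornerD(2)[OF assms(3) l] by (elim disjE) simp_all
  qed
  then show ?thesis
    unfolding FS unit_cube_def by (intro PiE_cong) simp
qed

lemma face_opposite_corners:
  assumes F: "cube_face d k F" and "cube_const d 0 \<in> F" "cube_const d 1 \<in> F"
  shows "F = unit_cube d"
proof -
  obtain S where S0: "\<forall>i<d. S i = {0} \<or> S i = {1} \<or> S i = {0..1}"
    and card: "k = card {i. i < d \<and> S i = {0..1}}" and FS: "F = (\<Pi>\<^sub>E i\<in>{..<d}. S i)"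
    using cube_faceE[OF F] by blast
  have "S l = {0..1}" if l: "l < d" for l
  proof -
    have "0 \<in> S l" "1 \<in> S l"
      using PiE_mem[of "cube_const d 0" "{..<d}" S l] PiE_mem[of "cube_const d 1" "{..<d}" S l]
        assms(2,3) l unfolding FS by (simp_all add: cube_const_def)
    moreover have "S l = {0} \<or> S l = {1} \<or> S l = {0..1}"
      using S0 l by blast
    ultimately show ?thesis
      by (elim disjE) simp_all
  qed
  then show ?thesis
    unfolding FS unit_cube_def by (intro PiE_cong) simp
qed

lemma zero_dim_face:
  assumes "cube_face d 0 F"
  obtains u where "corner d u" "F = {u}"
proof -
  obtain S where S0: "\<forall>i<d. S i = {0} \<or> S i = {1} \<or> S i = {0..1}"
    and card: "0 = card {i. i < d \<and> S i = {0..1}}" and FS: "F = (\<Pi>\<^sub>E i\<in>{..<d}. S i)"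
    using cube_faceE[OF assms] by blast
  have "finite {i. i < d \<and> S i = {0..1}}"
    by simp
  then have none: "{i. i < d \<and> S i = {0..1}} = {}"
    using card by (metis card_eq_0_iff)
  define u where "u = (\<lambda>l\<in>{..<d}. if S l = {0} then 0 else 1 :: real)"
  have u_ext: "u \<in> extensional {..<d}"
    unfolding u_def by (rule restrict_extensional)
  have "S l = {u l}" if l: "l < d" for l
  proof -
    have "S l = {0} \<or> S l = {1}"
      using S0 l none by blast
    then show ?thesis
      using l by (elim disjE) (simp_all add: u_def)
  qed
  then have "F = (\<Pi>\<^sub>E i\<in>{..<d}. {u i})"
    unfolding FS by (intro PiE_cong) simp
  also have "\<dots> = {u}"
    using u_ext by (rule PiE_singleton)
  finally have "F = {u}" .
  moreover have "corner d u"
    using u_ext by (simp add: corner_def unit_cube_iff) (simp add: u_def)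
  ultimately show thesis
    using that by blast
qed

text \<open>The dimension of a face is the square of its diameter, hence invariant under isometries.\<close>

lemma cube_face_diameter:
  assumes "cube_face d k F"
  shows "\<forall>x\<in>F. \<forall>y\<in>F. (cube_dist d x y)\<^sup>2 \<le> k" "\<exists>x\<in>F. \<exists>y\<in>F. (cube_dist d x y)\<^sup>2 = k"
proof -
  obtain S where S0: "\<forall>i<d. S i = {0} \<or> S i = {1} \<or> S i = {0..1}"
    and card: "k = card {i. i < d \<and> S i = {0..1}}" and FS: "F = (\<Pi>\<^sub>E i\<in>{..<d}. S i)"
    using cube_faceE[OF assms] by blast
  have k: "real k = (\<Sum>i<d. if S i = {0..1} then 1 else 0)"
    unfolding card by (simp add: sum.If_cases Int_def)
  show "\<forall>x\<in>F. \<forall>y\<in>F. (cube_dist d x y)\<^sup>2 \<le> k"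
  proof (intro ballI)
    fix x y
    assume xy: "x \<in> F" "y \<in> F"
    have "(x i - y i)\<^sup>2 \<le> (if S i = {0..1} then 1 else 0)" if i: "i < d" for i
    proof -
      have m: "x i \<in> S i" "y i \<in> S i"
        using xy i unfolding FS by blast+
      consider "S i = {0}" | "S i = {1}" | "S i = {0..1}"
        using S0 i by blast
      then show ?thesis
      proof cases
        case 3
        then have "\<bar>x i - y i\<bar> \<le> 1"
          using m by (simp add: abs_le_iff)
        then show ?thesis
          using 3 by (simp add: abs_square_le_1)
      qed (use m in simp_all)
    qed
    then show "(cube_dist d x y)\<^sup>2 \<le> k"
      unfolding cube_dist_square k by (intro sum_mono) simp
  qed
  let ?x = "\<lambda>i\<in>{..<d}. if S i = {1} then 1 else 0 :: real"
  let ?y = "\<lambda>i\<in>{..<d}. if S i = {0} then 0 else 1 :: real"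
  have eq: "?x i \<in> S i \<and> ?y i \<in> S i \<and> (?x i - ?y i)\<^sup>2 = (if S i = {0..1} then 1 else 0)" if i: "i < d" for i
  proof -
    have ne: "{0..1::real} \<noteq> {0}" "{0..1::real} \<noteq> {1}"
      by (metis atLeastAtMost_iff le_numeral_extra(1) order_refl singletonD zero_neq_one)+
    consider "S i = {0}" | "S i = {1}" | "S i = {0..1}"
      using S0 i by blast
    then show ?thesis
      by cases (use i ne ne[symmetric] in simp_all)
  qed
  show "\<exists>x\<in>F. \<exists>y\<in>F. (cube_dist d x y)\<^sup>2 = k"
  proof (intro bexI)
    show "(cube_dist d ?x ?y)\<^sup>2 = k"
      unfolding cube_dist_square k by (intro sum.cong) (use eq in auto)
    show "?x \<in> F" "?y \<in> F"
      unfolding FS using eq by (auto intro!: PiE_I)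
  qed
qed

lemma isometric_faces_dim:
  assumes "cube_face d k F" "cube_face e l F'" "cube_isometry d e F F' \<psi>"
  shows "k = l"
proof -
  have iso: "cube_dist e (\<psi> x) (\<psi> y) = cube_dist d x y" if "x \<in> F" "y \<in> F" for x y
    using assms(3) that by (simp add: cube_isometry_def)
  have im: "\<psi> ` F = F'"
    using assms(3) by (simp add: cube_isometry_def bij_betw_def)
  have imF: "\<psi> x \<in> F'" if "x \<in> F" for x
    using im that by blast
  obtain x y where xy: "x \<in> F" "y \<in> F" "(cube_dist d x y)\<^sup>2 = k"
    using cube_face_diameter(2)[OF assms(1)] by blast
  have "real k \<le> l"
    using cube_face_diameter(1)[OF assms(2), THEN bspec, OF imF[OF xy(1)], THEN bspec, OF imF[OF xy(2)]]
    unfolding iso[OF xy(1,2)] xy(3) .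
  moreover obtain x' y' where "x' \<in> F'" "y' \<in> F'" and d': "(cube_dist e x' y')\<^sup>2 = l"
    using cube_face_diameter(2)[OF assms(2)] by blast
  then obtain x y where xy: "x \<in> F" "y \<in> F" "x' = \<psi> x" "y' = \<psi> y"
    using im by blast
  have "real l \<le> k"
    using cube_face_diameter(1)[OF assms(1), THEN bspec, OF xy(1), THEN bspec, OF xy(2)] d'
    unfolding xy(3,4) iso[OF xy(1,2)] by simp
  ultimately show ?thesis
    by simp
qed

section \<open>Cells and vertices of a cube complex\<close>

locale glued_cubes =
  fixes X :: "'i cube_data"
  assumes complex: "cube_complex X"
begin

abbreviation C :: "'i \<Rightarrow> pt set" where
  "C i \<equiv> unit_cube (cdim X i)"

abbreviation glue_sym :: "(('i \<times> pt) \<times> ('i \<times> pt)) set" where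
  "glue_sym \<equiv> glue_step X \<union> (glue_step X)\<inverse>"

lemma glueingD:
  assumes "(i, j, \<psi>) \<in> glueings X"
  shows "i \<in> cubes X" "j \<in> cubes X" "is_glueing (cdim X i) (cdim X j) \<psi>"
  using assms complex unfolding cube_complex_def by blast+

lemma proj_inj: "i \<in> cubes X \<Longrightarrow> x \<in> C i \<Longrightarrow> y \<in> C i \<Longrightarrow> proj X i x = proj X i y \<longleftrightarrow> x = y"
proof -
  assume "i \<in> cubes X" "x \<in> C i" "y \<in> C i"
  moreover from this have "inj_on (proj X i) (C i)"
    using complex unfolding cube_complex_def by blast
  ultimately show ?thesis
    by (rule_tac inj_on_eq_iff)
qed

lemma glue_equiv: "equiv (disjoint_cubes X) (glue_rel X)"
proof (rule equivI)
  show "refl_on (disjoint_cubes X) (glue_rel X)"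
    by (auto simp: refl_on_def glue_rel_def)
  have "sym (glue_sym\<^sup>*)"
    by (intro sym_rtrancl sym_Un_converse)
  then show "sym (glue_rel X)"
    unfolding glue_rel_def sym_def by blast
  show "trans (glue_rel X)"
    unfolding glue_rel_def trans_def by (blast intro: rtrancl_trans)
qed (auto simp: glue_rel_def)

lemma proj_eq_iff:
  assumes "i \<in> cubes X" "x \<in> C i" "j \<in> cubes X" "y \<in> C j"
  shows "proj X i x = proj X j y \<longleftrightarrow> ((i, x), (j, y)) \<in> glue_sym\<^sup>*"
  using eq_equiv_class_iff[OF glue_equiv, of "(i, x)" "(j, y)"] assms
  by (auto simp: proj_def disjoint_cubes_def glue_rel_def)

lemma points_iff: "p \<in> points X \<longleftrightarrow> (\<exists>i\<in>cubes X. \<exists>x\<in>C i. p = proj X i x)"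
  by (auto simp: points_def quotient_def proj_def disjoint_cubes_def)

lemma proj_points [intro]: "i \<in> cubes X \<Longrightarrow> x \<in> C i \<Longrightarrow> proj X i x \<in> points X"
  by (auto simp: points_iff)

text \<open>A single step of the glueing relation, in either direction, is an isometry defined on a
  whole face.\<close>

lemma glue_sym_face:
  assumes "((i, b), (j, b')) \<in> glue_sym"
  shows "j \<in> cubes X \<and> (\<exists>k E \<psi>. cube_face (cdim X i) k E \<and> b \<in> E \<and> \<psi> b = b' \<and>
    (\<forall>x\<in>E. \<psi> x \<in> C j \<and> ((i, x), (j, \<psi> x)) \<in> glue_sym) \<and>
    (\<forall>x\<in>E. \<forall>y\<in>E. cube_dist (cdim X j) (\<psi> x) (\<psi> y) = cube_dist (cdim X i) x y))"
proof -
  consider "((i, b), (j, b')) \<in> glue_step X" | "((j, b'), (i, b)) \<in> glue_step X"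
    using assms by blast
  then show ?thesis
  proof cases
    case 1
    then obtain \<psi> where \<psi>: "(i, j, \<psi>) \<in> glueings X" "\<psi> b = Some b'"
      by (auto simp: glue_step_def)
    note g = glueingD[OF \<psi>(1)]
    obtain k l where kl: "cube_face (cdim X i) k (dom \<psi>)" "cube_face (cdim X j) l (ran \<psi>)"
      and iso: "cube_isometry (cdim X i) (cdim X j) (dom \<psi>) (ran \<psi>) (\<lambda>x. the (\<psi> x))"
      using g(3) unfolding is_glueing_def by blast
    have "the (\<psi> x) \<in> C j \<and> ((i, x), (j, the (\<psi> x))) \<in> glue_sym" if "x \<in> dom \<psi>" for x
    proof -
      from that have "\<psi> x = Some (the (\<psi> x))"
        by auto
      then show ?thesis
        using \<psi>(1) cube_face_subset[OF kl(2)] by (auto simp: glue_step_def intro: ranI)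
    qed
    then show ?thesis
      using g(2) kl(1) iso \<psi>(2)
      by (intro conjI exI[of _ k] exI[of _ "dom \<psi>"] exI[of _ "\<lambda>x. the (\<psi> x)"])
        (auto simp: cube_isometry_def)
  next
    case 2
    then obtain \<psi> where \<psi>: "(j, i, \<psi>) \<in> glueings X" "\<psi> b' = Some b"
      by (auto simp: glue_step_def)
    note g = glueingD[OF \<psi>(1)]
    obtain k l where kl: "cube_face (cdim X j) k (dom \<psi>)" "cube_face (cdim X i) l (ran \<psi>)"
      and iso: "cube_isometry (cdim X j) (cdim X i) (dom \<psi>) (ran \<psi>) (\<lambda>x. the (\<psi> x))"
      using g(3) unfolding is_glueing_def by blast
    have bij: "bij_betw (\<lambda>x. the (\<psi> x)) (dom \<psi>) (ran \<psi>)"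
      using iso by (simp add: cube_isometry_def)
    define \<theta> where "\<theta> = inv_into (dom \<psi>) (\<lambda>x. the (\<psi> x))"
    have \<theta>: "\<theta> x \<in> dom \<psi>" "\<psi> (\<theta> x) = Some x" if "x \<in> ran \<psi>" for x
    proof -
      show "\<theta> x \<in> dom \<psi>"
        using bij that unfolding \<theta>_def by (simp add: bij_betw_def inv_into_into)
      moreover have "the (\<psi> (\<theta> x)) = x"
        using bij_betw_inv_into_right[OF bij that] by (simp add: \<theta>_def)
      ultimately show "\<psi> (\<theta> x) = Some x"
        by auto
    qed
    have "\<theta> b = b'"
      using bij_betw_inv_into_left[OF bij, of b'] \<psi>(2) by (auto simp: \<theta>_def)
    moreover have "\<theta> x \<in> C j \<and> ((i, x), (j, \<theta> x)) \<in> glue_sym" if "x \<in> ran \<psi>" for x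
      using \<theta>[OF that] \<psi>(1) cube_face_subset[OF kl(1)] by (auto simp: glue_step_def)
    moreover have "cube_dist (cdim X j) (\<theta> x) (\<theta> y) = cube_dist (cdim X i) x y"
      if "x \<in> ran \<psi>" "y \<in> ran \<psi>" for x y
    proof -
      have "cube_dist (cdim X i) (the (\<psi> (\<theta> x))) (the (\<psi> (\<theta> y))) = cube_dist (cdim X j) (\<theta> x) (\<theta> y)"
        using \<theta>(1)[OF that(1)] \<theta>(1)[OF that(2)] iso unfolding cube_isometry_def by blast
      then show ?thesis
        by (simp add: \<theta>(2) that)
    qed
    ultimately show ?thesis
      using g(1) kl(2) \<psi>(2)
      by (intro conjI exI[of _ l] exI[of _ "ran \<psi>"] exI[of _ \<theta>]) (auto intro: ranI)
  qed
qed

text \<open>A chain of glueings that starts at the centre \<open>b\<close> of \<open>S\<close> carries all of \<open>S\<close> along: if \<open>S\<close>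
  has reached some cube, then the face on which the next glueing is defined contains the image of
  \<open>b\<close>, which is still the centre of the image of \<open>S\<close>, hence it contains the image of \<open>S\<close>.\<close>

lemma transport_centred:
  assumes "((i, b), p) \<in> glue_sym\<^sup>*" "centred (cdim X i) b S" "i \<in> cubes X"
  shows "\<exists>j b' \<theta>. p = (j, b') \<and> j \<in> cubes X \<and> \<theta> b = b' \<and>
    (\<forall>x\<in>S. \<theta> x \<in> C j \<and> ((i, x), (j, \<theta> x)) \<in> glue_sym\<^sup>*) \<and>
    (\<forall>x\<in>S. \<forall>y\<in>S. cube_dist (cdim X j) (\<theta> x) (\<theta> y) = cube_dist (cdim X i) x y)"
  using assms(1)
proof induction
  case base
  show ?case
    using assms(2,3) by (intro exI[of _ i] exI[of _ b] exI[of _ "\<lambda>x. x"]) (auto simp: centred_def)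
next
  case (step p q)
  then obtain j b' \<theta> where p: "p = (j, b')" "j \<in> cubes X" "\<theta> b = b'"
    and \<theta>: "\<And>x. x \<in> S \<Longrightarrow> \<theta> x \<in> C j \<and> ((i, x), (j, \<theta> x)) \<in> glue_sym\<^sup>*"
    and iso: "\<And>x y. x \<in> S \<Longrightarrow> y \<in> S \<Longrightarrow>
        cube_dist (cdim X j) (\<theta> x) (\<theta> y) = cube_dist (cdim X i) x y"
    by blast
  obtain k b'' where q: "q = (k, b'')"
    by fastforce
  obtain l E \<psi> where k: "k \<in> cubes X" and E: "cube_face (cdim X j) l E" "b' \<in> E" "\<psi> b' = b''"
    and \<psi>: "\<And>x. x \<in> E \<Longrightarrow> \<psi> x \<in> C k \<and> ((j, x), (k, \<psi> x)) \<in> glue_sym"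
    and \<psi>iso: "\<And>x y. x \<in> E \<Longrightarrow> y \<in> E \<Longrightarrow>
        cube_dist (cdim X k) (\<psi> x) (\<psi> y) = cube_dist (cdim X j) x y"
    using glue_sym_face[of j b' k b''] step.hyps(2) p(1) q by blast
  have bS: "b \<in> S"
    using assms(2) by (simp add: centred_def)
  have E\<theta>: "\<theta> x \<in> E" if x: "x \<in> S" for x
  proof -
    obtain x' where x': "x' \<in> S" "between (cdim X i) (1/2) x b x'"
      using assms(2) x by (auto simp: centred_def)
    have "between (cdim X j) (1/2) (\<theta> x) b' (\<theta> x')"
      by (rule between_isometric[OF x'(2)]) (use iso x x' bS p(3) in auto)
    then show ?thesis
      using cube_face_extreme(1)[OF E(1,2), of "\<theta> x" "\<theta> x'" "1/2"] \<theta> x x'(1) by auto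
  qed
  have "((i, x), (k, \<psi> (\<theta> x))) \<in> glue_sym\<^sup>*" if "x \<in> S" for x
    using \<theta>[OF that] \<psi>[OF E\<theta>[OF that]] by (blast intro: rtrancl_into_rtrancl)
  then show ?case
    unfolding q using k E(3) p(3) bS iso \<psi>iso \<psi> E\<theta>
    by (intro exI[of _ k] exI[of _ b''] exI[of _ "\<psi> \<circ> \<theta>"]) auto
qed

lemma overlap_face:
  assumes "i \<in> cubes X" "j \<in> cubes X" "proj X i ` C i \<inter> proj X j ` C j \<noteq> {}"
  obtains k F where "cube_face (cdim X i) k F"
    "\<And>x. x \<in> C i \<Longrightarrow> x \<in> F \<longleftrightarrow> proj X i x \<in> proj X j ` C j"
proof -
  obtain k F where F: "cube_face (cdim X i) k F" "proj X i ` C i \<inter> proj X j ` C j = proj X i ` F"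
    using complex[unfolded cube_complex_def Let_def, THEN conjunct2, THEN conjunct2, THEN conjunct2,
        THEN bspec, OF assms(1), THEN bspec, OF assms(2)] assms(3) by (elim disjE exE conjE) simp_all
  have "x \<in> F \<longleftrightarrow> proj X i x \<in> proj X j ` C j" if x: "x \<in> C i" for x
  proof -
    have "x \<in> F \<longleftrightarrow> proj X i x \<in> proj X i ` F"
      using proj_inj[OF assms(1)] cube_face_subset[OF F(1)] x by blast
    also have "\<dots> \<longleftrightarrow> proj X i x \<in> proj X j ` C j"
      using x F(2) by blast
    finally show ?thesis .
  qed
  then show thesis
    using that F(1) by blast
qed

text \<open>Different points may be identified by different chains of glueings. However, the two cubes
  meet in a common face, and the chain that identifies the centre of this face transports the whole
  face isometrically. Since cubes embed, this transport is the identification of the points.\<close>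

lemma transition_isometric:
  assumes "i \<in> cubes X" "j \<in> cubes X" "x \<in> C i" "y \<in> C i" "x' \<in> C j" "y' \<in> C j"
    and "proj X i x = proj X j x'" "proj X i y = proj X j y'"
  shows "cube_dist (cdim X j) x' y' = cube_dist (cdim X i) x y"
proof -
  have "proj X i ` C i \<inter> proj X j ` C j \<noteq> {}"
    using assms by (metis IntI empty_iff imageI)
  then obtain k F where F: "cube_face (cdim X i) k F"
    and iff: "\<And>x. x \<in> C i \<Longrightarrow> x \<in> F \<longleftrightarrow> proj X i x \<in> proj X j ` C j"
    using overlap_face[OF assms(1,2)] by metis
  obtain b where b: "centred (cdim X i) b F"
    using cube_face_centred[OF F] by blast
  then have "b \<in> C i" "b \<in> F"
    by (auto simp: centred_def)
  then obtain b' where b': "b' \<in> C j" "proj X i b = proj X j b'"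
    using iff by auto
  have "((i, b), (j, b')) \<in> glue_sym\<^sup>*"
    using proj_eq_iff[OF assms(1) \<open>b \<in> C i\<close> assms(2) b'(1)] b'(2) by simp
  then obtain \<theta> where
    \<theta>: "\<And>x. x \<in> F \<Longrightarrow> \<theta> x \<in> C j \<and> ((i, x), (j, \<theta> x)) \<in> glue_sym\<^sup>*"
    and iso: "\<And>x y. x \<in> F \<Longrightarrow> y \<in> F \<Longrightarrow>
        cube_dist (cdim X j) (\<theta> x) (\<theta> y) = cube_dist (cdim X i) x y"
    using transport_centred[OF _ b assms(1), of "(j, b')"] by blast
  have \<theta>_eq: "\<theta> w = w'" and wF: "w \<in> F"
    if w: "w \<in> C i" "w' \<in> C j" "proj X i w = proj X j w'" for w w'
  proof -
    show "w \<in> F"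
      using w iff by auto
    note \<theta>w = \<theta>[OF this]
    have "proj X i w = proj X j (\<theta> w)"
      using \<theta>w proj_eq_iff[OF assms(1) w(1) assms(2)] by blast
    then show "\<theta> w = w'"
      using \<theta>w proj_inj[OF assms(2) _ w(2)] w(3) by metis
  qed
  show ?thesis
    using iso[OF wF[OF assms(3,5,7)] wF[OF assms(4,6,8)]]
    unfolding \<theta>_eq[OF assms(3,5,7)] \<theta>_eq[OF assms(4,6,8)] .
qed

text \<open>If \<open>y\<close> lies in the interior of a segment of the cube \<open>i\<close> and also belongs to the cube \<open>j\<close>,
  then the endpoints of the segment belong to \<open>j\<close>, as the common face is extreme, and \<open>y\<close> divides
  the segment between them in the same ratio there.\<close>

lemma transfer_between:
  assumes ij: "i \<in> cubes X" "j \<in> cubes X" and uyz: "u \<in> C i" "y \<in> C i" "z \<in> C i"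
    and s: "0 < s" "s < 1" and b: "between (cdim X i) s u y z"
    and y': "y' \<in> C j" "proj X i y = proj X j y'"
  shows "\<exists>u'\<in>C j. \<exists>z'\<in>C j. proj X j u' = proj X i u \<and> proj X j z' = proj X i z \<and>
    between (cdim X j) s u' y' z'"
proof -
  have "proj X i ` C i \<inter> proj X j ` C j \<noteq> {}"
    using uyz(2) y' by blast
  then obtain k F where F: "cube_face (cdim X i) k F"
    and iff: "\<And>x. x \<in> C i \<Longrightarrow> x \<in> F \<longleftrightarrow> proj X i x \<in> proj X j ` C j"
    using overlap_face[OF ij] by metis
  have "y \<in> F"
    using iff uyz y' by auto
  then have "u \<in> F" "z \<in> F"
    using cube_face_extreme[OF F _ uyz(1,3) s b] by auto
  then obtain u' z' where uz: "u' \<in> C j" "z' \<in> C j" "proj X i u = proj X j u'" "proj X i z = proj X j z'"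
    using iff uyz by auto
  have "between (cdim X j) s u' y' z'"
    by (rule between_isometric[OF b])
      (use s transition_isometric[OF ij] uyz uz y' in auto)
  then show ?thesis
    using uz by (intro bexI[of _ u'] bexI[of _ z']) simp_all
qed

lemma vertices_iff: "v \<in> vertices X \<longleftrightarrow> (\<exists>i\<in>cubes X. \<exists>u. corner (cdim X i) u \<and> v = proj X i u)"
proof
  assume "v \<in> vertices X"
  then obtain i F where F: "i \<in> cubes X" "cube_face (cdim X i) 0 F" "{v} = proj X i ` F"
    unfolding vertices_def cells_def by blast
  obtain u where "corner (cdim X i) u" "F = {u}"
    using zero_dim_face[OF F(2)] by blast
  then show "\<exists>i\<in>cubes X. \<exists>u. corner (cdim X i) u \<and> v = proj X i u"
    using F by auto
next
  assume "\<exists>i\<in>cubes X. \<exists>u. corner (cdim X i) u \<and> v = proj X i u"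
  then obtain i u where "i \<in> cubes X" "corner (cdim X i) u" "v = proj X i u"
    by blast
  then show "v \<in> vertices X"
    unfolding vertices_def cells_def using corner_0_face[of "cdim X i" u]
    by (intro CollectI exI[of _ i] exI[of _ "{u}"]) simp
qed

lemma vertices_points: "v \<in> vertices X \<Longrightarrow> v \<in> points X"
  using vertices_iff cornerD(1) proj_points by metis

lemma neighbours_points: "neighbours X v \<subseteq> points X"
  unfolding neighbours_def using vertices_points by blast

lemma corner_transfer:
  assumes ij: "i \<in> cubes X" "j \<in> cubes X" and u: "corner (cdim X i) u"
    and u': "u' \<in> C j" "proj X i u = proj X j u'"
  shows "corner (cdim X j) u'"
  unfolding corner_iff_extreme[OF u'(1)]
proof (intro ballI impI)
  fix a b
  assume ab: "a \<in> C j" "b \<in> C j" "between (cdim X j) (1/2) a u' b"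
  note uC = cornerD(1)[OF u]
  obtain a' b' where ab': "a' \<in> C i" "b' \<in> C i" "proj X i a' = proj X j a" "proj X i b' = proj X j b"
      "between (cdim X i) (1/2) a' u b'"
    using transfer_between[OF ij(2,1) ab(1) u'(1) ab(2) _ _ ab(3) uC u'(2)[symmetric]] by fastforce
  then have "a' = b'"
    using u corner_iff_extreme[OF uC] by blast
  then show "a = b"
    using ab'(3,4) ab(1,2) proj_inj[OF ij(2)] by metis
qed

lemma vertex_corner:
  assumes "v \<in> vertices X" "i \<in> cubes X" "u \<in> C i" "v = proj X i u"
  shows "corner (cdim X i) u"
  using assms corner_transfer[OF _ assms(2) _ assms(3)] unfolding vertices_iff by metis

lemma neighboursI:
  "w \<in> vertices X \<Longrightarrow> w \<noteq> v \<Longrightarrow> e \<in> cells X 1 \<Longrightarrow> v \<in> e \<Longrightarrow> w \<in> e \<Longrightarrow> w \<in> neighbours X v"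
  unfolding neighbours_def by blast

lemma neighbours_flip:
  assumes i: "i \<in> cubes X" and u: "corner (cdim X i) u" and l: "l < cdim X i"
  shows "proj X i (flip l u) \<in> neighbours X (proj X i u)"
proof -
  have f: "corner (cdim X i) (flip l u)"
    by (rule corner_flip[OF u l])
  have ne: "proj X i (flip l u) \<noteq> proj X i u"
    using proj_inj[OF i cornerD(1)[OF f] cornerD(1)[OF u]] flip_neq[OF u l] by blast
  obtain e where e: "cube_face (cdim X i) 1 e" "u \<in> e" "flip l u \<in> e"
    using edge_1_face[OF u l] by blast
  have "proj X i ` e \<in> cells X 1"
    unfolding cells_def using i e(1) by blast
  moreover have "proj X i u \<in> proj X i ` e" "proj X i (flip l u) \<in> proj X i ` e"
    using e by blast+
  moreover have "proj X i (flip l u) \<in> vertices X"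
    using vertices_iff i f by blast
  ultimately show ?thesis
    using ne by (intro neighboursI)
qed

text \<open>The cell that contains \<open>p\<close> in its relative interior, described without a choice of a cube
  around \<open>p\<close>.\<close>

definition carrier_cell :: "('i \<times> pt) set \<Rightarrow> ('i \<times> pt) set set" where
  "carrier_cell p = {r. \<exists>i\<in>cubes X. \<exists>x\<in>C i. p = proj X i x \<and> r \<in> proj X i ` min_face (cdim X i) x}"

text \<open>The smallest face is made of segments through the point, and these pass from one cube to
  another.\<close>

lemma min_face_transfer:
  assumes ij: "i \<in> cubes X" "j \<in> cubes X" and x: "x \<in> C i" "y \<in> C j" "proj X i x = proj X j y"
  shows "proj X i ` min_face (cdim X i) x \<subseteq> proj X j ` min_face (cdim X j) y"
proof
  fix r
  assume "r \<in> proj X i ` min_face (cdim X i) x"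
  then obtain u where u: "u \<in> min_face (cdim X i) x" "r = proj X i u"
    by blast
  then obtain s z where *: "u \<in> C i" "0 < s" "s < 1" "z \<in> C i" "between (cdim X i) s u x z"
    unfolding min_face_iff[OF x(1)] by blast
  obtain u' z' where "u' \<in> C j" "z' \<in> C j" "proj X j u' = proj X i u" "between (cdim X j) s u' y z'"
    using transfer_between[OF ij *(1) x(1) *(4,2,3,5) x(2,3)] by blast
  then show "r \<in> proj X j ` min_face (cdim X j) y"
    using u(2) *(2,3) min_face_iff[OF x(2), of u'] by blast
qed

lemma carrier_cell_proj:
  assumes "i \<in> cubes X" "x \<in> C i"
  shows "carrier_cell (proj X i x) = proj X i ` min_face (cdim X i) x"
proof
  show "carrier_cell (proj X i x) \<subseteq> proj X i ` min_face (cdim X i) x"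
    unfolding carrier_cell_def using min_face_transfer[OF _ assms(1) _ assms(2)] by blast
  show "proj X i ` min_face (cdim X i) x \<subseteq> carrier_cell (proj X i x)"
    unfolding carrier_cell_def using assms by blast
qed

lemma carrier_cell_cells:
  assumes "p \<in> points X"
  obtains k where "carrier_cell p \<in> cells X k"
proof -
  obtain i x where ix: "i \<in> cubes X" "x \<in> C i" "p = proj X i x"
    using assms points_iff by blast
  obtain k where "cube_face (cdim X i) k (min_face (cdim X i) x)"
    using min_face_cube_face by blast
  then have "carrier_cell p \<in> cells X k"
    unfolding ix(3) carrier_cell_proj[OF ix(1,2)] cells_def using ix(1) by blast
  then show thesis
    by (rule that)
qed

lemma cubical_map_cube:
  assumes f: "maps_cubes_to_cubes X f" and i: "i \<in> cubes X"
  shows "\<exists>j\<in>cubes X. \<exists>\<psi>. (\<forall>x\<in>C i. \<psi> x \<in> C j \<and> f (proj X i x) = proj X j (\<psi> x)) \<and>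
    (\<forall>x\<in>C i. \<forall>y\<in>C i. cube_dist (cdim X j) (\<psi> x) (\<psi> y) = cube_dist (cdim X i) x y)"
proof -
  obtain j l F' \<psi> where j: "j \<in> cubes X" "cube_face (cdim X j) l F'"
    "cube_isometry (cdim X i) (cdim X j) (C i) F' \<psi>" "\<forall>x\<in>C i. f (proj X i x) = proj X j (\<psi> x)"
    using f[unfolded maps_cubes_to_cubes_def, rule_format, OF i cube_face_unit_cube] by blast
  have "\<psi> x \<in> C j" if "x \<in> C i" for x
    using bij_betw_apply[OF _ that, of \<psi> F'] j(3) cube_face_subset[OF j(2)]
    by (auto simp: cube_isometry_def)
  then show ?thesis
    using j(1,3,4) by (intro bexI[of _ j] exI[of _ \<psi>]) (simp_all add: cube_isometry_def)
qed

text \<open>A cubical map sends segments through \<open>p\<close> to segments through its image.\<close>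

lemma cubical_map_carrier:
  assumes f: "maps_cubes_to_cubes X f" and p: "p \<in> points X"
  shows "f ` carrier_cell p \<subseteq> carrier_cell (f p)"
proof
  fix r
  assume "r \<in> f ` carrier_cell p"
  obtain i x where ix: "i \<in> cubes X" "x \<in> C i" "p = proj X i x"
    using p points_iff by blast
  obtain u where u: "u \<in> min_face (cdim X i) x" "r = f (proj X i u)"
    using \<open>r \<in> _\<close> unfolding ix(3) carrier_cell_proj[OF ix(1,2)] by blast
  then obtain s z where *: "u \<in> C i" "0 < s" "s < 1" "z \<in> C i" "between (cdim X i) s u x z"
    unfolding min_face_iff[OF ix(2)] by blast
  obtain j \<psi> where j: "j \<in> cubes X"
    and \<psi>0: "\<forall>x\<in>C i. \<psi> x \<in> C j \<and> f (proj X i x) = proj X j (\<psi> x)"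
    and iso0: "\<forall>x\<in>C i. \<forall>y\<in>C i. cube_dist (cdim X j) (\<psi> x) (\<psi> y) = cube_dist (cdim X i) x y"
    using cubical_map_cube[OF f ix(1)] by blast
  note \<psi> = \<psi>0[rule_format] and iso = iso0[rule_format]
  have "between (cdim X j) s (\<psi> u) (\<psi> x) (\<psi> z)"
    by (rule between_isometric[OF *(5)]) (use iso * ix(2) in auto)
  then have "\<psi> u \<in> min_face (cdim X j) (\<psi> x)"
    using min_face_iff[of "\<psi> x" "cdim X j" "\<psi> u"] \<psi>[OF *(1)] \<psi>[OF *(4)] \<psi>[OF ix(2)] *(2,3) by blast
  then show "r \<in> carrier_cell (f p)"
    using \<psi>[OF ix(2)] \<psi>[OF *(1)] carrier_cell_proj[OF j, of "\<psi> x"] u(2) ix(3) by simp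
qed

text \<open>The dimension is preserved as it is determined by the diameter.\<close>

lemma cubical_map_cells:
  assumes f: "maps_cubes_to_cubes X f" and c: "c \<in> cells X k"
  shows "f ` c \<in> cells X k"
proof -
  obtain i F where iF: "i \<in> cubes X" "cube_face (cdim X i) k F" "c = proj X i ` F"
    using c unfolding cells_def by blast
  obtain j l F' \<psi> where j: "j \<in> cubes X" "cube_face (cdim X j) l F'"
    "cube_isometry (cdim X i) (cdim X j) F F' \<psi>" "\<forall>x\<in>F. f (proj X i x) = proj X j (\<psi> x)"
    using f[unfolded maps_cubes_to_cubes_def, rule_format, OF iF(1,2)] by blast
  have "k = l"
    by (rule isometric_faces_dim[OF iF(2) j(2,3)])
  moreover have "f ` c = proj X j ` F'"
  proof -
    have "f ` c = (\<lambda>x. proj X j (\<psi> x)) ` F"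
      unfolding iF(3) image_image using j(4) by (intro image_cong) auto
    also have "\<dots> = proj X j ` \<psi> ` F"
      by (simp add: image_image)
    finally show ?thesis
      using j(3) by (simp add: cube_isometry_def bij_betw_def)
  qed
  ultimately show ?thesis
    unfolding cells_def using j(1,2) by blast
qed

lemma cubical_map_vertices:
  assumes "maps_cubes_to_cubes X f" "v \<in> vertices X"
  shows "f v \<in> vertices X"
  using cubical_map_cells[OF assms(1), of "{v}" 0] assms(2) by (simp add: vertices_def)

lemma cubical_map_neighbours:
  assumes f: "maps_cubes_to_cubes X f" and w: "w \<in> neighbours X v" and "f w \<noteq> f v"
  shows "f w \<in> neighbours X (f v)"
proof -
  obtain e where e: "w \<in> vertices X" "e \<in> cells X 1" "v \<in> e" "w \<in> e"
    using w unfolding neighbours_def by blast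
  then have "f ` e \<in> cells X 1" "f v \<in> f ` e" "f w \<in> f ` e" "f w \<in> vertices X"
    using cubical_map_cells[OF f e(2)] cubical_map_vertices[OF f e(1)] by auto
  then show ?thesis
    using assms(3) by (intro neighboursI)
qed

lemma overlap_all:
  assumes ij: "i \<in> cubes X" "j \<in> cubes X" and ne: "proj X i ` C i \<inter> proj X j ` C j \<noteq> {}"
    and F: "\<And>k F. cube_face (cdim X i) k F \<Longrightarrow>
      (\<And>x. x \<in> C i \<Longrightarrow> proj X i x \<in> proj X j ` C j \<Longrightarrow> x \<in> F) \<Longrightarrow> F = C i"
  shows "proj X i ` C i \<subseteq> proj X j ` C j"
proof -
  obtain k F where *: "cube_face (cdim X i) k F" "\<And>x. x \<in> C i \<Longrightarrow> x \<in> F \<longleftrightarrow> proj X i x \<in> proj X j ` C j"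
    using overlap_face[OF ij ne] by metis
  have "F = C i"
    by (rule F[OF *(1)]) (use *(2) in blast)
  then show ?thesis
    using *(2) by blast
qed

text \<open>Both the map and the identification of the cube \<open>i\<close> with a face of its image are isometries,
  and they agree on two opposite corners; hence they agree on the midpoint of these corners.\<close>

lemma cubical_map_centre:
  assumes f: "maps_cubes_to_cubes X f" and i: "i \<in> cubes X"
    and fix0: "f (proj X i (cube_const (cdim X i) 0)) = proj X i (cube_const (cdim X i) 0)"
    and fix1: "f (proj X i (cube_const (cdim X i) 1)) = proj X i (cube_const (cdim X i) 1)"
  shows "f (proj X i (cube_const (cdim X i) (1/2))) = proj X i (cube_const (cdim X i) (1/2))"
proof -
  let ?o = "cube_const (cdim X i) 0" and ?e = "cube_const (cdim X i) 1"
    and ?b = "cube_const (cdim X i) (1/2)"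
  have in_C: "?o \<in> C i" "?e \<in> C i" "?b \<in> C i"
    by (auto intro: cube_const_in)
  obtain j \<psi> where j: "j \<in> cubes X"
    and \<psi>0: "\<forall>x\<in>C i. \<psi> x \<in> C j \<and> f (proj X i x) = proj X j (\<psi> x)"
    and iso0: "\<forall>x\<in>C i. \<forall>y\<in>C i. cube_dist (cdim X j) (\<psi> x) (\<psi> y) = cube_dist (cdim X i) x y"
    using cubical_map_cube[OF f i] by blast
  note \<psi> = \<psi>0[rule_format] and iso = iso0[rule_format]
  have o: "proj X i ?o = proj X j (\<psi> ?o)" "\<psi> ?o \<in> C j" and e: "proj X i ?e = proj X j (\<psi> ?e)" "\<psi> ?e \<in> C j"
    using \<psi>[OF in_C(1)] \<psi>[OF in_C(2)] fix0 fix1 by auto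
  have "proj X i ` C i \<subseteq> proj X j ` C j"
  proof (rule overlap_all[OF i j])
    show "proj X i ` C i \<inter> proj X j ` C j \<noteq> {}"
      using o in_C(1) by blast
    show "F = C i" if "cube_face (cdim X i) k F"
      "\<And>x. x \<in> C i \<Longrightarrow> proj X i x \<in> proj X j ` C j \<Longrightarrow> x \<in> F" for k F
      by (rule face_opposite_corners[OF that(1)]) (use that(2) in_C o e in auto)
  qed
  then obtain b' where b': "b' \<in> C j" "proj X i ?b = proj X j b'"
    using in_C(3) by blast
  have mid: "between (cdim X i) (1/2) ?o ?b ?e"
    by (simp add: between_def cube_const_def)
  have m1: "between (cdim X j) (1/2) (\<psi> ?o) b' (\<psi> ?e)"
    by (rule between_isometric[OF mid])
      (use transition_isometric[OF i j] in_C o e b' in auto)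
  have m2: "between (cdim X j) (1/2) (\<psi> ?o) (\<psi> ?b) (\<psi> ?e)"
    by (rule between_isometric[OF mid]) (use iso in_C in auto)
  have "b' = \<psi> ?b"
    by (rule unit_cube_eqI[OF b'(1)]) (use \<psi>[OF in_C(3)] m1 m2 in \<open>auto simp: between_def\<close>)
  then show ?thesis
    using \<psi>[OF in_C(3)] b'(2) by simp
qed

lemma pl_path_nonneg: "pl_path X p q L \<Longrightarrow> 0 \<le> L"
  by (induction rule: pl_path.induct) auto

text \<open>For a point \<open>x\<close> of the cube, a corner whose distance from \<open>x\<close> is at most \<open>1/2\<close> in each
  coordinate.\<close>

definition rounded :: "nat \<Rightarrow> pt \<Rightarrow> pt" where
  "rounded d x = (\<lambda>l\<in>{..<d}. if x l \<le> 1/2 then 0 else 1)"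

lemma corner_rounded: "corner d (rounded d x)"
  by (simp add: rounded_def corner_def unit_cube_iff)

text \<open>A path of length less than \<open>1/2\<close> that starts at \<open>x\<close> cannot leave the union of the cubes
  around the corner \<open>v\<close> nearest to \<open>x\<close>, whatever the dimension. The invariant bounds the distance
  from \<open>v\<close> in the maximum norm. When the path moves on to the cube \<open>k\<close> at the point \<open>w\<close>, the bound
  \<open>s < 1\<close> means that the segment from \<open>v\<close> to \<open>w\<close> can be prolonged by the factor \<open>1/s\<close>; the
  prolonged segment, and in particular \<open>v\<close>, then belongs to \<open>k\<close>, with the same ratio.\<close>

lemma short_path_in_star:
  assumes "pl_path X p q L" "L < 1/2" "p = proj X i x" "i \<in> cubes X" "x \<in> C i"
  shows "\<exists>j\<in>cubes X. \<exists>u\<in>C j. \<exists>y\<in>C j. proj X i (rounded (cdim X i) x) = proj X j u \<and> q = proj X j y \<and>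
      (\<forall>l<cdim X j. \<bar>y l - u l\<bar> \<le> 1/2 + L)"
  using assms
proof (induction rule: pl_path.induct)
  case (pl_refl p)
  have "\<bar>x l - rounded (cdim X i) x l\<bar> \<le> 1/2 + 0" if "l < cdim X i" for l
    using pl_refl.prems(4) that by (auto simp: rounded_def unit_cube_iff)
  then show ?case
    using pl_refl.prems cornerD(1)[OF corner_rounded[of "cdim X i" x]] by blast
next
  case (pl_step p k x' L y)
  let ?v = "proj X i (rounded (cdim X i) x)"
  have L: "0 \<le> L"
    using pl_path_nonneg[OF pl_step.hyps(1)] .
  have dist: "0 \<le> cube_dist (cdim X k) x' y"
    by simp
  have L2: "L < 1/2"
    using pl_step.prems(1) dist by linarith
  obtain j u w where j: "j \<in> cubes X" and u: "u \<in> C j" "?v = proj X j u"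
    and w: "w \<in> C j" "proj X k x' = proj X j w" and bound: "\<And>l. l < cdim X j \<Longrightarrow> \<bar>w l - u l\<bar> \<le> 1/2 + L"
    using pl_step.IH[OF L2 pl_step.prems(2-4)] by blast
  have "?v \<in> vertices X"
    using vertices_iff pl_step.prems(3) corner_rounded by blast
  then have cu: "corner (cdim X j) u"
    by (rule vertex_corner[OF _ j u])
  define s where "s = 1/2 + L"
  have s: "0 < s" "s < 1"
    using L L2 by (auto simp: s_def)
  \<comment> \<open>The prolonged segment ends at \<open>z\<close>, which stays in the cube since \<open>u\<close> is a corner.\<close>
  define z where "z = (\<lambda>l\<in>{..<cdim X j}. u l + (w l - u l) / s)"
  have "0 \<le> u l + (w l - u l) / s \<and> u l + (w l - u l) / s \<le> 1" if l: "l < cdim X j" for l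
  proof -
    have "0 \<le> w l" "w l \<le> 1"
      using w(1) l by (auto simp: unit_cube_iff)
    then show ?thesis
      using cornerD(2)[OF cu l] bound[OF l] s(1) unfolding s_def[symmetric]
      by (auto simp: field_simps abs_if split: if_splits)
  qed
  then have z: "z \<in> C j"
    by (simp add: unit_cube_iff z_def)
  have bz: "between (cdim X j) s u w z"
    using s(1) by (simp add: between_def z_def)
  obtain u' z' where u': "u' \<in> C k" "z' \<in> C k" "proj X k u' = proj X j u"
      and b': "between (cdim X k) s u' x' z'"
    using transfer_between[OF j pl_step.hyps(2) u(1) w(1) z s bz pl_step.hyps(3) w(2)[symmetric]] by blast
  have "\<bar>y l - u' l\<bar> \<le> 1/2 + (L + cube_dist (cdim X k) x' y)" if l: "l < cdim X k" for l
  proof -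
    have "\<bar>z' l - u' l\<bar> \<le> 1"
      using u'(1,2) l by (auto simp: unit_cube_iff abs_le_iff) (smt (verit))+
    then have "s * \<bar>z' l - u' l\<bar> \<le> s"
      using s(1) by (simp add: mult_left_le)
    moreover have "\<bar>x' l - u' l\<bar> = s * \<bar>z' l - u' l\<bar>"
      using b' l s(1) by (simp add: between_def abs_mult)
    ultimately have "\<bar>x' l - u' l\<bar> \<le> 1/2 + L"
      unfolding s_def[symmetric] by linarith
    moreover have "\<bar>x' l - y l\<bar> \<le> cube_dist (cdim X k) x' y"
      by (rule coordinate_le_cube_dist[OF l])
    ultimately show ?thesis
      by linarith
  qed
  moreover have "proj X i (rounded (cdim X i) x) = proj X k u'"
    using u'(3) u(2) by simp
  ultimately show ?case
    using pl_step.hyps(2,4) u'(1) by blast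
qed

lemma near_vertex:
  assumes "p \<in> points X"
  obtains v where "v \<in> vertices X"
    "\<And>q L. pl_path X p q L \<Longrightarrow> L < 1/2 \<Longrightarrow> \<exists>j\<in>cubes X. v \<in> proj X j ` C j \<and> q \<in> proj X j ` C j"
proof -
  obtain i x where ix: "i \<in> cubes X" "x \<in> C i" "p = proj X i x"
    using assms points_iff by blast
  show thesis
  proof (rule that[of "proj X i (rounded (cdim X i) x)"])
    show "proj X i (rounded (cdim X i) x) \<in> vertices X"
      using vertices_iff ix(1) corner_rounded by blast
    show "\<exists>j\<in>cubes X. proj X i (rounded (cdim X i) x) \<in> proj X j ` C j \<and> q \<in> proj X j ` C j"
      if "pl_path X p q L" "L < 1/2" for q L
      using short_path_in_star[OF that ix(3,1,2)] by blast
  qed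
qed

text \<open>A cube around \<open>v\<close> is determined by the neighbours of \<open>v\<close> that it contains: a face that
  contains a corner of the cube and all corners adjacent to it is the whole cube.\<close>

lemma finite_star:
  assumes v: "v \<in> vertices X" and fin: "finite (neighbours X v)"
  shows "finite {proj X i ` C i | i. i \<in> cubes X \<and> v \<in> proj X i ` C i}" (is "finite ?S")
proof (rule inj_on_finite)
  have sub: "proj X i ` C i \<subseteq> proj X j ` C j"
    if ij: "i \<in> cubes X" "j \<in> cubes X" and v': "v \<in> proj X i ` C i" "v \<in> proj X j ` C j"
      and eq: "proj X i ` C i \<inter> neighbours X v = proj X j ` C j \<inter> neighbours X v" for i j
  proof (rule overlap_all[OF ij])
    show "proj X i ` C i \<inter> proj X j ` C j \<noteq> {}"
      using v' by blast
    fix k F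
    assume F: "cube_face (cdim X i) k F" "\<And>x. x \<in> C i \<Longrightarrow> proj X i x \<in> proj X j ` C j \<Longrightarrow> x \<in> F"
    obtain u where u: "u \<in> C i" "v = proj X i u"
      using v' by blast
    have cu: "corner (cdim X i) u"
      by (rule vertex_corner[OF v ij(1) u])
    show "F = C i"
    proof (rule face_all_corners[OF F(1) _ cu])
      show "u \<in> F"
        using F(2) u v'(2) by blast
      fix l
      assume l: "l < cdim X i"
      have "flip l u \<in> C i"
        by (rule cornerD(1)[OF corner_flip[OF cu l]])
      then show "flip l u \<in> F"
        using F(2) neighbours_flip[OF ij(1) cu l] eq unfolding u(2) by blast
    qed
  qed
  show "inj_on (\<lambda>c. c \<inter> neighbours X v) ?S"
  proof (rule inj_onI)
    fix c c'
    assume "c \<in> ?S" "c' \<in> ?S" and eq: "c \<inter> neighbours X v = c' \<inter> neighbours X v"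
    then obtain i j where ij: "i \<in> cubes X" "j \<in> cubes X" "v \<in> proj X i ` C i" "v \<in> proj X j ` C j"
      and c: "c = proj X i ` C i" "c' = proj X j ` C j"
      by blast
    show "c = c'"
      using sub[OF ij(1,2,3,4)] sub[OF ij(2,1,4,3)] eq unfolding c by blast
  qed
  show "(\<lambda>c. c \<inter> neighbours X v) ` ?S \<subseteq> Pow (neighbours X v)"
    by blast
  show "finite (Pow (neighbours X v))"
    using fin by simp
qed

end

section \<open>Fixed points of finite groups\<close>

text \<open>Points of the cube are extended by \<open>undefined\<close>, so the cube is a product over all natural
  numbers whose factors are intervals or singletons.\<close>

lemma compact_unit_cube: "compact (unit_cube d)"
proof -
  let ?S = "\<lambda>i. if i < d then {0..1} else {undefined :: real}"
  have "unit_cube d = (\<Pi>\<^sub>E i\<in>UNIV. ?S i)"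
    by (fastforce simp: unit_cube_def PiE_iff extensional_def split: if_splits)
  moreover have "compactin (product_topology (\<lambda>_. euclidean) UNIV) (\<Pi>\<^sub>E i\<in>UNIV. ?S i)"
    unfolding compactin_PiE by simp
  ultimately show ?thesis
    by (simp add: euclidean_product_topology)
qed

lemma continuous_cube_dist: "continuous_on S (\<lambda>y. cube_dist d x y)"
  unfolding cube_dist_def L2_set_def
  by (intro continuous_intros continuous_on_product_then_coordinatewise continuous_on_id)

lemma cube_dist_bounded_continuous:
  fixes f :: "pt \<Rightarrow> real"
  assumes "\<And>x y. x \<in> S \<Longrightarrow> y \<in> S \<Longrightarrow> \<bar>f x - f y\<bar> \<le> cube_dist d x y"
  shows "continuous_on S f"
  unfolding continuous_on_def
proof
  fix x
  assume x: "x \<in> S"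
  have "((\<lambda>y. cube_dist d x y) \<longlongrightarrow> cube_dist d x x) (at x within S)"
    using continuous_cube_dist[of S d x] x unfolding continuous_on_def by blast
  then have lim: "((\<lambda>y. cube_dist d x y) \<longlongrightarrow> 0) (at x within S)"
    by (simp add: cube_dist_def L2_set_def)
  have "eventually (\<lambda>y. norm (f y - f x) \<le> cube_dist d x y) (at x within S)"
    using assms[OF _ x] by (auto simp: eventually_at_filter cube_dist_commute[of d x] intro!: always_eventually)
  from Lim_null_comparison[OF this lim] show "(f \<longlongrightarrow> f x) (at x within S)"
    by (simp add: LIM_zero_iff)
qed

lemma comparison_triangle:
  fixes a b c :: real
  assumes "0 \<le> a" "0 \<le> b" "0 \<le> c" "a \<le> b + c" "b \<le> a + c" "c \<le> a + b"
  shows "\<exists>p q r :: real \<times> real. dist p q = c \<and> dist q r = a \<and> dist r p = b"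
proof (cases "c = 0")
  case True
  then have "a = b"
    using assms by simp
  then show ?thesis
    using True assms by (intro exI[of _ "(0, 0)"] exI[of _ "(0, 0)"] exI[of _ "(b, 0)"]) (simp add: dist_prod_def)
next
  case False
  then have c: "0 < c"
    using assms by simp
  define x where "x = (b\<^sup>2 + c\<^sup>2 - a\<^sup>2) / (2 * c)"
  define y where "y = sqrt (b\<^sup>2 - x\<^sup>2)"
  have xc: "2 * x * c = b\<^sup>2 + c\<^sup>2 - a\<^sup>2"
    using c by (simp add: x_def)
  have "(c - b)\<^sup>2 \<le> a\<^sup>2"
    using assms by (intro abs_le_square_iff[THEN iffD1]) auto
  then have "2 * x * c \<le> 2 * b * c"
    unfolding xc by (simp add: power2_eq_square algebra_simps)
  then have 1: "x \<le> b"
    using c by simp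
  have "a\<^sup>2 \<le> (b + c)\<^sup>2"
    using assms by (intro power_mono) auto
  then have "2 * (- b) * c \<le> 2 * x * c"
    unfolding xc by (simp add: power2_eq_square algebra_simps)
  then have "- b * c \<le> x * c"
    by (simp add: mult.commute)
  then have 2: "- b \<le> x"
    using c by (rule mult_right_le_imp_le)
  have "x\<^sup>2 \<le> b\<^sup>2"
    using 1 2 by (intro abs_le_square_iff[THEN iffD1]) auto
  then have y2: "y\<^sup>2 = b\<^sup>2 - x\<^sup>2"
    by (simp add: y_def)
  have "dist (x, y) (0, 0) = sqrt (b\<^sup>2)"
    by (simp add: dist_prod_def dist_real_def y2)
  moreover have "(c - x)\<^sup>2 + y\<^sup>2 = a\<^sup>2"
    using xc y2 by (simp add: power2_eq_square algebra_simps)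
  then have "dist (c, 0) (x, y) = sqrt (a\<^sup>2)"
    by (simp add: dist_prod_def dist_real_def)
  moreover have "dist (0, 0) (c, 0 :: real) = c"
    using c by (simp add: dist_prod_def dist_real_def)
  ultimately show ?thesis
    using assms by (intro exI[of _ "(0, 0)"] exI[of _ "(c, 0)"] exI[of _ "(x, y)"]) simp
qed

lemma median_length:
  fixes p q r :: "'a::real_inner"
  shows "(dist (midpoint p q) r)\<^sup>2 = ((dist r p)\<^sup>2 + (dist r q)\<^sup>2) / 2 - (dist p q)\<^sup>2 / 4"
  unfolding dist_norm power2_norm_eq_inner midpoint_def
  by (simp add: inner_simps inner_commute field_simps)

text \<open>The inequality of Bruhat and Tits: compare the median of a triangle with the one of its
  comparison triangle, whose length is known.\<close>

lemma CAT0_midpoint: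
  assumes CAT0: "CAT0_space M d" and pq: "p \<in> M" "q \<in> M"
  obtains m where "m \<in> M" "\<forall>z\<in>M. (d z m)\<^sup>2 \<le> ((d z p)\<^sup>2 + (d z q)\<^sup>2) / 2 - (d p q)\<^sup>2 / 4"
proof -
  interpret Metric_space M d
    using CAT0 unfolding CAT0_space_def by blast
  have geo: "\<exists>c. geodesic_segment M d p q c" if "p \<in> M" "q \<in> M" for p q
    using CAT0 that unfolding CAT0_space_def by blast
  obtain a where a: "geodesic_segment M d p q a"
    using geo[OF pq] by blast
  then obtain \<gamma> where \<gamma>: "\<gamma> ` {0..d p q} = a" "a \<subseteq> M" "\<gamma> 0 = p" "\<gamma> (d p q) = q"
    and iso: "\<forall>s\<in>{0..d p q}. \<forall>t\<in>{0..d p q}. d (\<gamma> s) (\<gamma> t) = \<bar>s - t\<bar>"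
    unfolding geodesic_segment_def by blast
  define m where "m = \<gamma> (d p q / 2)"
  have half: "d p q / 2 \<in> {0..d p q}" "0 \<in> {0..d p q}"
    by auto
  have m: "m \<in> a" "m \<in> M"
    using \<gamma>(1,2) half unfolding m_def by blast+
  have dm: "d p m = d p q / 2"
    using iso[rule_format, OF half(2,1)] \<gamma>(3) by (simp add: m_def)
  have "(d z m)\<^sup>2 \<le> ((d z p)\<^sup>2 + (d z q)\<^sup>2) / 2 - (d p q)\<^sup>2 / 4" if z: "z \<in> M" for z
  proof -
    obtain b where b: "geodesic_segment M d q z b"
      using geo[OF pq(2) z] by blast
    obtain c where c: "geodesic_segment M d z p c"
      using geo[OF z pq(1)] by blast
    obtain p' q' r' :: "real \<times> real" where tri: "dist p' q' = d p q" "dist q' r' = d q z" "dist r' p' = d z p"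
      using comparison_triangle[of "d q z" "d z p" "d p q"] triangle[OF pq(2,1) z] triangle[OF z pq(2,1)]
        triangle[OF pq(1) z pq(2)] nonneg commute[of p q] commute[of q z] commute[of z p]
      by (smt (verit))
    have zb: "z \<in> b"
    proof -
      obtain \<beta> where \<beta>: "\<beta> ` {0..d q z} = b" "\<beta> (d q z) = z"
        using b unfolding geodesic_segment_def by (elim exE conjE)
      have "d q z \<in> {0..d q z}"
        by simp
      then show ?thesis
        using imageI[of "d q z" "{0..d q z}" \<beta>] unfolding \<beta> by blast
    qed
    have 1: "comparison_point d p a p' q' m (midpoint p' q')"
      using m(1) dm tri(1) by (simp add: comparison_point_def dist_midpoint)
    have 2: "comparison_point d q b q' r' z r'"
      using zb tri(2) by (simp add: comparison_point_def)
    have "d m z \<le> dist (midpoint p' q') r'"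
    proof -
      have *: "\<forall>p\<in>M. \<forall>q\<in>M. \<forall>r\<in>M. \<forall>a b c p' q' r'.
        geodesic_segment M d p q a \<and> geodesic_segment M d q r b \<and> geodesic_segment M d r p c \<and>
        dist p' q' = d p q \<and> dist q' r' = d q r \<and> dist r' p' = d r p \<longrightarrow>
        (\<forall>x x' y y'. (comparison_point d p a p' q' x x' \<or> comparison_point d q b q' r' x x' \<or>
            comparison_point d r c r' p' x x') \<and>
          (comparison_point d p a p' q' y y' \<or> comparison_point d q b q' r' y y' \<or>
            comparison_point d r c r' p' y y') \<longrightarrow> d x y \<le> dist x' y')"
        using CAT0[unfolded CAT0_space_def Let_def] by (elim conjE)
      show ?thesis
        using *[rule_format, OF pq z, of a b c p' q' r' m "midpoint p' q'" z r'] a b c tri 1 2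
        by blast
    qed
    then have "(d z m)\<^sup>2 \<le> (dist (midpoint p' q') r')\<^sup>2"
      unfolding commute[of z m] by (intro power_mono) auto
    also have "\<dots> = ((d z p)\<^sup>2 + (d z q)\<^sup>2) / 2 - (d p q)\<^sup>2 / 4"
      unfolding median_length tri(3) tri(1) using tri(2) by (simp add: dist_commute commute)
    finally show ?thesis .
  qed
  then show thesis
    using that m(2) by blast
qed

text \<open>The function \<open>f\<close> is strictly convex in the sense of the inequality of Bruhat and Tits: two
  points where it is close to its infimum are close to each other. So the points whose value is
  less than the infimum plus \<open>1/16\<close> have distance less than \<open>1/2\<close> from each other, and it suffices
  that \<open>f\<close> has a minimum on some set that contains a ball of radius \<open>1/2\<close>. This replaces
  completeness.\<close>

lemma centre_of_mass:
  fixes o' :: "'b \<Rightarrow> 'a"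
  assumes CAT0: "CAT0_space M d" and A: "finite A" "A \<noteq> {}" and o: "o' ` A \<subseteq> M" and ne: "M \<noteq> {}"
  defines "f \<equiv> \<lambda>x. \<Sum>a\<in>A. (d x (o' a))\<^sup>2"
  assumes local: "\<And>x. x \<in> M \<Longrightarrow>
    \<exists>S\<subseteq>M. {y \<in> M. d x y < 1/2} \<subseteq> S \<and> (\<exists>\<mu>\<in>S. \<forall>y\<in>S. f \<mu> \<le> f y)"
  shows "\<exists>\<mu>\<in>M. \<forall>x\<in>M. f x \<le> f \<mu> \<longrightarrow> x = \<mu>"
proof -
  interpret Metric_space M d
    using CAT0 unfolding CAT0_space_def by blast
  have f0: "0 \<le> f x" for x
    unfolding f_def by (intro sum_nonneg) simp
  have bdd: "bdd_below (f ` M)"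
    using f0 by (intro bdd_belowI[of _ 0]) auto
  define R where "R = Inf (f ` M)"
  have R: "R \<le> f x" if "x \<in> M" for x
    unfolding R_def using bdd that by (intro cInf_lower) auto
  have cardA: "1 \<le> real (card A)"
    using A by (simp add: Suc_le_eq card_gt_0_iff)
  have close: "(d x y)\<^sup>2 / 4 \<le> (f x + f y) / 2 - R" if xy: "x \<in> M" "y \<in> M" for x y
  proof -
    obtain m where m: "m \<in> M" "\<forall>z\<in>M. (d z m)\<^sup>2 \<le> ((d z x)\<^sup>2 + (d z y)\<^sup>2) / 2 - (d x y)\<^sup>2 / 4"
      using CAT0_midpoint[OF CAT0 xy] by blast
    have "R \<le> f m"
      using m(1) by (rule R)
    also have "f m \<le> (\<Sum>a\<in>A. ((d x (o' a))\<^sup>2 + (d y (o' a))\<^sup>2) / 2 - (d x y)\<^sup>2 / 4)"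
      unfolding f_def
    proof (rule sum_mono)
      fix a
      assume "a \<in> A"
      then have "o' a \<in> M"
        using o by blast
      then show "(d m (o' a))\<^sup>2 \<le> ((d x (o' a))\<^sup>2 + (d y (o' a))\<^sup>2) / 2 - (d x y)\<^sup>2 / 4"
        using m(2) commute by metis
    qed
    also have "\<dots> = (f x + f y) / 2 - card A * ((d x y)\<^sup>2 / 4)"
      by (simp add: f_def sum_subtractf sum.distrib flip: sum_divide_distrib)
    finally have "card A * ((d x y)\<^sup>2 / 4) \<le> (f x + f y) / 2 - R"
      by linarith
    moreover have "1 * ((d x y)\<^sup>2 / 4) \<le> card A * ((d x y)\<^sup>2 / 4)"
      using cardA by (intro mult_right_mono) auto
    ultimately show ?thesis
      by linarith
  qed
  have "Inf (f ` M) < R + 1/16"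
    by (simp add: R_def)
  then obtain x0 where x0: "x0 \<in> M" "f x0 < R + 1/16"
    using cInf_lessD[of "f ` M" "R + 1/16"] ne by blast
  obtain S \<mu> where S: "S \<subseteq> M" "{y \<in> M. d x0 y < 1/2} \<subseteq> S" "\<mu> \<in> S" "\<forall>y\<in>S. f \<mu> \<le> f y"
    using local[OF x0(1)] by blast
  have mu: "f \<mu> \<le> f x" if x: "x \<in> M" for x
  proof (cases "f x < R + 1/16")
    case True
    then have "(f x0 + f x) / 2 < R + 1 / 16"
      using x0(2) by simp
    then have "(d x0 x)\<^sup>2 / 4 < 1 / 16"
      using close[OF x0(1) x] by argo
    then have "(d x0 x)\<^sup>2 < (1/2)\<^sup>2"
      by (simp add: power2_eq_square)
    then have "d x0 x < 1/2"
      by (rule power2_less_imp_less) simp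
    then show ?thesis
      using S(2,4) x by blast
  next
    case False
    have "x0 \<in> S"
      using S(2) x0(1) by auto
    then have "f \<mu> \<le> f x0"
      using S(4) by blast
    then show ?thesis
      using False x0(2) by linarith
  qed
  have muM: "\<mu> \<in> M"
    using S by blast
  have "f \<mu> \<le> R"
    unfolding R_def using ne mu by (intro cInf_greatest) auto
  have "x = \<mu>" if x: "x \<in> M" "f x \<le> f \<mu>" for x
  proof -
    have "(d x \<mu>)\<^sup>2 / 4 \<le> 0"
      using close[OF x(1) muM] x(2) \<open>f \<mu> \<le> R\<close> by argo
    then show ?thesis
      using x(1) muM by simp
  qed
  then show ?thesis
    using muM by blast
qed

context glued_cubes begin

lemma pl_path_cube:
  assumes "i \<in> cubes X" "x \<in> C i" "y \<in> C i"
  shows "pl_path X (proj X i x) (proj X i y) (cube_dist (cdim X i) x y)"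
  using pl_step[OF pl_refl[OF proj_points[OF assms(1,2)]] assms] by simp

lemma length_dist_le_cube_dist:
  assumes "i \<in> cubes X" "x \<in> C i" "y \<in> C i"
  shows "length_dist X (proj X i x) (proj X i y) \<le> cube_dist (cdim X i) x y"
proof -
  have "Inf {L. pl_path X (proj X i x) (proj X i y) L} \<le> cube_dist (cdim X i) x y"
    by (rule cInf_lower) (auto intro: pl_path_cube[OF assms] bdd_belowI[of _ 0] pl_path_nonneg)
  then show ?thesis
    using pl_path_cube[OF assms] unfolding length_dist_def by auto
qed

lemma length_dist_less:
  assumes "pl_path X p q K" "length_dist X p q < r"
  obtains L where "pl_path X p q L" "L < r"
proof -
  have "Inf {L. pl_path X p q L} < r"
    using assms unfolding length_dist_def by (auto split: if_splits)
  then show thesis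
    using cInf_lessD[of "{L. pl_path X p q L}" r] assms(1) that by blast
qed

end

locale cat0_complex = glued_cubes +
  assumes CAT0_complex: "CAT0_cube_complex X"
begin

abbreviation d where "d \<equiv> length_dist X"

lemma CAT0: "CAT0_space (points X) d"
  using CAT0_complex unfolding CAT0_cube_complex_def by blast

sublocale Metric_space "points X" d
  using CAT0 unfolding CAT0_space_def by blast

lemma pl_path_exists: "p \<in> points X \<Longrightarrow> q \<in> points X \<Longrightarrow> \<exists>L. pl_path X p q L"
  using CAT0_complex unfolding CAT0_cube_complex_def by blast

lemma min_on_cube:
  assumes i: "i \<in> cubes X" and A: "finite A" "o' ` A \<subseteq> points X"
  shows "\<exists>\<mu>\<in>proj X i ` C i. \<forall>y\<in>proj X i ` C i.
    (\<Sum>a\<in>A. (d \<mu> (o' a))\<^sup>2) \<le> (\<Sum>a\<in>A. (d y (o' a))\<^sup>2)"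
proof -
  have "\<bar>d (proj X i x) z - d (proj X i y) z\<bar> \<le> cube_dist (cdim X i) x y"
    if "x \<in> C i" "y \<in> C i" "z \<in> points X" for x y z
  proof -
    have "proj X i x \<in> points X" "proj X i y \<in> points X"
      using i that by blast+
    then have "\<bar>d (proj X i x) z - d (proj X i y) z\<bar> \<le> d (proj X i x) (proj X i y)"
      using triangle[of "proj X i x" "proj X i y" z] triangle[of "proj X i y" "proj X i x" z]
        commute[of "proj X i x" "proj X i y"] that(3) by auto
    then show ?thesis
      using length_dist_le_cube_dist[OF i that(1,2)] by linarith
  qed
  then have "continuous_on (C i) (\<lambda>x. d (proj X i x) z)" if "z \<in> points X" for z
    using that by (intro cube_dist_bounded_continuous)
  then have cont: "continuous_on (C i) (\<lambda>x. \<Sum>a\<in>A. (d (proj X i x) (o' a))\<^sup>2)"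
    using A(2) by (intro continuous_intros) auto
  have ne: "C i \<noteq> {}"
    using cube_const_in[of 0 "cdim X i"] by auto
  show ?thesis
    using continuous_attains_inf[OF compact_unit_cube ne cont] by blast
qed

text \<open>A ball of radius \<open>1/2\<close> is contained in the star of a vertex, which consists of finitely many
  compact cubes.\<close>

lemma min_near:
  assumes fin: "\<And>v. v \<in> vertices X \<Longrightarrow> finite (neighbours X v)"
    and A: "finite A" "o' ` A \<subseteq> points X" and x: "x \<in> points X"
  defines "f \<equiv> \<lambda>x. \<Sum>a\<in>A. (d x (o' a))\<^sup>2"
  shows "\<exists>S\<subseteq>points X. {y \<in> points X. d x y < 1/2} \<subseteq> S \<and> (\<exists>\<mu>\<in>S. \<forall>y\<in>S. f \<mu> \<le> f y)"
proof -
  obtain v where v: "v \<in> vertices X" and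
    near: "\<And>q L. pl_path X x q L \<Longrightarrow> L < 1/2 \<Longrightarrow> \<exists>j\<in>cubes X. v \<in> proj X j ` C j \<and> q \<in> proj X j ` C j"
    using near_vertex[OF x] by metis
  define S where "S = {proj X i ` C i | i. i \<in> cubes X \<and> v \<in> proj X i ` C i}"
  have finS: "finite S"
    unfolding S_def by (rule finite_star[OF v fin[OF v]])
  have near': "\<exists>c\<in>S. y \<in> c" if y: "y \<in> points X" "d x y < 1/2" for y
  proof -
    obtain K where "pl_path X x y K"
      using pl_path_exists[OF x y(1)] by blast
    then obtain L where "pl_path X x y L" "L < 1/2"
      using length_dist_less[OF _ y(2)] by blast
    from near[OF this] show ?thesis
      unfolding S_def by blast
  qed
  have "d x x < 1/2"
    using x by simp
  then have neS: "S \<noteq> {}"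
    using near'[OF x] by blast
  have "\<forall>c\<in>S. \<exists>\<mu>. \<mu> \<in> c \<and> (\<forall>y\<in>c. f \<mu> \<le> f y)"
    using min_on_cube[OF _ A] unfolding f_def S_def by blast
  then have "\<exists>\<mu>. \<forall>c\<in>S. \<mu> c \<in> c \<and> (\<forall>y\<in>c. f (\<mu> c) \<le> f y)"
    by (rule bchoice)
  then obtain \<mu> where \<mu>: "\<forall>c\<in>S. \<mu> c \<in> c \<and> (\<forall>y\<in>c. f (\<mu> c) \<le> f y)"
    by (rule exE)
  define c0 where "c0 = arg_min_on (\<lambda>c. f (\<mu> c)) S"
  have c0: "c0 \<in> S" "\<forall>c\<in>S. f (\<mu> c0) \<le> f (\<mu> c)"
    using arg_min_if_finite[OF finS neS, of "\<lambda>c. f (\<mu> c)"] unfolding c0_def[symmetric]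
    by (simp_all add: not_less)
  show ?thesis
  proof (intro exI[of _ "\<Union>S"] conjI)
    show "\<Union>S \<subseteq> points X"
      unfolding S_def by blast
    show "{y \<in> points X. d x y < 1/2} \<subseteq> \<Union>S"
      using near' by blast
    show "\<exists>\<mu>\<in>\<Union>S. \<forall>y\<in>\<Union>S. f \<mu> \<le> f y"
    proof (intro bexI[of _ "\<mu> c0"] ballI)
      show "\<mu> c0 \<in> \<Union>S"
        using c0(1) \<mu> by blast
      fix y
      assume "y \<in> \<Union>S"
      then obtain c where "c \<in> S" "y \<in> c"
        by blast
      then show "f (\<mu> c0) \<le> f y"
        using c0(2) \<mu> by (meson order_trans)
    qed
  qed
qed

end

lemma isom_groupD:
  assumes "f \<in> carrier (isom_group M d)"
  shows "bij_betw f M M" "f \<in> extensional M" "\<And>x y. x \<in> M \<Longrightarrow> y \<in> M \<Longrightarrow> d (f x) (f y) = d x y"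
    "\<And>x. x \<in> M \<Longrightarrow> f x \<in> M"
  using assms by (auto simp: isom_group_def Bij_def dest: bij_betwE)

lemma isom_group_mult:
  assumes "f \<in> carrier (isom_group M d)" "g \<in> carrier (isom_group M d)" "x \<in> M"
  shows "(f \<otimes>\<^bsub>isom_group M d\<^esub> g) x = f (g x)"
  using assms by (simp add: isom_group_def BijGroup_def compose_def)

locale isometric_action = group H + cat0_complex X
  for H (structure) and X :: "'i cube_data" +
  fixes \<phi> :: "'h \<Rightarrow> ('i \<times> pt) set \<Rightarrow> ('i \<times> pt) set"
  assumes hom: "\<phi> \<in> hom H (Isom X)"
begin

lemma act_carrier: "g \<in> carrier H \<Longrightarrow> \<phi> g \<in> carrier (Isom X)"
  using hom by (rule hom_in_carrier)

lemmas act_isom = isom_groupD[OF act_carrier]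

lemma act_mult: "g \<in> carrier H \<Longrightarrow> h \<in> carrier H \<Longrightarrow> p \<in> points X \<Longrightarrow> \<phi> (g \<otimes> h) p = \<phi> g (\<phi> h p)"
  using hom_mult[OF hom, of g h] isom_group_mult[OF act_carrier act_carrier, of g h p] by simp

lemma act_one:
  assumes p: "p \<in> points X"
  shows "\<phi> \<one> p = p"
proof -
  have "\<phi> \<one> (\<phi> \<one> p) = \<phi> \<one> p"
    using act_mult[OF one_closed one_closed p] by simp
  moreover have "inj_on (\<phi> \<one>) (points X)"
    using act_isom(1)[OF one_closed] by (simp add: bij_betw_def)
  ultimately show ?thesis
    using act_isom(4)[OF one_closed p] p by (meson inj_onD)
qed

text \<open>The sum of the squared distances from an orbit is invariant under the group, so its unique
  minimum is a fixed point.\<close>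

theorem fixed_point:
  assumes finH: "finite (carrier H)" and ne: "points X \<noteq> {}"
    and fin: "\<And>v. v \<in> vertices X \<Longrightarrow> finite (neighbours X v)"
  shows "\<exists>p\<in>points X. \<forall>h\<in>carrier H. \<phi> h p = p"
proof -
  obtain p where p: "p \<in> points X"
    using ne by blast
  let ?o = "\<lambda>g. \<phi> g p" and ?f = "\<lambda>x. \<Sum>g\<in>carrier H. (d x (\<phi> g p))\<^sup>2"
  have o: "?o ` carrier H \<subseteq> points X"
    using act_isom(4) p by blast
  have "\<exists>\<mu>\<in>points X. \<forall>x\<in>points X. ?f x \<le> ?f \<mu> \<longrightarrow> x = \<mu>"
  proof (rule centre_of_mass[OF CAT0 finH _ o ne])
    show "carrier H \<noteq> {}"
      using one_closed by blast
  qed (rule min_near[OF fin finH o])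
  then obtain \<mu> where \<mu>: "\<mu> \<in> points X" "\<And>x. x \<in> points X \<Longrightarrow> ?f x \<le> ?f \<mu> \<Longrightarrow> x = \<mu>"
    by blast
  have "\<phi> h \<mu> = \<mu>" if h: "h \<in> carrier H" for h
  proof (rule \<mu>(2))
    show "\<phi> h \<mu> \<in> points X"
      by (rule act_isom(4)[OF h \<mu>(1)])
    have "bij_betw (\<lambda>g. h \<otimes> g) (carrier H) (carrier H)"
      using inj_on_cmult[OF h] surj_const_mult[OF h] by (simp add: bij_betw_def)
    then have "?f (\<phi> h \<mu>) = (\<Sum>g\<in>carrier H. (d (\<phi> h \<mu>) (\<phi> (h \<otimes> g) p))\<^sup>2)"
      by (rule sum.reindex_bij_betw[symmetric])
    also have "\<dots> = ?f \<mu>"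
      using act_mult[OF h _ p] act_isom(3)[OF h \<mu>(1)] act_isom(4)[OF _ p] by (intro sum.cong) auto
    finally show "?f (\<phi> h \<mu>) \<le> ?f \<mu>"
      by simp
  qed
  then show ?thesis
    using \<mu>(1) by blast
qed

end

locale cubical_action = isometric_action +
  assumes strong: "strongly_simplicial_action H X \<phi>"
begin

lemma cubical: "h \<in> carrier H \<Longrightarrow> maps_cubes_to_cubes X (\<phi> h)"
  using strong unfolding strongly_simplicial_action_def simplicial_action_def by blast

text \<open>An element that fixes \<open>p\<close> maps the cell around \<open>p\<close> to itself, hence fixes it pointwise as
  the action is strongly simplicial.\<close>

lemma fixes_carrier_cell:
  assumes h: "h \<in> carrier H" and p: "p \<in> points X" "\<phi> h p = p" and r: "r \<in> carrier_cell p"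
  shows "\<phi> h r = r"
proof -
  let ?c = "carrier_cell p"
  have sub: "?c \<subseteq> points X"
    unfolding carrier_cell_def using min_face_subset by blast
  have inv: "\<phi> (inv h) (\<phi> h q) = q" "\<phi> h (\<phi> (inv h) q) = q" if "q \<in> points X" for q
    using act_mult[OF inv_closed[OF h] h that] act_mult[OF h inv_closed[OF h] that] act_one[OF that] h
    by simp_all
  have "\<phi> h ` ?c \<subseteq> ?c"
    using cubical_map_carrier[OF cubical[OF h] p(1)] p(2) by simp
  moreover have "\<phi> (inv h) p = p"
    using inv(1)[OF p(1)] p(2) by simp
  then have inv_sub: "\<phi> (inv h) ` ?c \<subseteq> ?c"
    using cubical_map_carrier[OF cubical[OF inv_closed[OF h]] p(1)] by simp
  have "?c \<subseteq> \<phi> h ` ?c"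
  proof
    fix q
    assume q: "q \<in> ?c"
    then have "\<phi> (inv h) q \<in> ?c"
      using inv_sub by blast
    then show "q \<in> \<phi> h ` ?c"
      using inv(2)[of q] q sub by (intro image_eqI[of _ _ "\<phi> (inv h) q"]) auto
  qed
  ultimately have "\<phi> h ` ?c = ?c"
    by blast
  moreover obtain k where "?c \<in> cells X k"
    using carrier_cell_cells[OF p(1)] by blast
  ultimately show ?thesis
    using strong h r unfolding strongly_simplicial_action_def by blast
qed

lemma corners_connected:
  assumes u: "corner e u" and w: "corner e w" and P: "P u"
    and step: "\<And>u l. corner e u \<Longrightarrow> P u \<Longrightarrow> l < e \<Longrightarrow> P (flip l u)"
  shows "P w"
  using u P
proof (induction "card {l. l < e \<and> u l \<noteq> w l}" arbitrary: u)
  case 0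
  have fin: "finite {l. l < e \<and> u l \<noteq> w l}"
    by simp
  have "{l. l < e \<and> u l \<noteq> w l} = {}"
    using card_0_eq[OF fin] 0(1) by simp
  then have "u = w"
    using unit_cube_eqI[OF cornerD(1)[OF 0(2)] cornerD(1)[OF w]] by blast
  then show ?case
    using 0 by simp
next
  case (Suc n)
  have "{l. l < e \<and> u l \<noteq> w l} \<noteq> {}"
  proof
    assume "{l. l < e \<and> u l \<noteq> w l} = {}"
    then show False
      using Suc(2) by (simp only: card.empty)
  qed
  then obtain l where l: "l < e" "u l \<noteq> w l"
    by blast
  have "flip l u l = w l"
    using cornerD(2)[OF Suc(3) l(1)] cornerD(2)[OF w l(1)] l(2) by (auto simp: flip_def)
  then have eq: "{k. k < e \<and> flip l u k \<noteq> w k} = {k. k < e \<and> u k \<noteq> w k} - {l}"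
    by (auto simp: flip_def)
  have "n = card {k. k < e \<and> flip l u k \<noteq> w k}"
    unfolding eq using Suc(2) l by simp
  then show ?case
    using Suc.hyps(1) corner_flip[OF Suc(3) l(1)] step[OF Suc(3,4) l(1)] by blast
qed

text \<open>Triviality spreads along a path. If one point of a cube is fixed, then so is a corner of the
  cell around this point, then all corners of the cube, as any two are joined by a path of edges
  and neighbours of fixed vertices are fixed, then the centre of the cube, and then the cube, which
  is the cell around its centre.\<close>

theorem fixes_everything:
  assumes nb: "\<And>v w. v \<in> vertices X \<Longrightarrow> (\<forall>h\<in>carrier H. \<phi> h v = v) \<Longrightarrow> w \<in> neighbours X v \<Longrightarrow>
      \<forall>h\<in>carrier H. \<phi> h w = w"
    and p: "p \<in> points X" "\<forall>h\<in>carrier H. \<phi> h p = p" and q: "q \<in> points X"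
  shows "\<forall>h\<in>carrier H. \<phi> h q = q"
proof -
  let ?fixed = "\<lambda>r. \<forall>h\<in>carrier H. \<phi> h r = r"
  obtain L where "pl_path X p q L"
    using pl_path_exists p(1) q by blast
  then show ?thesis
    using p(2)
  proof (induction rule: pl_path.induct)
    case (pl_step p i x L y)
    have "?fixed (proj X i x)"
      using pl_step.IH pl_step.prems by blast
    then have cell: "?fixed r" if "r \<in> carrier_cell (proj X i x)" for r
      using fixes_carrier_cell[OF _ proj_points[OF pl_step.hyps(2,3)] _ that] by blast
    obtain u where u: "u \<in> min_face (cdim X i) x" "corner (cdim X i) u"
      using min_face_corner[OF pl_step.hyps(3)] by blast
    then have fu: "?fixed (proj X i u)"
      using cell carrier_cell_proj[OF pl_step.hyps(2,3)] by blast
    have corners: "?fixed (proj X i w)" if "corner (cdim X i) w" for w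
    proof (rule corners_connected[OF u(2) that, where P = "\<lambda>w. ?fixed (proj X i w)"])
      show "?fixed (proj X i u)"
        by (rule fu)
      show "?fixed (proj X i (flip l u'))"
        if "corner (cdim X i) u'" "?fixed (proj X i u')" "l < cdim X i" for u' l
      proof (rule nb)
        show "proj X i u' \<in> vertices X"
          using vertices_iff that(1) pl_step.hyps(2) by blast
        show "?fixed (proj X i u')"
          by (rule that(2))
        show "proj X i (flip l u') \<in> neighbours X (proj X i u')"
          by (rule neighbours_flip[OF pl_step.hyps(2) that(1,3)])
      qed
    qed
    let ?b = "cube_const (cdim X i) (1/2)"
    have b: "?b \<in> C i"
      by (rule cube_const_in) auto
    have c01: "corner (cdim X i) (cube_const (cdim X i) t)" if "t = 0 \<or> t = 1" for t
      using that cube_const_in[of t] by (auto simp: corner_def cube_const_def)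
    have fb: "\<phi> h (proj X i ?b) = proj X i ?b" if "h \<in> carrier H" for h
      by (rule cubical_map_centre[OF cubical[OF that] pl_step.hyps(2)]) (use corners c01 that in blast)+
    have "min_face (cdim X i) ?b = C i"
      by (rule min_face_interior) (simp add: cube_const_def)
    then have "proj X i y \<in> carrier_cell (proj X i ?b)"
      using carrier_cell_proj[OF pl_step.hyps(2) b] pl_step.hyps(4) by simp
    then show ?case
      using fixes_carrier_cell[OF _ proj_points[OF pl_step.hyps(2) b] fb] by blast
  qed
qed

end

section \<open>Words of the free group\<close>

abbreviation F where "F n \<equiv> carrier (free_group n)"

abbreviation End where "End n \<equiv> hom (free_group n) (free_group n)"

lemma carrier_free_group: "w \<in> F n \<longleftrightarrow> reduced_word w \<and> (\<forall>a\<in>set w. fst a < n)"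
  by (auto simp: free_group_def)

lemma mult_free_group [simp]: "x \<otimes>\<^bsub>free_group n\<^esub> y = word_mult x y"
  by (simp add: free_group_def)

lemma one_free_group [simp]: "\<one>\<^bsub>free_group n\<^esub> = []"
  by (simp add: free_group_def)

lemma word_mult_closed [intro]: "u \<in> F n \<Longrightarrow> v \<in> F n \<Longrightarrow> word_mult u v \<in> F n"
  using group.is_monoid[OF group_free_group, THEN monoid.m_closed, of u n v] by simp

lemma Nil_closed [simp]: "[] \<in> F n"
  by (simp add: carrier_free_group)

lemma letter_closed [simp]: "[a] \<in> F n \<longleftrightarrow> fst a < n"
  by (simp add: carrier_free_group)

lemma Cons_closed: "a # w \<in> F n \<Longrightarrow> fst a < n \<and> w \<in> F n \<and> word_mult [a] w = a # w"
  using letter_mult_reduced[of a w] by (auto simp: carrier_free_group word_mult_def dest: reduced_tl)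

lemma word_mult_Nil [simp]: "word_mult [] w = w"
  by (simp add: word_mult_def)

lemma word_mult_Cons: "word_mult (a # u) w = letter_mult a (word_mult u w)"
  by (simp add: word_mult_def)

lemma word_mult_Nil2: "u \<in> F n \<Longrightarrow> word_mult u [] = u"
  by (simp add: carrier_free_group word_mult_Nil_right)

lemma assoc: "w \<in> F n \<Longrightarrow> word_mult (word_mult u v) w = word_mult u (word_mult v w)"
  by (simp add: carrier_free_group word_mult_assoc)

definition word_inv :: "word \<Rightarrow> word" where
  "word_inv u = rev (map letter_inv u)"

lemma word_inv_simps [simp]: "word_inv [] = []" "word_inv [a] = [letter_inv a]"
    "word_inv (u @ v) = word_inv v @ word_inv u" "word_inv (word_inv u) = u"
    "length (word_inv u) = length u" "word_inv (a # u) = word_inv u @ [letter_inv a]"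
  by (simp_all add: word_inv_def rev_map comp_def)

lemma word_inv_Nil [simp]: "word_inv u = [] \<longleftrightarrow> u = []"
  by (simp add: word_inv_def)

lemma reduced_append_iff:
  "reduced_word (u @ v) \<longleftrightarrow> reduced_word u \<and> reduced_word v \<and>
     (u = [] \<or> v = [] \<or> hd v \<noteq> letter_inv (last u))"
proof (induction u rule: reduced_word.induct)
  case (2 a)
  then show ?case by (cases v) auto
qed auto

lemma letter_inv_eq_iff [simp]: "letter_inv a = letter_inv b \<longleftrightarrow> a = b"
  by (metis letter_inv_inv)

lemma reduced_word_inv [simp]: "reduced_word (word_inv u) \<longleftrightarrow> reduced_word u"
proof -
  have "reduced_word (word_inv u)" if "reduced_word u" for u
    using that
  proof (induction u)
    case (Cons a u)
    then show ?case
      by (cases u) (auto simp: reduced_append_iff word_inv_def)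
  qed simp
  then show ?thesis
    by (metis word_inv_simps(4))
qed

lemma word_inv_closed [simp]: "word_inv u \<in> F n \<longleftrightarrow> u \<in> F n"
proof -
  have "set (word_inv u) = letter_inv ` set u"
    by (simp add: word_inv_def)
  then show ?thesis
    by (simp add: carrier_free_group)
qed

lemma word_mult_inv_append: "word_mult u (word_inv u @ w) = w"
proof (induction u arbitrary: w)
  case (Cons a u)
  have "word_mult (a # u) (word_inv (a # u) @ w) = letter_mult a (word_mult u (word_inv u @ (letter_inv a # w)))"
    by (simp add: word_mult_Cons)
  also have "\<dots> = w"
    unfolding Cons.IH by simp
  finally show ?case .
qed simp

lemma word_mult_inv [simp]: "word_mult u (word_inv u) = []" "word_mult (word_inv u) u = []"
  using word_mult_inv_append[of u "[]"] word_mult_inv_append[of "word_inv u" "[]"] by simp_all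

lemma word_mult_cancel:
  assumes "w \<in> F n"
  shows "word_mult u (word_mult (word_inv u) w) = w" "word_mult (word_inv u) (word_mult u w) = w"
  using assoc[OF assms, of u "word_inv u"] assoc[OF assms, of "word_inv u" u] by simp_all

lemma word_inv_unique:
  assumes "u \<in> F n" "v \<in> F n" "word_mult u v = []"
  shows "v = word_inv u"
  using word_mult_cancel(2)[OF assms(2), of u] assms word_mult_Nil2[of "word_inv u" n] by simp

lemma word_inv_mult:
  assumes "u \<in> F n" "v \<in> F n"
  shows "word_inv (word_mult u v) = word_mult (word_inv v) (word_inv u)"
proof (rule word_inv_unique[symmetric, where n = n])
  have "word_mult (word_mult u v) (word_mult (word_inv v) (word_inv u)) =
      word_mult u (word_mult v (word_mult (word_inv v) (word_inv u)))"
    using assms by (intro assoc[of _ n]) auto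
  also have "\<dots> = []"
    using word_mult_cancel(1)[of "word_inv u" n v] assms by simp
  finally show "word_mult (word_mult u v) (word_mult (word_inv v) (word_inv u)) = []" .
qed (use assms in auto)

text \<open>In the product of two reduced words a suffix \<open>p\<close> of the first one cancels against a prefix
  of the second one, and nothing else happens.\<close>

lemma cancellation:
  assumes "reduced_word u" "reduced_word v"
  shows "\<exists>s p r. u = s @ p \<and> v = word_inv p @ r \<and> word_mult u v = s @ r"
  using assms(1)
proof (induction u)
  case Nil
  then show ?case by simp
next
  case (Cons a u)
  then obtain s p r where IH: "u = s @ p" "v = word_inv p @ r" "word_mult u v = s @ r"
    using reduced_tl by blast
  show ?case
  proof (cases s)
    case (Cons b s')
    then have "b \<noteq> letter_inv a"
      using Cons.prems IH(1) by simp
    then show ?thesis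
      using IH Cons by (intro exI[of _ "a # s"] exI[of _ p] exI[of _ r]) (simp add: word_mult_Cons)
  next
    case s: Nil
    show ?thesis
    proof (cases "r \<noteq> [] \<and> hd r = letter_inv a")
      case True
      then obtain r' where "r = letter_inv a # r'"
        by (cases r) auto
      then show ?thesis
        using IH s by (intro exI[of _ "[]"] exI[of _ "a # p"] exI[of _ r']) (simp add: word_mult_Cons)
    next
      case False
      then have "letter_mult a r = a # r"
        by (cases r) auto
      then show ?thesis
        using IH s by (intro exI[of _ "[a]"] exI[of _ p] exI[of _ r]) (simp add: word_mult_Cons)
    qed
  qed
qed

section \<open>Endomorphisms\<close>

text \<open>The values on letters that define an endomorphism. Prescribing them on inverse letters as
  well avoids case distinctions on the sign of a letter.\<close>

definition letter_map :: "nat \<Rightarrow> (letter \<Rightarrow> word) \<Rightarrow> bool" where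
  "letter_map n g \<longleftrightarrow> (\<forall>a. fst a < n \<longrightarrow> g a \<in> F n \<and> g (letter_inv a) = word_inv (g a))"

lemma letter_mapD:
  assumes "letter_map n g" "fst a < n"
  shows "g a \<in> F n" "g (letter_inv a) = word_inv (g a)"
  using assms by (simp_all only: letter_map_def)

definition spell :: "(letter \<Rightarrow> word) \<Rightarrow> word \<Rightarrow> word" where
  "spell g w = foldr word_mult (map g w) []"

text \<open>Elements of the automorphism group are extensional functions, hence the restriction.\<close>

definition endo :: "nat \<Rightarrow> (letter \<Rightarrow> word) \<Rightarrow> word \<Rightarrow> word" where
  "endo n g = restrict (spell g) (F n)"

lemma spell_simps [simp]: "spell g [] = []" "spell g (a # w) = word_mult (g a) (spell g w)"
  by (simp_all add: spell_def)

lemma spell_closed: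
  assumes "letter_map n g" "\<forall>a\<in>set w. fst a < n"
  shows "spell g w \<in> F n"
  using assms(2) 
  by (induction w) (simp_all add: word_mult_closed letter_mapD(1)[OF assms(1)])

lemma spell_letter_mult:
  assumes g: "letter_map n g" and "fst a < n" "\<forall>b\<in>set w. fst b < n"
  shows "spell g (letter_mult a w) = word_mult (g a) (spell g w)"
proof (cases "w \<noteq> [] \<and> hd w = letter_inv a")
  case True
  then obtain w' where w: "w = letter_inv a # w'"
    by (cases w) auto
  have "spell g w' \<in> F n"
    using spell_closed[OF g] assms(3) w by simp
  then show ?thesis
    using letter_mapD(2)[OF g assms(2)] word_mult_cancel(1)[of "spell g w'" n "g a"] by (simp add: w)
next
  case False
  then have "letter_mult a w = a # w"
    by (cases w) auto
  then show ?thesis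
    by simp
qed

lemma spell_word_mult:
  assumes g: "letter_map n g" and "u \<in> F n" "v \<in> F n"
  shows "spell g (word_mult u v) = word_mult (spell g u) (spell g v)"
  using assms(2)
proof (induction u)
  case (Cons a u)
  then have u: "fst a < n" "u \<in> F n"
    using Cons_closed by blast+
  have "spell g (word_mult (a # u) v) = word_mult (g a) (spell g (word_mult u v))"
    unfolding word_mult_Cons
    by (rule spell_letter_mult[OF g]) (use u word_mult_closed[OF u(2) assms(3)] in \<open>auto simp: carrier_free_group\<close>)
  also have "\<dots> = word_mult (word_mult (g a) (spell g u)) (spell g v)"
    using Cons.IH u assoc[of "spell g v" n "g a" "spell g u"] spell_closed[OF g, of v] assms(3)
    by (simp add: carrier_free_group)
  finally show ?case
    by simp
qed simp

lemma endo_hom: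
  assumes "letter_map n g"
  shows "endo n g \<in> End n"
proof (rule homI)
  show "endo n g x \<in> F n" if "x \<in> F n" for x
  proof -
    have "\<forall>a\<in>set x. fst a < n"
      using that by (simp add: carrier_free_group)
    then show ?thesis
      using that spell_closed[OF assms] by (simp add: endo_def)
  qed
  show "endo n g (x \<otimes>\<^bsub>free_group n\<^esub> y) = endo n g x \<otimes>\<^bsub>free_group n\<^esub> endo n g y"
    if "x \<in> F n" "y \<in> F n" for x y
    using that spell_word_mult[OF assms] by (simp add: endo_def word_mult_closed)
qed

lemma endo_extensional: "endo n g \<in> extensional (F n)"
  by (simp add: endo_def)

lemma endo_letter: "letter_map n g \<Longrightarrow> fst a < n \<Longrightarrow> endo n g [a] = g a"
  using letter_mapD(1)[of n g a] by (simp add: endo_def word_mult_Nil2)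

lemma hom_closed: "\<phi> \<in> End n \<Longrightarrow> w \<in> F n \<Longrightarrow> \<phi> w \<in> F n"
  by (rule hom_in_carrier)

lemma hom_word_mult:
  "\<phi> \<in> End n \<Longrightarrow> u \<in> F n \<Longrightarrow> v \<in> F n \<Longrightarrow>
     \<phi> (word_mult u v) = word_mult (\<phi> u) (\<phi> v)"
  using hom_mult[of \<phi> "free_group n" "free_group n" u v] by simp

lemma hom_Nil:
  assumes "\<phi> \<in> End n"
  shows "\<phi> [] = []"
  using hom_one[OF assms group_free_group group_free_group] by simp

lemma hom_inv:
  assumes "\<phi> \<in> End n" "u \<in> F n"
  shows "\<phi> (word_inv u) = word_inv (\<phi> u)"
  using hom_word_mult[OF assms, of "word_inv u"] hom_Nil[OF assms(1)] assms
  by (intro word_inv_unique[of _ n] hom_closed[OF assms(1)]) simp_all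

lemma hom_Cons:
  assumes "\<phi> \<in> End n" "a # w \<in> F n"
  shows "\<phi> (a # w) = word_mult (\<phi> [a]) (\<phi> w)"
  using hom_word_mult[OF assms(1), of "[a]" w] Cons_closed[OF assms(2)] by simp

lemma hom_spell:
  assumes "\<phi> \<in> End n" "w \<in> F n"
  shows "\<phi> w = spell (\<lambda>a. \<phi> [a]) w"
  using assms(2)
proof (induction w)
  case (Cons a w)
  then show ?case
    using hom_Cons[OF assms(1) Cons.prems] Cons_closed[OF Cons.prems] by simp
qed (simp add: hom_Nil[OF assms(1)])

lemma hom_eqI:
  assumes "\<phi> \<in> End n" "\<psi> \<in> End n"
    and "\<phi> \<in> extensional (F n)" "\<psi> \<in> extensional (F n)"
    and eq: "\<And>a. fst a < n \<Longrightarrow> \<phi> [a] = \<psi> [a]"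
  shows "\<phi> = \<psi>"
proof (rule extensionalityI[OF assms(3,4)])
  fix w
  assume w: "w \<in> F n"
  have "map (\<lambda>a. \<phi> [a]) w = map (\<lambda>a. \<psi> [a]) w"
    using eq w by (simp add: carrier_free_group)
  then show "\<phi> w = \<psi> w"
    unfolding hom_spell[OF assms(1) w] hom_spell[OF assms(2) w] spell_def by (simp only:)
qed

abbreviation cmp :: "nat \<Rightarrow> (word \<Rightarrow> word) \<Rightarrow> (word \<Rightarrow> word) \<Rightarrow> word \<Rightarrow> word" where
  "cmp n \<equiv> compose (F n)"

lemma cmp_hom:
  assumes "\<phi> \<in> End n" "\<psi> \<in> End n"
  shows "cmp n \<phi> \<psi> \<in> End n"
  using assms by (intro homI) (auto simp: compose_def hom_word_mult hom_closed word_mult_closed)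

lemma cmp_apply: "w \<in> F n \<Longrightarrow> cmp n \<phi> \<psi> w = \<phi> (\<psi> w)"
  by (simp add: compose_def)

lemma autoI:
  assumes \<phi>: "\<phi> \<in> End n" "\<phi> \<in> extensional (F n)"
    and \<psi>: "\<psi> \<in> End n"
    and inv: "\<And>a. fst a < n \<Longrightarrow> \<phi> (\<psi> [a]) = [a]" "\<And>a. fst a < n \<Longrightarrow> \<psi> (\<phi> [a]) = [a]"
  shows "\<phi> \<in> auto (free_group n)"
proof -
  have id: "(\<lambda>w\<in>F n. w) \<in> End n"
    by (intro homI) (auto simp: word_mult_closed)
  have 1: "cmp n \<phi> \<psi> = (\<lambda>w\<in>F n. w)"
    by (rule hom_eqI[OF cmp_hom[OF \<phi>(1) \<psi>] id]) (simp_all add: inv cmp_apply)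
  have 2: "cmp n \<psi> \<phi> = (\<lambda>w\<in>F n. w)"
    by (rule hom_eqI[OF cmp_hom[OF \<psi> \<phi>(1)] id]) (simp_all add: inv cmp_apply)
  have "bij_betw \<phi> (F n) (F n)"
  proof (rule bij_betw_byWitness[where f' = \<psi>])
    show "\<forall>w\<in>F n. \<psi> (\<phi> w) = w" "\<forall>w\<in>F n. \<phi> (\<psi> w) = w"
      using 1 2 by (metis cmp_apply restrict_apply')+
  qed (use hom_closed[OF \<phi>(1)] hom_closed[OF \<psi>] in blast)+
  then show ?thesis
    using \<phi> by (simp add: auto_def Bij_def)
qed

lemma autoD:
  assumes "\<phi> \<in> auto (free_group n)"
  shows "\<phi> \<in> End n" "\<phi> \<in> extensional (F n)" "bij_betw \<phi> (F n) (F n)"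
  using assms by (auto simp: auto_def Bij_def)

section \<open>The matrix of an automorphism\<close>

lemma exponent_sum_simps [simp]: "exponent_sum i [] = 0"
    "exponent_sum i (a # w) = (if fst a = i then (if snd a then 1 else - 1) else 0) + exponent_sum i w"
  by (simp_all add: exponent_sum_def)

lemma exponent_sum_append [simp]: "exponent_sum i (u @ v) = exponent_sum i u + exponent_sum i v"
  by (simp add: exponent_sum_def)

lemma exponent_sum_letter_mult: "exponent_sum i (letter_mult a w) = exponent_sum i [a] + exponent_sum i w"
  by (cases w) (auto simp: letter_inv_def)

lemma exponent_sum_mult [simp]: "exponent_sum i (word_mult u v) = exponent_sum i u + exponent_sum i v"
  by (induction u) (simp_all add: word_mult_Cons exponent_sum_letter_mult)

lemma exponent_sum_inv [simp]: "exponent_sum i (word_inv u) = - exponent_sum i u"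
  by (induction u) (auto simp: letter_inv_def)

lemma exponent_sum_hom:
  assumes \<phi>: "\<phi> \<in> End n" and w: "w \<in> F n"
  shows "exponent_sum i (\<phi> w) = (\<Sum>k<n. exponent_sum i (\<phi> [(k, True)]) * exponent_sum k w)"
  using w
proof (induction w)
  case Nil
  then show ?case by (simp add: hom_Nil[OF \<phi>])
next
  case (Cons a w)
  obtain j s where a: "a = (j, s)"
    by fastforce
  have aw: "fst a < n" "w \<in> F n"
    using Cons_closed[OF Cons.prems] by auto
  have "exponent_sum i (\<phi> [a]) = (\<Sum>k<n. exponent_sum i (\<phi> [(k, True)]) * exponent_sum k [a])"
  proof -
    have "(\<Sum>k<n. exponent_sum i (\<phi> [(k, True)]) * exponent_sum k [a]) =
        (\<Sum>k<n. if k = j then exponent_sum i (\<phi> [(j, True)]) * (if s then 1 else - 1) else 0)"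
      by (intro sum.cong) (auto simp: a)
    also have "\<dots> = exponent_sum i (\<phi> [(j, True)]) * (if s then 1 else - 1)"
      using aw(1) by (simp add: a)
    also have "\<dots> = exponent_sum i (\<phi> [a])"
    proof (cases s)
      case False
      then have "[a] = word_inv [(j, True)]"
        by (simp add: a letter_inv_def)
      then show ?thesis
        using hom_inv[OF \<phi>, of "[(j, True)]"] aw(1) False by (simp add: a)
    qed (simp add: a)
    finally show ?thesis by simp
  qed
  then show ?case
    using hom_Cons[OF \<phi> Cons.prems] Cons.IH[OF aw(2)]
    by (simp add: sum.distrib distrib_left)
qed

lemma aut_matrix_carrier [simp]: "aut_matrix n \<phi> \<in> carrier_mat n n"
  by (simp add: aut_matrix_def mat_of_cols_def)

lemma aut_matrix_index: "i < n \<Longrightarrow> j < n \<Longrightarrow> aut_matrix n \<phi> $$ (i, j) = exponent_sum i (\<phi> [(j, True)])"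
  by (simp add: aut_matrix_def mat_of_cols_index abelianization_def)

lemma aut_matrix_dim [simp]: "dim_row (aut_matrix n \<phi>) = n" "dim_col (aut_matrix n \<phi>) = n"
  by (simp_all only: carrier_matD[OF aut_matrix_carrier])

lemma aut_matrix_mult:
  assumes "\<phi> \<in> End n" "\<psi> \<in> End n"
  shows "aut_matrix n (cmp n \<phi> \<psi>) = aut_matrix n \<phi> * aut_matrix n \<psi>"
proof (rule eq_matI)
  fix i j
  assume "i < dim_row (aut_matrix n \<phi> * aut_matrix n \<psi>)" "j < dim_col (aut_matrix n \<phi> * aut_matrix n \<psi>)"
  then have ij: "i < n" "j < n"
    by simp_all
  have "aut_matrix n (cmp n \<phi> \<psi>) $$ (i, j) = exponent_sum i (\<phi> (\<psi> [(j, True)]))"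
    using ij by (simp add: aut_matrix_index cmp_apply)
  also have "\<dots> = (\<Sum>k<n. exponent_sum i (\<phi> [(k, True)]) * exponent_sum k (\<psi> [(j, True)]))"
    by (rule exponent_sum_hom[OF assms(1) hom_closed[OF assms(2)]]) (simp add: ij)
  also have "\<dots> = (aut_matrix n \<phi> * aut_matrix n \<psi>) $$ (i, j)"
    using ij by (simp add: scalar_prod_def aut_matrix_index atLeast0LessThan)
  finally show "aut_matrix n (cmp n \<phi> \<psi>) $$ (i, j) = (aut_matrix n \<phi> * aut_matrix n \<psi>) $$ (i, j)" .
qed simp_all

abbreviation aut_det :: "nat \<Rightarrow> (word \<Rightarrow> word) \<Rightarrow> int" where
  "aut_det n \<phi> \<equiv> Determinant.det (aut_matrix n \<phi>)"

lemma aut_det_mult: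
  assumes "\<phi> \<in> End n" "\<psi> \<in> End n"
  shows "aut_det n (cmp n \<phi> \<psi>) = aut_det n \<phi> * aut_det n \<psi>"
  unfolding aut_matrix_mult[OF assms] by (rule Determinant.det_mult) auto

lemma aut_det_id: "aut_det n (\<lambda>w\<in>F n. w) = 1"
proof -
  have "aut_matrix n (\<lambda>w\<in>F n. w) = 1\<^sub>m n"
    by (rule eq_matI) (simp_all add: aut_matrix_index)
  then show ?thesis
    by simp
qed

lemma SAut_carrier: "\<phi> \<in> carrier (SAut n) \<longleftrightarrow> \<phi> \<in> auto (free_group n) \<and> aut_det n \<phi> = 1"
  by (simp add: SAut_def AutoGroup_def SL_mat_def)

lemma SAut_mult: "\<phi> \<in> carrier (SAut n) \<Longrightarrow> \<psi> \<in> carrier (SAut n) \<Longrightarrow> \<phi> \<otimes>\<^bsub>SAut n\<^esub> \<psi> = cmp n \<phi> \<psi>"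
  by (simp add: SAut_carrier) (simp add: SAut_def AutoGroup_def BijGroup_def auto_def)

lemma SAut_one: "\<one>\<^bsub>SAut n\<^esub> = (\<lambda>w\<in>F n. w)"
  by (simp add: SAut_def AutoGroup_def BijGroup_def)

lemma group_SAut: "group (SAut n)"
  unfolding SAut_def
proof (rule group.subgroup_imp_group)
  let ?A = "AutoGroup (free_group n)"
  show A: "group ?A"
    by (rule group.AutoGroup[OF group_free_group])
  have mult: "x \<otimes>\<^bsub>?A\<^esub> y = cmp n x y" if "x \<in> carrier ?A" "y \<in> carrier ?A" for x y
    using that by (simp add: AutoGroup_def BijGroup_def auto_def)
  have det_mult: "aut_det n (x \<otimes>\<^bsub>?A\<^esub> y) = aut_det n x * aut_det n y"
    if "x \<in> carrier ?A" "y \<in> carrier ?A" for x y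
    unfolding mult[OF that] using that by (intro aut_det_mult) (auto simp: AutoGroup_def auto_def)
  have one: "\<one>\<^bsub>?A\<^esub> = (\<lambda>w\<in>F n. w)"
    by (simp add: AutoGroup_def BijGroup_def)
  show "subgroup {\<phi> \<in> carrier ?A. aut_matrix n \<phi> \<in> SL_mat n} ?A"
  proof (rule group.subgroupI[OF A])
    show "{\<phi> \<in> carrier ?A. aut_matrix n \<phi> \<in> SL_mat n} \<noteq> {}"
      using monoid.one_closed[OF group.is_monoid[OF A]] aut_det_id[of n] unfolding one by (auto simp: SL_mat_def)
  next
    fix x
    assume x: "x \<in> {\<phi> \<in> carrier ?A. aut_matrix n \<phi> \<in> SL_mat n}"
    then have inv: "inv\<^bsub>?A\<^esub> x \<in> carrier ?A"
      using group.inv_closed[OF A] by blast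
    have "aut_det n x * aut_det n (inv\<^bsub>?A\<^esub> x) = 1"
      using det_mult[OF _ inv, of x] group.r_inv[OF A, of x] x one aut_det_id[of n] by simp
    then show "inv\<^bsub>?A\<^esub> x \<in> {\<phi> \<in> carrier ?A. aut_matrix n \<phi> \<in> SL_mat n}"
      using x inv by (simp add: SL_mat_def)
  next
    fix x y
    assume "x \<in> {\<phi> \<in> carrier ?A. aut_matrix n \<phi> \<in> SL_mat n}" "y \<in> {\<phi> \<in> carrier ?A. aut_matrix n \<phi> \<in> SL_mat n}"
    then show "x \<otimes>\<^bsub>?A\<^esub> y \<in> {\<phi> \<in> carrier ?A. aut_matrix n \<phi> \<in> SL_mat n}"
      using det_mult[of x y] monoid.m_closed[OF group.is_monoid[OF A], of x y] by (simp add: SL_mat_def)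
  qed blast
qed

section \<open>Transvections\<close>

abbreviation gen :: "nat \<Rightarrow> word" where "gen i \<equiv> [(i, True)]"

text \<open>The Nielsen transvection that multiplies the letter \<open>b\<close> by the letter \<open>c\<close> on the right. As
  \<open>b\<close> may be an inverse letter, multiplication on the left is included.\<close>

definition transvection :: "nat \<Rightarrow> letter \<Rightarrow> letter \<Rightarrow> word \<Rightarrow> word" where
  "transvection n b c = endo n (\<lambda>a. if a = b then [b, c]
     else if a = letter_inv b then [letter_inv c, letter_inv b] else [a])"

definition diff_gens :: "nat \<Rightarrow> letter \<Rightarrow> letter \<Rightarrow> bool" where
  "diff_gens n b c \<longleftrightarrow> fst b < n \<and> fst c < n \<and> fst b \<noteq> fst c"

lemma same_fst: "fst a = fst b \<longleftrightarrow> a = b \<or> a = letter_inv b"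
  by (cases a; cases b) (auto simp: letter_inv_def)

lemma neq_inv: "fst b \<noteq> fst c \<Longrightarrow> c \<noteq> letter_inv b \<and> c \<noteq> b \<and> b \<noteq> letter_inv c \<and> b \<noteq> c
    \<and> letter_inv b \<noteq> c \<and> letter_inv c \<noteq> b"
  by (auto simp: letter_inv_def)

lemma transvection_letter_map:
  assumes "diff_gens n b c"
  shows "letter_map n (\<lambda>a. if a = b then [b, c]
     else if a = letter_inv b then [letter_inv c, letter_inv b] else [a])"
  using assms neq_inv[of b c]
  by (auto simp: letter_map_def diff_gens_def carrier_free_group)

lemmas transvection_hom = endo_hom[OF transvection_letter_map, folded transvection_def]

lemma transvection_letter:
  assumes "diff_gens n b c"
  shows "transvection n b c [b] = [b, c]" "transvection n b c [letter_inv b] = [letter_inv c, letter_inv b]"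
    "fst a < n \<Longrightarrow> fst a \<noteq> fst b \<Longrightarrow> transvection n b c [a] = [a]"
  using endo_letter[OF transvection_letter_map[OF assms], folded transvection_def] assms neq_inv[of a b]
  by (auto simp: diff_gens_def)

lemma pair_closed: "diff_gens n b c \<Longrightarrow> [b, c] \<in> F n"
  using neq_inv[of b c] by (auto simp: carrier_free_group diff_gens_def)

lemma diff_gens_inv [simp]: "diff_gens n (letter_inv b) c = diff_gens n b c"
    "diff_gens n b (letter_inv c) = diff_gens n b c"
  by (auto simp: diff_gens_def)

lemma diff_gens_commute: "diff_gens n b c = diff_gens n c b"
  by (auto simp: diff_gens_def)

lemma hom_pair:
  assumes "\<phi> \<in> End n" "diff_gens n b c"
  shows "\<phi> [b, c] = word_mult (\<phi> [b]) (\<phi> [c])"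
  by (rule hom_Cons[OF assms(1) pair_closed[OF assms(2)]])

lemma hom_letter_inv:
  assumes "\<phi> \<in> End n" "fst a < n"
  shows "\<phi> [letter_inv a] = word_inv (\<phi> [a])"
  using hom_inv[OF assms(1), of "[a]"] assms(2) by simp

lemma transvection_cancel:
  assumes i: "diff_gens n b c" and a: "fst a < n"
  shows "transvection n b c (transvection n b (letter_inv c) [a]) = [a]"
proof -
  let ?t = "transvection n b c"
  have i': "diff_gens n b (letter_inv c)"
    using i by simp
  have n: "fst b < n" "fst c < n" "fst b \<noteq> fst c"
    using i by (auto simp: diff_gens_def)
  have tc: "?t [c] = [c]" "?t [letter_inv c] = [letter_inv c]"
    using transvection_letter(3)[OF i] n by auto
  have pos: "?t (transvection n b (letter_inv c) [b]) = [b]"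
    using hom_pair[OF transvection_hom[OF i] i'] transvection_letter(1)[OF i'] transvection_letter(1)[OF i] tc
      neq_inv[OF n(3)]
    by (simp add: word_mult_def)
  consider "a = b" | "a = letter_inv b" | "fst a \<noteq> fst b"
    using same_fst[of a b] by blast
  then show ?thesis
  proof cases
    case 2
    have "?t (transvection n b (letter_inv c) [letter_inv b]) = word_inv [b]"
      using pos hom_letter_inv[OF transvection_hom[OF i'] n(1)] n
        hom_inv[OF transvection_hom[OF i] hom_closed[OF transvection_hom[OF i']], of "[b]"] by simp
    then show ?thesis
      using 2 by simp
  qed (use pos transvection_letter(3)[OF i a] transvection_letter(3)[OF i' a] in simp_all)
qed

lemma transvection_auto:
  assumes i: "diff_gens n b c"
  shows "transvection n b c \<in> auto (free_group n)"
proof (rule autoI)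
  have i': "diff_gens n b (letter_inv c)"
    using i by simp
  show "transvection n b (letter_inv c) \<in> End n"
    by (rule transvection_hom[OF i'])
  show "transvection n b (letter_inv c) (transvection n b c [a]) = [a]" if "fst a < n" for a
    using transvection_cancel[OF i' that] by simp
  show "transvection n b c \<in> extensional (F n)"
    by (simp add: transvection_def endo_extensional)
qed (use transvection_cancel[OF i] transvection_hom[OF i] in blast)+

text \<open>The matrix is elementary; the sign of the extra entry depends on the signs of the two
  letters.\<close>

lemma transvection_det:
  assumes i: "diff_gens n b c"
  shows "aut_det n (transvection n b c) = 1"
proof -
  have n: "fst b < n" "fst c < n" "fst b \<noteq> fst c"
    using i by (auto simp: diff_gens_def)
  let ?x = "if snd b = snd c then 1 else - 1 :: int"
  have "aut_matrix n (transvection n b c) = addrow_mat n ?x (fst c) (fst b)"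
  proof (rule eq_matI)
    fix k j
    assume "k < dim_row (addrow_mat n ?x (fst c) (fst b))" "j < dim_col (addrow_mat n ?x (fst c) (fst b))"
    then have kj: "k < n" "j < n"
      by simp_all
    show "aut_matrix n (transvection n b c) $$ (k, j) = addrow_mat n ?x (fst c) (fst b) $$ (k, j)"
    proof (cases "j = fst b")
      case True
      show ?thesis
      proof (cases "snd b")
        case sb: True
        then have "transvection n b c (gen j) = [b, c]"
          using transvection_letter(1)[OF i] True by (cases b) simp
        then show ?thesis
          using kj n True sb by (auto simp: aut_matrix_index)
      next
        case sb: False
        then have "letter_inv b = (j, True)"
          using True by (cases b) (simp add: letter_inv_def)
        then have "transvection n b c (gen j) = [letter_inv c, letter_inv b]"
          using transvection_letter(2)[OF i] by simp
        then show ?thesis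
          using kj n True sb by (auto simp: aut_matrix_index letter_inv_def)
      qed
    next
      case False
      then show ?thesis
        using transvection_letter(3)[OF i, of "(j, True)"] kj by (auto simp: aut_matrix_index)
    qed
  qed simp_all
  then show ?thesis
    using det_addrow_mat[of "fst c" "fst b" n ?x] n(3) by simp
qed

lemma transvection_SAut: "diff_gens n b c \<Longrightarrow> transvection n b c \<in> carrier (SAut n)"
  by (simp add: SAut_carrier transvection_auto transvection_det)

lemma cmp_transvection:
  assumes \<phi>: "\<phi> \<in> End n" and i: "diff_gens n b c"
  shows "cmp n \<phi> (transvection n b c) [b] = word_mult (\<phi> [b]) (\<phi> [c])"
    and "cmp n \<phi> (transvection n b c) [letter_inv b] = word_inv (word_mult (\<phi> [b]) (\<phi> [c]))"
    and "fst a < n \<Longrightarrow> fst a \<noteq> fst b \<Longrightarrow> cmp n \<phi> (transvection n b c) [a] = \<phi> [a]"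
proof -
  have b: "fst b < n"
    using i by (simp add: diff_gens_def)
  show 1: "cmp n \<phi> (transvection n b c) [b] = word_mult (\<phi> [b]) (\<phi> [c])"
    using transvection_letter(1)[OF i] hom_pair[OF \<phi> i] b by (simp add: cmp_apply)
  then show "cmp n \<phi> (transvection n b c) [letter_inv b] = word_inv (word_mult (\<phi> [b]) (\<phi> [c]))"
    using hom_letter_inv[OF cmp_hom[OF \<phi> transvection_hom[OF i]] b] by simp
  show "fst a < n \<Longrightarrow> fst a \<noteq> fst b \<Longrightarrow> cmp n \<phi> (transvection n b c) [a] = \<phi> [a]"
    using transvection_letter(3)[OF i] by (simp add: cmp_apply)
qed

text \<open>Composition with a transvection changes the image of one generator only. The functions to be
  used are the length and the weight of a word, which do not distinguish a word from its inverse.\<close>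

lemma transvection_measure:
  fixes f :: "word \<Rightarrow> nat"
  assumes \<phi>: "\<phi> \<in> End n" and i: "diff_gens n b c"
    and f: "\<And>w. w \<in> F n \<Longrightarrow> f (word_inv w) = f w"
  shows "(\<Sum>k<n. f (cmp n \<phi> (transvection n b c) (gen k))) + f (\<phi> [b]) =
    (\<Sum>k<n. f (\<phi> (gen k))) + f (word_mult (\<phi> [b]) (\<phi> [c]))"
proof -
  let ?\<psi> = "cmp n \<phi> (transvection n b c)"
  have n: "fst b < n" "fst c < n"
    using i by (auto simp: diff_gens_def)
  have \<psi>: "?\<psi> \<in> End n"
    by (rule cmp_hom[OF \<phi> transvection_hom[OF i]])
  have gen: "f (\<theta> (gen (fst b))) = f (\<theta> [b])" if "\<theta> \<in> End n" for \<theta>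
  proof -
    have "(fst b, True) = b \<or> (fst b, True) = letter_inv b"
      by (cases b) (auto simp: letter_inv_def)
    then show ?thesis
      using hom_letter_inv[OF that n(1)] f[OF hom_closed[OF that, of "[b]"]] n(1) by auto
  qed
  have split: "(\<Sum>k<n. f (\<theta> (gen k))) = f (\<theta> [b]) + (\<Sum>k\<in>{..<n} - {fst b}. f (\<theta> (gen k)))"
    if "\<theta> \<in> End n" for \<theta>
    using sum.remove[of "{..<n}" "fst b" "\<lambda>k. f (\<theta> (gen k))"] n(1) gen[OF that] by simp
  have "(\<Sum>k\<in>{..<n} - {fst b}. f (?\<psi> (gen k))) = (\<Sum>k\<in>{..<n} - {fst b}. f (\<phi> (gen k)))"
    using cmp_transvection(3)[OF \<phi> i] by (intro sum.cong) auto
  then show ?thesis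
    unfolding split[OF \<phi>] split[OF \<psi>] cmp_transvection(1)[OF \<phi> i] by simp
qed

section \<open>Cancellation\<close>

lemma self_inverse_word: "reduced_word t \<Longrightarrow> word_inv t = t \<Longrightarrow> t = []"
proof (induction "length t" arbitrary: t rule: less_induct)
  case less
  show ?case
  proof (cases t)
    case (Cons a t')
    show ?thesis
    proof (cases t' rule: rev_cases)
      case Nil
      then show ?thesis
        using less.prems(2) Cons by simp
    next
      case (snoc m b)
      then have "b = letter_inv a" "word_inv m = m"
        using less.prems(2) Cons by auto
      moreover have "reduced_word m"
        using less.prems(1) Cons snoc reduced_append_iff[of "[a]" "m @ [b]"] reduced_append_iff[of m "[b]"]
        by simp
      ultimately have "m = []"
        using less.hyps[of m] Cons snoc by simp
      then show ?thesis
        using less.prems(1) Cons snoc \<open>b = letter_inv a\<close> by simp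
    qed
  qed simp
qed

text \<open>Less than half of a reduced word cancels in its square. If at least half of it did, then the
  word would be \<open>s @ t @ r\<close> with \<open>t\<close> equal to its own inverse, so \<open>t\<close> would be empty and the word
  would be \<open>s\<close> followed by the inverse of \<open>s\<close>.\<close>

lemma self_cancellation:
  assumes u: "reduced_word u" "u \<noteq> []" and eq: "u = s @ p" "u = word_inv p @ r"
  shows "2 * length p < length u"
proof (rule ccontr)
  assume "\<not> 2 * length p < length u"
  then have "length s \<le> length (word_inv p)"
    using eq(1) by simp
  moreover have "s @ p = word_inv p @ r"
    using eq by simp
  ultimately obtain t where t: "word_inv p = s @ t"
    by (metis append_eq_append_conv_if append_take_drop_id)
  have "p = word_inv (word_inv p)"
    by simp
  then have p: "p = word_inv t @ word_inv s"
    unfolding t by simp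
  have "word_inv t @ word_inv s = t @ r"
    using eq unfolding t p by simp
  then have "word_inv t = t"
    by (simp add: append_eq_append_conv)
  moreover have "reduced_word t"
    using u(1) eq(2) t by (simp add: reduced_append_iff)
  ultimately have "t = []"
    using self_inverse_word by blast
  then have us: "u = s @ word_inv s"
    using eq(1) p by simp
  then have "s \<noteq> []"
    using u(2) by auto
  then have "hd (word_inv s) = letter_inv (last s)"
    by (simp add: word_inv_def hd_rev last_map)
  then show False
    using u(1) \<open>s \<noteq> []\<close> unfolding us reduced_append_iff by simp
qed

text \<open>For reduced words, the number of letters of \<open>u\<close>, and of \<open>v\<close>, that cancel in the product.\<close>

definition cancel :: "word \<Rightarrow> word \<Rightarrow> nat" where
  "cancel u v = (length u + length v - length (word_mult u v)) div 2"

lemma cancelE: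
  assumes "reduced_word u" "reduced_word v"
  obtains s p r where "u = s @ p" "v = word_inv p @ r" "word_mult u v = s @ r" "length p = cancel u v"
proof -
  obtain s p r where *: "u = s @ p" "v = word_inv p @ r" "word_mult u v = s @ r"
    using cancellation[OF assms] by blast
  moreover have "length p = cancel u v"
    unfolding cancel_def *(3) by (simp add: *(1,2))
  ultimately show thesis
    using that by blast
qed

lemma length_word_mult:
  assumes "reduced_word u" "reduced_word v"
  shows "length (word_mult u v) + 2 * cancel u v = length u + length v"
    "cancel u v \<le> length u" "cancel u v \<le> length v"
proof -
  obtain s p r where *: "u = s @ p" "v = word_inv p @ r" "word_mult u v = s @ r" "length p = cancel u v"
    using cancelE[OF assms] by blast
  have "length u = length s + cancel u v" "length v = cancel u v + length r"
      "length (word_mult u v) = length s + length r"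
    using * by (metis length_append word_inv_simps(5))+
  then show "length (word_mult u v) + 2 * cancel u v = length u + length v"
    "cancel u v \<le> length u" "cancel u v \<le> length v"
    by linarith+
qed

lemma cancel_self: "reduced_word u \<Longrightarrow> u \<noteq> [] \<Longrightarrow> 2 * cancel u u < length u"
  by (metis cancelE self_cancellation)

lemma reduced_glue:
  assumes "reduced_word (u @ m)" "reduced_word (m @ v)" "m \<noteq> []"
  shows "reduced_word (u @ m @ v)"
  using assms by (auto simp: reduced_append_iff)

text \<open>If for any letter \<open>b\<close> of a reduced word the cancellations with the two adjacent letters do
  not use up the image of \<open>b\<close>, then each letter leaves a nonempty trace in the image of the word.
  The induction keeps track of the last factor, whose end is still intact.\<close>

lemma long_image:
  assumes \<phi>: "\<phi> \<in> End n"
    and N0: "\<And>a. fst a < n \<Longrightarrow> \<phi> [a] \<noteq> []"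
    and N2: "\<And>a b c. fst a < n \<Longrightarrow> fst b < n \<Longrightarrow> fst c < n \<Longrightarrow> b \<noteq> letter_inv a \<Longrightarrow> c \<noteq> letter_inv b \<Longrightarrow>
      cancel (\<phi> [a]) (\<phi> [b]) + cancel (\<phi> [b]) (\<phi> [c]) < length (\<phi> [b])"
    and N1: "\<And>a b. fst a < n \<Longrightarrow> fst b < n \<Longrightarrow> b \<noteq> letter_inv a \<Longrightarrow>
      cancel (\<phi> [a]) (\<phi> [b]) < length (\<phi> [b])"
    and "w @ [b] \<in> F n"
  shows "\<exists>A k. \<phi> (w @ [b]) = A @ drop k (\<phi> [b]) \<and> length w \<le> length A \<and>
     (w = [] \<and> k = 0 \<or> w \<noteq> [] \<and> k = cancel (\<phi> [last w]) (\<phi> [b]))"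
  using assms(5)
proof (induction w arbitrary: b rule: rev_induct)
  case Nil
  then show ?case by (intro exI[of _ "[]"] exI[of _ 0]) simp
next
  case (snoc a w)
  have wab: "w @ [a] \<in> F n" "fst a < n" "fst b < n" "b \<noteq> letter_inv a"
    using snoc.prems by (auto simp: carrier_free_group reduced_append_iff)
  obtain A k where IH: "\<phi> (w @ [a]) = A @ drop k (\<phi> [a])" "length w \<le> length A"
    "w = [] \<and> k = 0 \<or> w \<noteq> [] \<and> k = cancel (\<phi> [last w]) (\<phi> [a])"
    using snoc.IH[OF wab(1)] by blast
  have red: "reduced_word (\<phi> [a])" "reduced_word (\<phi> [b])" "reduced_word (\<phi> (w @ [a]))"
    using hom_closed[OF \<phi>] wab by (auto simp: carrier_free_group)
  obtain s p r where spr: "\<phi> [a] = s @ p" "\<phi> [b] = word_inv p @ r" "word_mult (\<phi> [a]) (\<phi> [b]) = s @ r"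
    "length p = cancel (\<phi> [a]) (\<phi> [b])"
    using cancelE[OF red(1,2)] by blast
  \<comment> \<open>The part of the image of \<open>a\<close> between the two cancellations is not empty.\<close>
  have ks: "k < length s"
  proof (cases "w = []")
    case True
    have "cancel (\<phi> [letter_inv b]) (\<phi> [letter_inv a]) < length (\<phi> [letter_inv a])"
      using N1[of "letter_inv b" "letter_inv a"] wab by auto
    moreover have "word_mult (\<phi> [letter_inv b]) (\<phi> [letter_inv a]) = word_inv (word_mult (\<phi> [a]) (\<phi> [b]))"
      using word_inv_mult[of "\<phi> [a]" n "\<phi> [b]"] hom_letter_inv[OF \<phi>] hom_closed[OF \<phi>] wab by simp
    ultimately have "cancel (\<phi> [a]) (\<phi> [b]) < length (\<phi> [a])"
      using hom_letter_inv[OF \<phi>] wab by (simp add: cancel_def add.commute)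
    then show ?thesis
      using IH(3) True spr(1,4) by simp
  next
    case False
    have "fst (last w) < n" "a \<noteq> letter_inv (last w)"
      using wab(1) False by (auto simp: carrier_free_group reduced_append_iff)
    then have "k + cancel (\<phi> [a]) (\<phi> [b]) < length (\<phi> [a])"
      using N2[of "last w" a b] wab IH(3) False by simp
    then show ?thesis
      using spr(1,4) by simp
  qed
  have wa: "\<phi> (w @ [a]) = (A @ drop k s) @ p"
    using IH(1) ks by (simp add: spr(1))
  have "reduced_word (s @ r)"
    using reduced_word_mult[OF red(2), of "\<phi> [a]"] spr(3) by simp
  then have "reduced_word (take k s @ (drop k s @ r))"
    by (metis append_assoc append_take_drop_id)
  then have "reduced_word (drop k s @ r)"
    unfolding reduced_append_iff by blast
  moreover have "reduced_word (A @ drop k s)"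
    using red(3) unfolding wa reduced_append_iff by blast
  ultimately have red': "reduced_word (A @ drop k s @ r)"
    using ks by (intro reduced_glue) auto
  have split: "word_mult (w @ [a]) [b] = w @ [a] @ [b]"
  proof -
    have "reduced_word (w @ [a, b])"
      using snoc.prems by (simp add: carrier_free_group)
    then have "word_mult (w @ [a]) [b] = w @ [a, b]"
    proof (induction w)
      case Nil
      then show ?case by (simp add: word_mult_def)
    next
      case (Cons x w)
      then show ?case
        using reduced_tl letter_mult_reduced[of x "w @ [a, b]"] by (simp add: word_mult_Cons)
    qed
    then show ?thesis by simp
  qed
  have "\<phi> (w @ [a] @ [b]) = word_mult (\<phi> (w @ [a])) (\<phi> [b])"
    using hom_word_mult[OF \<phi> wab(1), of "[b]"] wab(3) split by simp
  also have "\<dots> = (A @ drop k s) @ r"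
  proof -
    have app: "word_mult (x @ y) z = word_mult x (word_mult y z)" for x y z
      by (simp add: word_mult_def)
    have prepend: "word_mult x z = x @ z" if "reduced_word (x @ z)" for x z
      using that
    proof (induction x)
      case (Cons y x)
      then show ?case
        using reduced_tl[of y "x @ z"] letter_mult_reduced[of y "x @ z"] by (simp add: word_mult_Cons)
    qed simp
    have "word_mult p (\<phi> [b]) = r"
      unfolding spr(2) by (rule word_mult_inv_append)
    then show ?thesis
      unfolding wa app[of "A @ drop k s" p] using prepend[of "A @ drop k s" r] red' by simp
  qed
  finally have "\<phi> ((w @ [a]) @ [b]) = (A @ drop k s) @ drop (length p) (\<phi> [b])"
    by (simp add: spr(2))
  moreover have "length (w @ [a]) \<le> length (A @ drop k s)"
    using IH(2) ks by simp
  ultimately show ?case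
    using spr(4) by (intro exI[of _ "A @ drop k s"] exI[of _ "length p"]) simp
qed

section \<open>The weight of a word\<close>

text \<open>Words are read as numbers in base \<open>B\<close>, which orders words of equal length lexicographically.\<close>

fun digits :: "nat \<Rightarrow> word \<Rightarrow> nat" where
  "digits B [] = 0"
| "digits B (a # w) = (2 * fst a + of_bool (snd a)) * B ^ length w + digits B w"

lemma digits_append: "digits B (u @ v) = digits B u * B ^ length v + digits B v"
  by (induction u) (simp_all add: power_add algebra_simps)

lemma digits_less: "\<forall>a\<in>set w. fst a < n \<Longrightarrow> digits (2 * n) w < (2 * n) ^ length w"
proof (induction w)
  case (Cons a w)
  have "2 * fst a + of_bool (snd a) + 1 \<le> 2 * n"
    using Cons.prems by (auto simp: of_bool_def)
  then have "(2 * fst a + of_bool (snd a) + 1) * (2 * n) ^ length w \<le> 2 * n * (2 * n) ^ length w"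
    by (intro mult_right_mono) auto
  then show ?case
    using Cons by simp
qed simp

lemma div_mod_unique:
  fixes x y c e B :: nat
  assumes "x * B + c = y * B + e" "c < B" "e < B"
  shows "x = y" "c = e"
proof -
  have "x = (x * B + c) div B" "y = (y * B + e) div B"
    using assms(2,3) by simp_all
  then show "x = y"
    using assms(1) by simp
  then show "c = e"
    using assms(1) by simp
qed

lemma digits_inj:
  "\<forall>a\<in>set u. fst a < n \<Longrightarrow> \<forall>a\<in>set v. fst a < n \<Longrightarrow> length u = length v \<Longrightarrow>
     digits (2 * n) u = digits (2 * n) v \<Longrightarrow> u = v"
proof (induction u arbitrary: v)
  case (Cons a u)
  obtain b v' where v: "v = b # v'"
    using Cons.prems(3) by (cases v) auto
  let ?B = "(2 * n) ^ length u"
  have less: "digits (2 * n) u < ?B" "digits (2 * n) v' < ?B"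
    using digits_less[of u n] digits_less[of v' n] Cons.prems v by auto
  have eq: "(2 * fst a + of_bool (snd a)) * ?B + digits (2 * n) u =
      (2 * fst b + of_bool (snd b)) * ?B + digits (2 * n) v'"
    using Cons.prems v by simp
  note du = div_mod_unique[OF eq less]
  have "fst a = fst b \<and> snd a = snd b"
    using du(1) by (cases "snd a"; cases "snd b") (simp_all, presburger+)
  moreover have "u = v'"
    using Cons.IH[of v'] Cons.prems(1-3) v du(2) by simp
  ultimately show ?case
    using v by (simp add: prod_eq_iff)
qed simp

definition half :: "word \<Rightarrow> word" where
  "half w = take ((length w + 1) div 2) w"

text \<open>Nielsen's tie-break compares the first halves, rounded up, of a word and of its inverse.\<close>

definition weight :: "nat \<Rightarrow> word \<Rightarrow> nat" where
  "weight n w = digits (2 * n) (half w) + digits (2 * n) (half (word_inv w))"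

lemma weight_inv: "weight n (word_inv w) = weight n w"
  by (simp add: weight_def)

text \<open>A prefix of at most half the length does not occur in the first half of the inverse.\<close>

lemma weight_less:
  assumes "length p = length q" "2 * length q \<le> length (q @ r)" "digits (2 * n) p < digits (2 * n) q" "0 < n"
  shows "weight n (p @ r) < weight n (q @ r)"
proof -
  let ?k = "(length (q @ r) + 1) div 2"
  have k: "length q \<le> ?k" "?k \<le> length r"
    using assms(2) by auto
  have "half (p @ r) = p @ take (?k - length q) r" "half (q @ r) = q @ take (?k - length q) r"
    using k assms(1) by (simp_all add: half_def)
  then have "digits (2 * n) (half (p @ r)) < digits (2 * n) (half (q @ r))"
    using assms(3,4) by (simp add: digits_append)
  moreover have "half (word_inv (p @ r)) = half (word_inv (q @ r))"
    using k assms(1) by (simp add: half_def)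
  ultimately show ?thesis
    by (simp add: weight_def)
qed

section \<open>Nielsen reduction\<close>

text \<open>For an automorphism this says that it permutes the generators up to sign. This form is the
  one that surjectivity provides.\<close>

definition permutes_letters :: "nat \<Rightarrow> (word \<Rightarrow> word) \<Rightarrow> bool" where
  "permutes_letters n \<phi> \<longleftrightarrow> (\<forall>a. fst a < n \<longrightarrow> (\<exists>b. fst b < n \<and> \<phi> [b] = [a]))"

lemma auto_letter_nonempty:
  assumes "\<phi> \<in> auto (free_group n)" "fst a < n"
  shows "\<phi> [a] \<noteq> []"
proof
  assume "\<phi> [a] = []"
  then have "\<phi> [a] = \<phi> []"
    using hom_Nil[OF autoD(1)[OF assms(1)]] by simp
  then have "[a] = []"
    by (rule inj_onD[OF bij_betw_imp_inj_on[OF autoD(3)[OF assms(1)]]]) (simp_all add: assms(2))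
  then show False
    by simp
qed

text \<open>Images of reduced words are at least as long as the words. A preimage of a generator is
  therefore a single letter.\<close>

lemma Nielsen_reduced_permutes_letters:
  assumes \<phi>: "\<phi> \<in> auto (free_group n)"
    and N1: "\<And>a b. fst a < n \<Longrightarrow> fst b < n \<Longrightarrow> b \<noteq> letter_inv a \<Longrightarrow>
      2 * cancel (\<phi> [a]) (\<phi> [b]) \<le> length (\<phi> [b])"
    and N2: "\<And>a b c. fst a < n \<Longrightarrow> fst b < n \<Longrightarrow> fst c < n \<Longrightarrow> b \<noteq> letter_inv a \<Longrightarrow> c \<noteq> letter_inv b \<Longrightarrow>
      cancel (\<phi> [a]) (\<phi> [b]) + cancel (\<phi> [b]) (\<phi> [c]) < length (\<phi> [b])"
  shows "permutes_letters n \<phi>"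
  unfolding permutes_letters_def
proof (intro allI impI)
  note hom = autoD(1)[OF \<phi>]
  have ne: "\<phi> [a] \<noteq> []" if "fst a < n" for a
    by (rule auto_letter_nonempty[OF \<phi> that])
  have N1': "cancel (\<phi> [a]) (\<phi> [b]) < length (\<phi> [b])" if "fst a < n" "fst b < n" "b \<noteq> letter_inv a" for a b
  proof -
    have "0 < length (\<phi> [b])"
      using ne[OF that(2)] by simp
    then show ?thesis
      using N1[OF that] by linarith
  qed
  fix a :: letter
  assume a: "fst a < n"
  obtain w where w: "w \<in> F n" "\<phi> w = [a]"
    using autoD(3)[OF \<phi>] a by (metis bij_betw_iff_bijections letter_closed)
  have "w \<noteq> []"
    using w hom_Nil[OF hom] by auto
  then obtain v b where v: "w = v @ [b]"
    by (metis rev_exhaust)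
  have vb: "v @ [b] \<in> F n" "fst b < n"
    using w(1) v by (auto simp: carrier_free_group)
  obtain A k where A: "\<phi> (v @ [b]) = A @ drop k (\<phi> [b])" "length v \<le> length A"
     "v = [] \<and> k = 0 \<or> v \<noteq> [] \<and> k = cancel (\<phi> [last v]) (\<phi> [b])"
    using long_image[OF hom ne N2 N1' vb(1)] by blast
  have "k < length (\<phi> [b])"
  proof (cases "v = []")
    case True
    then show ?thesis
      using A(3) ne[OF vb(2)] by simp
  next
    case False
    have "fst (last v) < n" "b \<noteq> letter_inv (last v)"
      using vb(1) False by (auto simp: carrier_free_group reduced_append_iff)
    then show ?thesis
      using A(3) False N1'[of "last v" b] vb(2) by simp
  qed
  then have "v = []"
    using A(1,2) w(2) v by (cases "\<phi> [b]"; cases A) (auto simp: Suc_le_eq)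
  then have "\<phi> [b] = [a]"
    using w(2) v by simp
  then show "\<exists>b. fst b < n \<and> \<phi> [b] = [a]"
    using vb(2) by blast
qed

lemma permutes_letters_surj:
  assumes "permutes_letters n \<phi>" "fst b < n"
  shows "\<exists>a. fst a < n \<and> \<phi> [b] = [a]"
proof -
  let ?L = "{a :: letter. fst a < n}"
  have fin: "finite ?L"
  proof -
    have "?L = {..<n} \<times> UNIV"
      by auto
    then show ?thesis
      by simp
  qed
  have "\<forall>a\<in>?L. \<exists>b. b \<in> ?L \<and> \<phi> [b] = [a]"
    using assms(1) unfolding permutes_letters_def by simp
  then have "\<exists>f. \<forall>a\<in>?L. f a \<in> ?L \<and> \<phi> [f a] = [a]"
    by (rule bchoice)
  then obtain f where f: "\<forall>a\<in>?L. f a \<in> ?L \<and> \<phi> [f a] = [a]"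
    by (rule exE)
  have "inj_on f ?L"
  proof (rule inj_onI)
    fix x y
    assume xy: "x \<in> ?L" "y \<in> ?L" "f x = f y"
    have "[x] = \<phi> [f x]" "[y] = \<phi> [f y]"
      using f[rule_format, OF xy(1)] f[rule_format, OF xy(2)] by simp_all
    then show "x = y"
      using xy(3) by (metis list.inject)
  qed
  then have "f ` ?L = ?L"
    using f by (intro endo_inj_surj[OF fin] image_subsetI) blast+
  then obtain a where "a \<in> ?L" "b = f a"
    using assms(2) by blast
  then show ?thesis
    using f by blast
qed

locale transvection_subgroup =
  fixes n :: nat and K :: "(word \<Rightarrow> word) set"
  assumes K: "subgroup K (SAut n)"
    and transvection_in: "\<And>b c. diff_gens n b c \<Longrightarrow> transvection n b c \<in> K"
begin

lemma step_back:
  assumes \<phi>: "\<phi> \<in> carrier (SAut n)" and i: "diff_gens n b c"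
    and "cmp n \<phi> (transvection n b c) \<in> K"
  shows "\<phi> \<in> K"
proof -
  interpret group "SAut n"
    by (rule group_SAut)
  let ?t = "transvection n b c"
  have t: "?t \<in> carrier (SAut n)"
    by (rule transvection_SAut[OF i])
  have "\<phi> = \<phi> \<otimes>\<^bsub>SAut n\<^esub> ?t \<otimes>\<^bsub>SAut n\<^esub> inv\<^bsub>SAut n\<^esub> ?t"
    using \<phi> t by (simp add: m_assoc)
  also have "\<dots> \<in> K"
  proof (rule subgroup.m_closed[OF K])
    show "\<phi> \<otimes>\<^bsub>SAut n\<^esub> ?t \<in> K"
      unfolding SAut_mult[OF \<phi> t] by (rule assms(3))
    show "inv\<^bsub>SAut n\<^esub> ?t \<in> K"
      by (rule subgroup.m_inv_closed[OF K transvection_in[OF i]])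
  qed
  finally show ?thesis .
qed

lemma cmp_transvection_SAut:
  assumes "\<phi> \<in> carrier (SAut n)" "diff_gens n b c"
  shows "cmp n \<phi> (transvection n b c) \<in> carrier (SAut n)"
  using monoid.m_closed[OF group.is_monoid[OF group_SAut] assms(1) transvection_SAut[OF assms(2)]]
    SAut_mult[OF assms(1) transvection_SAut[OF assms(2)]] by simp

lemma SAut_hom: "\<phi> \<in> carrier (SAut n) \<Longrightarrow> \<phi> \<in> End n"
  by (simp add: SAut_carrier autoD)

text \<open>The product of these three transvections maps \<open>e\<close> to \<open>c\<close> and \<open>c\<close> to the inverse of \<open>e\<close>, as a
  rotation by a quarter turn does; here it is composed with \<open>\<sigma>\<close>.\<close>

definition quarter_turn :: "letter \<Rightarrow> letter \<Rightarrow> (word \<Rightarrow> word) \<Rightarrow> word \<Rightarrow> word" where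
  "quarter_turn e c \<sigma> = cmp n (cmp n (cmp n \<sigma> (transvection n (letter_inv e) (letter_inv c)))
     (transvection n (letter_inv c) e)) (transvection n e c)"

lemma quarter_turn:
  assumes \<sigma>: "\<sigma> \<in> carrier (SAut n)" and i: "diff_gens n e c"
  shows "quarter_turn e c \<sigma> \<in> carrier (SAut n)" "quarter_turn e c \<sigma> \<in> K \<Longrightarrow> \<sigma> \<in> K"
    "quarter_turn e c \<sigma> [e] = \<sigma> [c]" "quarter_turn e c \<sigma> [c] = word_inv (\<sigma> [e])"
    "fst a < n \<Longrightarrow> fst a \<noteq> fst e \<Longrightarrow> fst a \<noteq> fst c \<Longrightarrow> quarter_turn e c \<sigma> [a] = \<sigma> [a]"
proof -
  define \<sigma>1 where "\<sigma>1 = cmp n \<sigma> (transvection n (letter_inv e) (letter_inv c))"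
  define \<sigma>2 where "\<sigma>2 = cmp n \<sigma>1 (transvection n (letter_inv c) e)"
  define \<sigma>3 where "\<sigma>3 = cmp n \<sigma>2 (transvection n e c)"
  have q: "quarter_turn e c \<sigma> = \<sigma>3"
    by (simp add: quarter_turn_def \<sigma>1_def \<sigma>2_def \<sigma>3_def)
  have ind: "diff_gens n (letter_inv e) (letter_inv c)" "diff_gens n (letter_inv c) e"
    using i diff_gens_commute by simp_all
  have n: "fst e < n" "fst c < n" "fst e \<noteq> fst c" "fst c \<noteq> fst e"
    using i by (auto simp: diff_gens_def)
  have 1: "\<sigma>1 \<in> carrier (SAut n)"
    unfolding \<sigma>1_def by (rule cmp_transvection_SAut[OF \<sigma> ind(1)])
  have 2: "\<sigma>2 \<in> carrier (SAut n)"
    unfolding \<sigma>2_def by (rule cmp_transvection_SAut[OF 1 ind(2)])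
  have 3: "\<sigma>3 \<in> carrier (SAut n)"
    unfolding \<sigma>3_def by (rule cmp_transvection_SAut[OF 2 i])
  show "quarter_turn e c \<sigma> \<in> carrier (SAut n)"
    unfolding q by (rule 3)
  show "quarter_turn e c \<sigma> \<in> K \<Longrightarrow> \<sigma> \<in> K"
    unfolding q using step_back[OF \<sigma> ind(1)] step_back[OF 1 ind(2)] step_back[OF 2 i]
    by (simp add: \<sigma>1_def \<sigma>2_def \<sigma>3_def)
  note h = SAut_hom[OF \<sigma>] and h1 = SAut_hom[OF 1] and h2 = SAut_hom[OF 2] and h3 = SAut_hom[OF 3]
  have cl: "\<sigma> [e] \<in> F n" "\<sigma> [c] \<in> F n"
    using hom_closed[OF h] n by simp_all
  note inv = word_inv_mult[where n = n]
  have e1: "\<sigma>1 [e] = word_mult (\<sigma> [c]) (\<sigma> [e])"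
    using cmp_transvection(2)[OF h ind(1), folded \<sigma>1_def] hom_letter_inv[OF h] n cl by (simp add: inv)
  have c1: "\<sigma>1 [c] = \<sigma> [c]"
    using cmp_transvection(3)[OF h ind(1), folded \<sigma>1_def, of c] n by simp
  have e2: "\<sigma>2 [e] = word_mult (\<sigma> [c]) (\<sigma> [e])"
    using cmp_transvection(3)[OF h1 ind(2), folded \<sigma>2_def, of e] n e1 by simp
  have "\<sigma>2 [letter_inv c] = word_mult (word_inv (\<sigma> [c])) (word_mult (\<sigma> [c]) (\<sigma> [e]))"
    using cmp_transvection(1)[OF h1 ind(2), folded \<sigma>2_def] e1 c1 hom_letter_inv[OF h1] n by simp
  also have "\<dots> = \<sigma> [e]"
    by (rule word_mult_cancel(2)[OF cl(1)])
  finally have c2: "\<sigma>2 [c] = word_inv (\<sigma> [e])"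
    using hom_letter_inv[OF h2 n(2)] by (metis word_inv_simps(4))
  have "\<sigma>3 [e] = word_mult (word_mult (\<sigma> [c]) (\<sigma> [e])) (word_inv (\<sigma> [e]))"
    using cmp_transvection(1)[OF h2 i, folded \<sigma>3_def] e2 c2 by simp
  also have "\<dots> = \<sigma> [c]"
    using assoc[of "word_inv (\<sigma> [e])" n "\<sigma> [c]" "\<sigma> [e]"] cl by (simp add: word_mult_Nil2)
  finally show "quarter_turn e c \<sigma> [e] = \<sigma> [c]"
    unfolding q .
  show "quarter_turn e c \<sigma> [c] = word_inv (\<sigma> [e])"
    unfolding q using cmp_transvection(3)[OF h2 i, folded \<sigma>3_def, of c] n c2 by simp
  show "quarter_turn e c \<sigma> [a] = \<sigma> [a]" if "fst a < n" "fst a \<noteq> fst e" "fst a \<noteq> fst c"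
    unfolding q using cmp_transvection(3)[OF h2 i, folded \<sigma>3_def, of a]
      cmp_transvection(3)[OF h1 ind(2), folded \<sigma>2_def, of a]
      cmp_transvection(3)[OF h ind(1), folded \<sigma>1_def, of a] that by simp
qed

lemma permutes_letters_quarter_turn:
  assumes \<sigma>: "\<sigma> \<in> carrier (SAut n)" and i: "diff_gens n e c" and p: "permutes_letters n \<sigma>"
  shows "permutes_letters n (quarter_turn e c \<sigma>)"
  unfolding permutes_letters_def
proof (intro allI impI)
  let ?\<tau> = "quarter_turn e c \<sigma>"
  note q = quarter_turn[OF \<sigma> i]
  have n: "fst e < n" "fst c < n"
    using i by (auto simp: diff_gens_def)
  fix a :: letter
  assume "fst a < n"
  then obtain b where b: "fst b < n" "\<sigma> [b] = [a]"
    using p unfolding permutes_letters_def by blast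
  have \<tau>h: "?\<tau> \<in> End n"
    by (rule SAut_hom[OF q(1)])
  have \<sigma>h: "\<sigma> \<in> End n"
    by (rule SAut_hom[OF \<sigma>])
  consider "b = e" | "b = letter_inv e" | "b = c" | "b = letter_inv c" | "fst b \<noteq> fst e" "fst b \<noteq> fst c"
    using same_fst[of b e] same_fst[of b c] by blast
  then show "\<exists>b. fst b < n \<and> ?\<tau> [b] = [a]"
  proof cases
    case 1
    then have "?\<tau> [letter_inv c] = [a]"
      using hom_letter_inv[OF \<tau>h n(2)] q(4) b(2) by simp
    then show ?thesis
      using n by (intro exI[of _ "letter_inv c"]) simp
  next
    case 2
    then have "?\<tau> [c] = [a]"
      using hom_letter_inv[OF \<sigma>h n(1)] q(4) b(2) by simp
    then show ?thesis
      using n by blast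
  next
    case 3
    then have "?\<tau> [e] = [a]"
      using q(3) b by simp
    then show ?thesis
      using n by blast
  next
    case 4
    then have "?\<tau> [letter_inv e] = [a]"
      using hom_letter_inv[OF \<tau>h n(1)] hom_letter_inv[OF \<sigma>h n(2)] q(3) b(2) by simp
    then show ?thesis
      using n by (intro exI[of _ "letter_inv e"]) simp
  next
    case 5
    then have "?\<tau> [b] = [a]"
      using q(5)[OF b(1)] b by simp
    then show ?thesis
      using b by blast
  qed
qed

text \<open>Signed permutations of the generators are sorted by quarter turns. A generator that is not
  mapped to itself or to its inverse is put into place by one quarter turn. If all generators are
  mapped to themselves or to their inverses, then there is not exactly one inverse among them,
  because the determinant is \<open>1\<close>, and two quarter turns remove two of them.\<close>

lemma permutation_in:
  assumes "\<sigma> \<in> carrier (SAut n)" "permutes_letters n \<sigma>"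
  shows "\<sigma> \<in> K"
  using assms
proof (induction "card {i. i < n \<and> \<sigma> (gen i) \<noteq> gen i}" arbitrary: \<sigma> rule: less_induct)
  case (less \<sigma>)
  note \<sigma> = less.prems(1)
  have h: "\<sigma> \<in> End n"
    by (rule SAut_hom[OF \<sigma>])
  have smaller: "\<sigma> \<in> K" if i: "diff_gens n e c"
    and \<tau>: "\<tau> \<in> carrier (SAut n)" "permutes_letters n \<tau>" "\<tau> \<in> K \<Longrightarrow> \<sigma> \<in> K"
    and fixed: "\<tau> (gen (fst e)) = gen (fst e)"
    and nfixed: "\<sigma> (gen (fst e)) \<noteq> gen (fst e)" "\<sigma> (gen (fst c)) \<noteq> gen (fst c)"
    and same: "\<And>k. k < n \<Longrightarrow> k \<noteq> fst e \<Longrightarrow> k \<noteq> fst c \<Longrightarrow> \<tau> (gen k) = \<sigma> (gen k)" for e c \<tau>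
  proof (rule \<tau>(3), rule less.hyps[OF _ \<tau>(1,2)])
    have "{k. k < n \<and> \<tau> (gen k) \<noteq> gen k} \<subset> {k. k < n \<and> \<sigma> (gen k) \<noteq> gen k}"
    proof
      show "{k. k < n \<and> \<tau> (gen k) \<noteq> gen k} \<subseteq> {k. k < n \<and> \<sigma> (gen k) \<noteq> gen k}"
        using fixed nfixed same by (smt (verit) Collect_mono)
      have "fst e \<in> {k. k < n \<and> \<sigma> (gen k) \<noteq> gen k}"
        using i nfixed by (simp add: diff_gens_def)
      then show "{k. k < n \<and> \<tau> (gen k) \<noteq> gen k} \<noteq> {k. k < n \<and> \<sigma> (gen k) \<noteq> gen k}"
        using fixed by blast
    qed
    then show "card {k. k < n \<and> \<tau> (gen k) \<noteq> gen k} < card {k. k < n \<and> \<sigma> (gen k) \<noteq> gen k}"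
      by (intro psubset_card_mono) simp_all
  qed
  consider (id) "\<forall>i<n. \<sigma> (gen i) = gen i"
    | (move) i b where "i < n" "fst b < n" "\<sigma> (gen i) = [b]" "fst b \<noteq> i"
    | (sign) i where "i < n" "\<sigma> (gen i) \<noteq> gen i"
        "\<forall>i<n. \<sigma> (gen i) = [(i, True)] \<or> \<sigma> (gen i) = [(i, False)]"
  proof (cases "\<exists>i b. i < n \<and> fst b < n \<and> \<sigma> (gen i) = [b] \<and> fst b \<noteq> i")
    case True
    then show ?thesis using that(2) by blast
  next
    case False
    have "\<sigma> (gen i) = [(i, True)] \<or> \<sigma> (gen i) = [(i, False)]" if i: "i < n" for i
    proof -
      obtain b where b: "fst b < n" "\<sigma> (gen i) = [b]"
        using permutes_letters_surj[OF less.prems(2), of "(i, True)"] i by auto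
      then have "fst b = i"
        using False i by blast
      then show ?thesis
        using b(2) by (cases b) auto
    qed
    then show ?thesis
      using that(1,3) by blast
  qed
  then show ?case
  proof cases
    case id
    have id_hom: "(\<lambda>w\<in>F n. w) \<in> End n"
      using group.id_in_auto[OF group_free_group] by (rule autoD)
    have "\<sigma> = (\<lambda>w\<in>F n. w)"
    proof (rule hom_eqI[OF h id_hom])
      show "\<sigma> \<in> extensional (F n)"
        using \<sigma> by (simp add: SAut_carrier autoD)
      fix a :: letter
      assume a: "fst a < n"
      consider "a = (fst a, True)" | "a = letter_inv (fst a, True)"
        by (cases a) (auto simp: letter_inv_def)
      then show "\<sigma> [a] = (\<lambda>w\<in>F n. w) [a]"
      proof cases
        case 1
        then show ?thesis
          using id a by (metis letter_closed restrict_apply')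
      next
        case 2
        then show ?thesis
          using id a hom_letter_inv[OF h, of "(fst a, True)"] by (metis fst_conv letter_closed restrict_apply' word_inv_simps(2))
      qed
    qed simp
    then show ?thesis
      using subgroup.one_closed[OF K] by (simp add: SAut_one)
  next
    case (move i b)
    let ?e = "(i, True)"
    obtain c where c: "fst c < n" "\<sigma> [c] = [?e]"
      using less.prems(2) move(1) unfolding permutes_letters_def by fastforce
    have "fst c \<noteq> i"
    proof
      assume "fst c = i"
      then have "c = ?e \<or> c = letter_inv ?e"
        using same_fst[of c ?e] by simp
      then have "[?e] = [b] \<or> [?e] = [letter_inv b]"
        using c(2) move(3) hom_letter_inv[OF h, of ?e] move(1) by auto
      then show False
        using move(4) by (auto simp: letter_inv_def)
    qed
    then have i: "diff_gens n ?e c"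
      using move(1) c(1) by (simp add: diff_gens_def)
    note q = quarter_turn[OF \<sigma> i]
    show ?thesis
    proof (rule smaller[OF i q(1) permutes_letters_quarter_turn[OF \<sigma> i less.prems(2)] q(2)])
      show "quarter_turn ?e c \<sigma> (gen (fst ?e)) = gen (fst ?e)"
        using q(3) c(2) by simp
      show "\<sigma> (gen (fst ?e)) \<noteq> gen (fst ?e)"
        using move by auto
      have "(fst c, True) = c \<or> (fst c, True) = letter_inv c"
        using same_fst[of "(fst c, True)" c] by simp
      then have "\<sigma> (gen (fst c)) = [?e] \<or> \<sigma> (gen (fst c)) = [letter_inv ?e]"
        using c hom_letter_inv[OF h c(1)] by auto
      then show "\<sigma> (gen (fst c)) \<noteq> gen (fst c)"
        using \<open>fst c \<noteq> i\<close> by (auto simp: letter_inv_def)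
      show "quarter_turn ?e c \<sigma> (gen k) = \<sigma> (gen k)" if "k < n" "k \<noteq> fst ?e" "k \<noteq> fst c" for k
        using q(5)[of "(k, True)"] that by simp
    qed
  next
    case (sign i)
    have i: "\<sigma> (gen i) = [(i, False)]"
      using sign by blast
    \<comment> \<open>A single sign would give determinant \<open>-1\<close>.\<close>
    have "\<exists>j<n. j \<noteq> i \<and> \<sigma> (gen j) \<noteq> gen j"
    proof (rule ccontr)
      assume neg: "\<not> (\<exists>j<n. j \<noteq> i \<and> \<sigma> (gen j) \<noteq> gen j)"
      have "aut_matrix n \<sigma> = multrow_mat n i (- 1)"
      proof (rule eq_matI)
        fix k j
        assume "k < dim_row (multrow_mat n i (- 1 :: int))" "j < dim_col (multrow_mat n i (- 1 :: int))"
        then have kj: "k < n" "j < n"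
          by simp_all
        show "aut_matrix n \<sigma> $$ (k, j) = multrow_mat n i (- 1) $$ (k, j)"
          using kj neg i by (cases "j = i") (auto simp: aut_matrix_index)
      qed simp_all
      then have "aut_det n \<sigma> = - 1"
        using det_multrow_mat[OF sign(1), of "- 1 :: int"] by simp
      then show False
        using \<sigma> by (simp add: SAut_carrier)
    qed
    then obtain j where j: "j < n" "j \<noteq> i" "\<sigma> (gen j) = [(j, False)]"
      using sign(3) by blast
    let ?e = "(i, True)" and ?c = "(j, True)"
    have ind: "diff_gens n ?e ?c"
      using sign(1) j by (simp add: diff_gens_def)
    note q = quarter_turn[OF \<sigma> ind]
    note qq = quarter_turn[OF q(1) ind]
    have pp: "permutes_letters n (quarter_turn ?e ?c (quarter_turn ?e ?c \<sigma>))"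
      by (rule permutes_letters_quarter_turn[OF q(1) ind permutes_letters_quarter_turn[OF \<sigma> ind less.prems(2)]])
    show ?thesis
    proof (rule smaller[OF ind qq(1) pp])
      show "quarter_turn ?e ?c (quarter_turn ?e ?c \<sigma>) \<in> K \<Longrightarrow> \<sigma> \<in> K"
        using q(2) qq(2) by blast
      show "quarter_turn ?e ?c (quarter_turn ?e ?c \<sigma>) (gen (fst ?e)) = gen (fst ?e)"
        using qq(3) q(4) i by (simp add: letter_inv_def)
      show "\<sigma> (gen (fst ?e)) \<noteq> gen (fst ?e)" "\<sigma> (gen (fst ?c)) \<noteq> gen (fst ?c)"
        using i j by simp_all
      show "quarter_turn ?e ?c (quarter_turn ?e ?c \<sigma>) (gen k) = \<sigma> (gen k)"
        if "k < n" "k \<noteq> fst ?e" "k \<noteq> fst ?c" for k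
        using q(5)[of "(k, True)"] qq(5)[of "(k, True)"] that by simp
    qed
  qed
qed

abbreviation total_length :: "(word \<Rightarrow> word) \<Rightarrow> nat" where
  "total_length \<phi> \<equiv> (\<Sum>k<n. length (\<phi> (gen k)))"

abbreviation total_weight :: "(word \<Rightarrow> word) \<Rightarrow> nat" where
  "total_weight \<phi> \<equiv> (\<Sum>k<n. weight n (\<phi> (gen k)))"

text \<open>Nielsen reduction. Whenever a transvection shortens the images of the generators, or keeps
  their total length and decreases their total weight, it may be split off. Suppose that this is
  not possible. Then at most half of the image of any letter cancels against an adjacent one. The
  only way to violate the hypothesis of \<open>long_image\<close> is an image \<open>P @ word_inv Q\<close> of which one half
  cancels on the left and the other half on the right. But then one can exchange the prefixes \<open>P\<close>
  and \<open>Q\<close> in an adjacent image, and one of the two possible exchanges decreases the weight.\<close>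

theorem transvections_generate_SAut:
  assumes "\<phi> \<in> carrier (SAut n)"
  shows "\<phi> \<in> K"
  using assms
proof (induction "(total_length \<phi>, total_weight \<phi>)" arbitrary: \<phi>
    rule: wf_induct_rule[OF wf_lex_prod[OF wf_less_than wf_less_than]])
  case (1 \<phi>)
  note \<phi> = 1(2)
  have auto: "\<phi> \<in> auto (free_group n)"
    using \<phi> by (simp add: SAut_carrier)
  note h = autoD(1)[OF auto]
  have IH: "\<phi> \<in> K" if i: "diff_gens n b c"
    and less: "length (word_mult (\<phi> [b]) (\<phi> [c])) < length (\<phi> [b]) \<or>
      length (word_mult (\<phi> [b]) (\<phi> [c])) = length (\<phi> [b]) \<and>
      weight n (word_mult (\<phi> [b]) (\<phi> [c])) < weight n (\<phi> [b])" for b c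
  proof (rule step_back[OF \<phi> i], rule 1(1)[OF _ cmp_transvection_SAut[OF \<phi> i]])
    show "((total_length (cmp n \<phi> (transvection n b c)), total_weight (cmp n \<phi> (transvection n b c))),
        (total_length \<phi>, total_weight \<phi>)) \<in> less_than <*lex*> less_than"
      using transvection_measure[OF h i, of length] transvection_measure[OF h i, of "weight n"] less
      by (auto simp: weight_inv)
  qed
  have red: "reduced_word (\<phi> [a])" if "fst a < n" for a
    using hom_closed[OF h, of "[a]"] that by (simp add: carrier_free_group)
  have ne: "\<phi> [a] \<noteq> []" if "fst a < n" for a
    by (rule auto_letter_nonempty[OF auto that])
  have inv: "\<phi> [letter_inv a] = word_inv (\<phi> [a])" if "fst a < n" for a
    by (rule hom_letter_inv[OF h that])
  have mult_inv: "word_mult (\<phi> [letter_inv b]) (\<phi> [letter_inv a]) = word_inv (word_mult (\<phi> [a]) (\<phi> [b]))"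
    if "fst a < n" "fst b < n" for a b
    using word_inv_mult[of "\<phi> [a]" n "\<phi> [b]"] inv hom_closed[OF h] that by simp
  have cancel_inv: "cancel (\<phi> [letter_inv b]) (\<phi> [letter_inv a]) = cancel (\<phi> [a]) (\<phi> [b])"
    if "fst a < n" "fst b < n" for a b
    using mult_inv[OF that] inv that by (simp add: cancel_def add.commute)
  have self: "2 * cancel (\<phi> [a]) (\<phi> [a]) < length (\<phi> [a])" if "fst a < n" for a
    by (rule cancel_self[OF red[OF that] ne[OF that]])
  show ?case
  proof (rule ccontr)
    assume notK: "\<phi> \<notin> K"
    have N1l: "2 * cancel (\<phi> [a]) (\<phi> [b]) \<le> length (\<phi> [b])"
      if ab: "fst a < n" "fst b < n" "b \<noteq> letter_inv a" for a b
    proof (cases "fst a = fst b")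
      case True
      then have "a = b"
        using same_fst[of b a] ab(3) by auto
      then show ?thesis
        using self[OF ab(1)] by simp
    next
      case False
      then have "diff_gens n a b"
        using ab by (simp add: diff_gens_def)
      then have "\<not> length (word_mult (\<phi> [a]) (\<phi> [b])) < length (\<phi> [a])"
        using IH notK by blast
      then show ?thesis
        using length_word_mult(1)[OF red[OF ab(1)] red[OF ab(2)]] by linarith
    qed
    have N1r: "2 * cancel (\<phi> [a]) (\<phi> [b]) \<le> length (\<phi> [a])"
      if ab: "fst a < n" "fst b < n" "b \<noteq> letter_inv a" for a b
      using N1l[of "letter_inv b" "letter_inv a"] cancel_inv[OF ab(1,2)] inv[OF ab(1)] ab by auto
    have N2: "cancel (\<phi> [a]) (\<phi> [b]) + cancel (\<phi> [b]) (\<phi> [c]) < length (\<phi> [b])"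
      if abc: "fst a < n" "fst b < n" "fst c < n" "b \<noteq> letter_inv a" "c \<noteq> letter_inv b" for a b c
    proof (rule ccontr)
      assume neg: "\<not> ?thesis"
      have hh: "2 * cancel (\<phi> [a]) (\<phi> [b]) = length (\<phi> [b])" "2 * cancel (\<phi> [b]) (\<phi> [c]) = length (\<phi> [b])"
        using neg N1l[OF abc(1,2,4)] N1r[OF abc(2,3,5)] by linarith+
      have "fst a \<noteq> fst b"
      proof
        assume "fst a = fst b"
        then have "a = b"
          using same_fst[of b a] abc(4) by auto
        then show False
          using self[OF abc(2)] hh(1) by simp
      qed
      then have iab: "diff_gens n a b"
        using abc by (simp add: diff_gens_def)
      have "fst c \<noteq> fst b"
      proof
        assume "fst c = fst b"
        then have "c = b"
          using same_fst[of c b] abc(5) by auto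
        then show False
          using self[OF abc(2)] hh(2) by simp
      qed
      then have icb: "diff_gens n (letter_inv c) (letter_inv b)"
        using abc by (simp add: diff_gens_def)
      obtain s p1 r1 where 1: "\<phi> [a] = s @ p1" "\<phi> [b] = word_inv p1 @ r1"
          "word_mult (\<phi> [a]) (\<phi> [b]) = s @ r1" "length p1 = cancel (\<phi> [a]) (\<phi> [b])"
        using cancelE[OF red[OF abc(1)] red[OF abc(2)]] by blast
      obtain s2 p2 r where 2: "\<phi> [b] = s2 @ p2" "\<phi> [c] = word_inv p2 @ r"
          "word_mult (\<phi> [b]) (\<phi> [c]) = s2 @ r" "length p2 = cancel (\<phi> [b]) (\<phi> [c])"
        using cancelE[OF red[OF abc(2)] red[OF abc(3)]] by blast
      \<comment> \<open>Equality in both estimates: the image of \<open>b\<close> is \<open>P @ word_inv Q\<close> with halves \<open>P\<close> and \<open>word_inv Q\<close>.\<close>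
      define P where "P = word_inv p1"
      define Q where "Q = word_inv p2"
      have len: "length P = length Q"
        using 1(4) 2(4) hh by (simp add: P_def Q_def)
      have "length s2 = length P"
        using 2(1,4) hh(2) len by (simp add: Q_def)
      then have sP: "s2 = P" and rQ: "r1 = p2"
        using 1(2) 2(1) by (auto simp: P_def append_eq_append_conv)
      have p2Q: "p2 = word_inv Q"
        by (simp add: Q_def)
      have b: "\<phi> [b] = P @ word_inv Q"
        using 2(1) sP p2Q by simp
      have c: "\<phi> [c] = Q @ r" "word_mult (\<phi> [b]) (\<phi> [c]) = P @ r"
        using 2(2,3) sP by (simp_all add: Q_def)
      have a: "word_inv (\<phi> [a]) = P @ word_inv s" "word_inv (word_mult (\<phi> [a]) (\<phi> [b])) = Q @ word_inv s"
        using 1(1,3) rQ by (simp_all add: P_def Q_def)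
      have "P \<noteq> []"
        using ne[OF abc(2)] b len by auto
      \<comment> \<open>The image of \<open>b\<close> is reduced and not empty.\<close>
      have "P \<noteq> Q"
      proof
        assume "P = Q"
        then have "reduced_word (P @ word_inv P)"
          using red[OF abc(2)] b by simp
        moreover have "hd (word_inv P) = letter_inv (last P)"
          using \<open>P \<noteq> []\<close> by (simp add: word_inv_def hd_rev last_map)
        ultimately show False
          using \<open>P \<noteq> []\<close> unfolding reduced_append_iff by simp
      qed
      have n0: "0 < n"
        using abc(1) by simp
      have "\<forall>a\<in>set (\<phi> [b]). fst a < n"
        using hom_closed[OF h, of "[b]"] abc(2) by (simp add: carrier_free_group)
      then have PQ: "\<forall>a\<in>set P. fst a < n" "\<forall>a\<in>set Q. fst a < n"
        unfolding b by (simp_all add: word_inv_def ball_Un)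
      have ne_digits: "digits (2 * n) P \<noteq> digits (2 * n) Q"
        using digits_inj[OF PQ len] \<open>P \<noteq> Q\<close> by blast
      have Ph: "length P = cancel (\<phi> [a]) (\<phi> [b])" "length Q = cancel (\<phi> [b]) (\<phi> [c])"
        unfolding P_def Q_def word_inv_simps(5) by (rule 1(4), rule 2(4))
      show False
      proof (cases "digits (2 * n) P < digits (2 * n) Q")
        case True
        have "2 * length Q \<le> length (Q @ r)"
          using N1l[OF abc(2,3,5)] Ph(2) c(1) by simp
        then have "weight n (P @ r) < weight n (Q @ r)"
          using weight_less[OF len _ True n0] by blast
        then have "weight n (word_inv (P @ r)) < weight n (word_inv (Q @ r))"
          unfolding weight_inv .
        moreover have "length (word_inv (P @ r)) = length (word_inv (Q @ r))"
          using len by simp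
        moreover have "word_mult (\<phi> [letter_inv c]) (\<phi> [letter_inv b]) = word_inv (P @ r)"
          unfolding mult_inv[OF abc(2,3)] c(2) by (rule refl)
        moreover have "\<phi> [letter_inv c] = word_inv (Q @ r)"
          unfolding inv[OF abc(3)] c(1) by (rule refl)
        ultimately show False
          using IH[OF icb] notK by metis
      next
        case False
        then have lt: "digits (2 * n) Q < digits (2 * n) P"
          using ne_digits by simp
        have "length (P @ word_inv s) = length (\<phi> [a])"
          using arg_cong[OF a(1), of length] by simp
        then have "2 * length P \<le> length (P @ word_inv s)"
          using N1r[OF abc(1,2,4)] Ph(1) by simp
        then have "weight n (Q @ word_inv s) < weight n (P @ word_inv s)"
          using weight_less[OF len[symmetric] _ lt n0] by blast
        then have "weight n (word_mult (\<phi> [a]) (\<phi> [b])) < weight n (\<phi> [a])"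
          unfolding a[symmetric] weight_inv .
        moreover have "length (word_mult (\<phi> [a]) (\<phi> [b])) = length (\<phi> [a])"
          using arg_cong[OF a(1), of length] arg_cong[OF a(2), of length] len by simp
        ultimately show False
          using IH[OF iab] notK by blast
      qed
    qed
    have "permutes_letters n \<phi>"
      by (rule Nielsen_reduced_permutes_letters[OF auto N1l N2])
    then show False
      using permutation_in[OF \<phi>] notK by blast
  qed
qed

end

section \<open>The alternating group as a group of automorphisms\<close>

text \<open>Consider the graph with two vertices and edges \<open>1, \<dots>, n + 1\<close> from the first one to the
  second one. Its fundamental group is free on the loops that run through the edge \<open>i + 1\<close> and back
  through the last edge. This is the class of the edge \<open>j\<close>, followed by the last edge in reverse;
  it is trivial for the last edge itself.\<close>

definition edge :: "nat \<Rightarrow> nat \<Rightarrow> word" where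
  "edge n j = (if j = Suc n then [] else [(j - 1, True)])"

text \<open>A permutation of the edges induces an automorphism of the fundamental group; the image of
  the last edge, which is in general a different edge, has to be divided out.\<close>

definition perm_letter :: "nat \<Rightarrow> (nat \<Rightarrow> nat) \<Rightarrow> letter \<Rightarrow> word" where
  "perm_letter n \<pi> a = (let w = word_mult (edge n (\<pi> (Suc (fst a)))) (word_inv (edge n (\<pi> (Suc n))))
     in if snd a then w else word_inv w)"

definition perm_aut :: "nat \<Rightarrow> (nat \<Rightarrow> nat) \<Rightarrow> word \<Rightarrow> word" where
  "perm_aut n \<pi> = endo n (perm_letter n \<pi>)"

lemma edge_closed: "j \<in> {1..Suc n} \<Longrightarrow> edge n j \<in> F n"
  by (auto simp: edge_def)

lemma perm_letter_map:
  assumes "\<pi> permutes {1..Suc n}"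
  shows "letter_map n (perm_letter n \<pi>)"
  unfolding letter_map_def
proof (intro allI impI conjI)
  fix a :: letter
  assume a: "fst a < n"
  have "\<pi> (Suc (fst a)) \<in> {1..Suc n}" "\<pi> (Suc n) \<in> {1..Suc n}"
    using a permutes_in_image[OF assms] by auto
  then show "perm_letter n \<pi> a \<in> F n"
    by (simp add: perm_letter_def Let_def edge_closed word_mult_closed)
  show "perm_letter n \<pi> (letter_inv a) = word_inv (perm_letter n \<pi> a)"
    by (simp add: perm_letter_def Let_def letter_inv_def)
qed

lemmas perm_aut_hom = endo_hom[OF perm_letter_map, folded perm_aut_def]
lemmas perm_aut_letter = endo_letter[OF perm_letter_map, folded perm_aut_def]

lemma perm_aut_edge:
  assumes \<pi>: "\<pi> permutes {1..Suc n}" and j: "j \<in> {1..Suc n}"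
  shows "perm_aut n \<pi> (edge n j) = word_mult (edge n (\<pi> j)) (word_inv (edge n (\<pi> (Suc n))))"
proof (cases "j = Suc n")
  case True
  then show ?thesis
    using hom_Nil[OF perm_aut_hom[OF \<pi>]] by (simp add: edge_def)
next
  case False
  then have "j - 1 < n" "Suc (j - 1) = j"
    using j by auto
  then show ?thesis
    using False perm_aut_letter[OF \<pi>, of "(j - 1, True)"] by (simp add: edge_def perm_letter_def Let_def)
qed

lemma perm_aut_comp:
  assumes \<pi>: "\<pi> permutes {1..Suc n}" and \<rho>: "\<rho> permutes {1..Suc n}"
  shows "perm_aut n (\<pi> \<circ> \<rho>) = cmp n (perm_aut n \<pi>) (perm_aut n \<rho>)"
proof (rule hom_eqI[OF perm_aut_hom[OF permutes_compose[OF \<rho> \<pi>]] cmp_hom[OF perm_aut_hom[OF \<pi>] perm_aut_hom[OF \<rho>]]])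
  show "perm_aut n (\<pi> \<circ> \<rho>) \<in> extensional (F n)"
    unfolding perm_aut_def by (rule endo_extensional)
  have h: "perm_aut n \<pi> \<in> End n"
    by (rule perm_aut_hom[OF \<pi>])
  have pos: "perm_aut n (\<pi> \<circ> \<rho>) (gen i) = cmp n (perm_aut n \<pi>) (perm_aut n \<rho>) (gen i)" if i: "i < n" for i
  proof -
    let ?j = "Suc i" and ?b = "Suc n"
    have \<rho>in: "\<rho> ?j \<in> {1..Suc n}" "\<rho> ?b \<in> {1..Suc n}"
      using i permutes_in_image[OF \<rho>] by auto
    have \<pi>in: "\<pi> (\<rho> ?j) \<in> {1..Suc n}" "\<pi> (\<rho> ?b) \<in> {1..Suc n}" "\<pi> ?b \<in> {1..Suc n}"
      using \<rho>in permutes_in_image[OF \<pi>] by auto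
    let ?x = "edge n (\<pi> (\<rho> ?j))" and ?y = "edge n (\<pi> (\<rho> ?b))" and ?z = "edge n (\<pi> ?b)"
    have cl: "?x \<in> F n" "?y \<in> F n" "?z \<in> F n"
      using \<pi>in edge_closed by auto
    have g: "gen i = edge n ?j"
      using i by (simp add: edge_def)
    have j: "?j \<in> {1..Suc n}"
      using i by simp
    have "cmp n (perm_aut n \<pi>) (perm_aut n \<rho>) (gen i) = perm_aut n \<pi> (perm_aut n \<rho> (edge n ?j))"
      unfolding g by (rule cmp_apply) (rule edge_closed[OF j])
    also have "\<dots> = perm_aut n \<pi> (word_mult (edge n (\<rho> ?j)) (word_inv (edge n (\<rho> ?b))))"
      by (simp only: perm_aut_edge[OF \<rho> j])
    also have "\<dots> = word_mult (perm_aut n \<pi> (edge n (\<rho> ?j))) (word_inv (perm_aut n \<pi> (edge n (\<rho> ?b))))"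
      using hom_word_mult[OF h, of "edge n (\<rho> ?j)" "word_inv (edge n (\<rho> ?b))"]
        hom_inv[OF h, of "edge n (\<rho> ?b)"] edge_closed \<rho>in by simp
    also have "\<dots> = word_mult (word_mult ?x (word_inv ?z)) (word_inv (word_mult ?y (word_inv ?z)))"
      by (simp only: perm_aut_edge[OF \<pi> \<rho>in(1)] perm_aut_edge[OF \<pi> \<rho>in(2)])
    also have "\<dots> = word_mult (word_mult ?x (word_inv ?z)) (word_mult ?z (word_inv ?y))"
      using word_inv_mult[of ?y n "word_inv ?z"] cl by simp
    also have "\<dots> = word_mult ?x (word_mult (word_inv ?z) (word_mult ?z (word_inv ?y)))"
      by (rule assoc[of _ n]) (use cl in auto)
    also have "\<dots> = word_mult ?x (word_inv ?y)"
      using word_mult_cancel(2)[of "word_inv ?y" n ?z] cl by simp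
    also have "\<dots> = perm_aut n (\<pi> \<circ> \<rho>) (edge n ?j)"
      using perm_aut_edge[OF permutes_compose[OF \<rho> \<pi>] j] by simp
    finally show ?thesis
      unfolding g by simp
  qed
  show "perm_aut n (\<pi> \<circ> \<rho>) [a] = cmp n (perm_aut n \<pi>) (perm_aut n \<rho>) [a]" if a: "fst a < n" for a
  proof -
    consider "a = (fst a, True)" | "[a] = word_inv (gen (fst a))"
      by (cases a) (auto simp: letter_inv_def)
    then show ?thesis
    proof cases
      case 1
      then show ?thesis
        using pos[OF a] by metis
    next
      case 2
      have g: "gen (fst a) \<in> F n"
        using a by simp
      show ?thesis
        unfolding 2 hom_inv[OF perm_aut_hom[OF permutes_compose[OF \<rho> \<pi>]] g]
          hom_inv[OF cmp_hom[OF perm_aut_hom[OF \<pi>] perm_aut_hom[OF \<rho>]] g] pos[OF a] by (rule refl)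
    qed
  qed
qed (simp add: compose_def)

lemma perm_aut_id: "perm_aut n id = (\<lambda>w\<in>F n. w)"
proof (rule hom_eqI[OF perm_aut_hom[OF permutes_id]])
  show "(\<lambda>w\<in>F n. w) \<in> End n"
    using group.id_in_auto[OF group_free_group] by (rule autoD)
  show "perm_aut n id \<in> extensional (F n)"
    unfolding perm_aut_def by (rule endo_extensional)
  show "perm_aut n id [a] = (\<lambda>w\<in>F n. w) [a]" if "fst a < n" for a
  proof -
    have "[(fst a, False)] = [a]" if "\<not> snd a"
      using that by (cases a) simp
    moreover have "[(fst a, True)] = [a]" if "snd a"
      using that by (cases a) simp
    ultimately show ?thesis
      using perm_aut_letter[OF permutes_id that] \<open>fst a < n\<close>
      by (auto simp: perm_letter_def Let_def edge_def word_mult_def letter_inv_def)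
  qed
qed simp

lemma perm_aut_auto:
  assumes "\<pi> permutes {1..Suc n}"
  shows "perm_aut n \<pi> \<in> auto (free_group n)"
proof (rule autoI)
  note inv = permutes_inv[OF assms]
  show "perm_aut n \<pi> \<in> End n" "perm_aut n (inv' \<pi>) \<in> End n"
    by (rule perm_aut_hom[OF assms], rule perm_aut_hom[OF inv])
  show "perm_aut n \<pi> \<in> extensional (F n)"
    unfolding perm_aut_def by (rule endo_extensional)
  fix a :: letter
  assume a: "fst a < n"
  then have "[a] \<in> F n"
    by simp
  then show "perm_aut n \<pi> (perm_aut n (inv' \<pi>) [a]) = [a]" "perm_aut n (inv' \<pi>) (perm_aut n \<pi> [a]) = [a]"
    using perm_aut_comp[OF assms inv] perm_aut_comp[OF inv assms] permutes_inv_o[OF assms] perm_aut_id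
    by (metis cmp_apply restrict_apply')+
qed

lemma int_cube_eq_1: "(x::int) * (x * x) = 1 \<Longrightarrow> x = 1"
  by (metis zmult_eq_1_iff mult_cancel_right1 mult_minus_left mult.right_neutral minus_mult_minus)

text \<open>Even permutations are products of three-cycles, and a three-cycle has order three, so its
  determinant is an integer whose cube is \<open>1\<close>.\<close>

lemma perm_aut_det:
  assumes "\<pi> \<in> carrier (alt_group (Suc n))"
  shows "aut_det n (perm_aut n \<pi>) = 1"
proof -
  have perm: "\<sigma> permutes {1..Suc n}" if "\<sigma> \<in> carrier (alt_group (Suc n))" for \<sigma>
    using that by (simp add: alt_group_carrier)
  have mult: "aut_det n (perm_aut n (\<sigma> \<circ> \<tau>)) = aut_det n (perm_aut n \<sigma>) * aut_det n (perm_aut n \<tau>)"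
    if "\<sigma> \<in> carrier (alt_group (Suc n))" "\<tau> \<in> carrier (alt_group (Suc n))" for \<sigma> \<tau>
    unfolding perm_aut_comp[OF perm[OF that(1)] perm[OF that(2)]]
    by (intro aut_det_mult perm_aut_hom perm that)
  have three: "aut_det n (perm_aut n (three_cycle a b c)) = 1"
    if d: "distinct [a, b, c]" and sub: "{a, b, c} \<subseteq> {1..Suc n}" for a b c
  proof -
    let ?t = "three_cycle a b c"
    note t = three_cycle_alt[OF d sub]
    have "?t \<circ> (?t \<circ> ?t) = id"
      unfolding three_cycle_comp_self[OF d] by (rule three_cycle_comp_reverse[OF d])
    then have "aut_det n (perm_aut n (?t \<circ> (?t \<circ> ?t))) = 1"
      using aut_det_id[of n] perm_aut_id[of n] by (simp only:)
    moreover have "aut_det n (perm_aut n (?t \<circ> (?t \<circ> ?t))) =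
        aut_det n (perm_aut n ?t) * (aut_det n (perm_aut n ?t) * aut_det n (perm_aut n ?t))"
      unfolding mult[OF t alt_group_closed(1)[OF t t]] mult[OF t t] by (rule refl)
    ultimately have "aut_det n (perm_aut n ?t) * (aut_det n (perm_aut n ?t) * aut_det n (perm_aut n ?t)) = 1"
      by (simp only:)
    then show ?thesis
      by (rule int_cube_eq_1)
  qed
  have "\<pi> \<in> generate (alt_group (Suc n)) (three_cycles (Suc n))"
    using assms alt_group_carrier_as_three_cycles by blast
  then show ?thesis
  proof induction
    case one
    then show ?case
      unfolding alt_group_one perm_aut_id by (rule aut_det_id)
  next
    case (incl h)
    then obtain x y z where "h = three_cycle x y z" "distinct [x, y, z]" "{x, y, z} \<subseteq> {1..Suc n}"
      by (auto simp: length_Suc_conv eval_nat_numeral simp del: cycle_of_list.simps)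
    then show ?case
      using three by blast
  next
    case (inv h)
    then obtain x y z where h: "h = three_cycle x y z" "distinct [x, y, z]" "{x, y, z} \<subseteq> {1..Suc n}"
      by (auto simp: length_Suc_conv eval_nat_numeral simp del: cycle_of_list.simps)
    have inv_h: "inv\<^bsub>alt_group (Suc n)\<^esub> h = three_cycle x z y"
      using three_cycle_inverse[OF h(2,3)] unfolding h(1) .
    have "distinct [x, z, y]" "{x, z, y} \<subseteq> {1..Suc n}"
      using h(2,3) by auto
    then show ?case
      unfolding inv_h by (rule three)
  next
    case (eng h1 h2)
    have h12: "h1 \<in> carrier (alt_group (Suc n))" "h2 \<in> carrier (alt_group (Suc n))"
      using eng.hyps unfolding alt_group_carrier_as_three_cycles by simp_all
    show ?case
      unfolding alt_group_mult mult[OF h12] eng.IH by simp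
  qed
qed

lemma perm_aut_SAut: "\<pi> \<in> carrier (alt_group (Suc n)) \<Longrightarrow> perm_aut n \<pi> \<in> carrier (SAut n)"
  using perm_aut_auto perm_aut_det by (simp add: SAut_carrier alt_group_carrier)

lemma perm_aut_alt_hom: "perm_aut n \<in> hom (alt_group (Suc n)) (SAut n)"
proof (rule homI)
  show "perm_aut n \<pi> \<in> carrier (SAut n)" if "\<pi> \<in> carrier (alt_group (Suc n))" for \<pi>
    by (rule perm_aut_SAut[OF that])
  show "perm_aut n (\<pi> \<otimes>\<^bsub>alt_group (Suc n)\<^esub> \<rho>) = perm_aut n \<pi> \<otimes>\<^bsub>SAut n\<^esub> perm_aut n \<rho>"
    if "\<pi> \<in> carrier (alt_group (Suc n))" "\<rho> \<in> carrier (alt_group (Suc n))" for \<pi> \<rho>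
    unfolding SAut_mult[OF perm_aut_SAut[OF that(1)] perm_aut_SAut[OF that(2)]] alt_group_mult
    by (rule perm_aut_comp) (use that in \<open>simp_all add: alt_group_carrier\<close>)
qed

lemma perm_aut_three_cycle:
  assumes d: "distinct [i, j, k]" and n: "i < n" "j < n" "k < n"
  shows "perm_aut n (three_cycle (Suc i) (Suc j) (Suc k)) [(i, s)] = [(j, s)]"
    "perm_aut n (three_cycle (Suc i) (Suc j) (Suc k)) [(j, s)] = [(k, s)]"
    "perm_aut n (three_cycle (Suc i) (Suc j) (Suc k)) [(k, s)] = [(i, s)]"
    "l < n \<Longrightarrow> l \<noteq> i \<Longrightarrow> l \<noteq> j \<Longrightarrow> l \<noteq> k \<Longrightarrow>
      perm_aut n (three_cycle (Suc i) (Suc j) (Suc k)) [(l, s)] = [(l, s)]"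
proof -
  let ?t = "three_cycle (Suc i) (Suc j) (Suc k)"
  have "distinct [Suc i, Suc j, Suc k]" "{Suc i, Suc j, Suc k} \<subseteq> {1..Suc n}"
    using d n by auto
  then have t: "?t permutes {1..Suc n}"
    using three_cycle_alt alt_group_carrier by blast
  have vals: "?t (Suc i) = Suc j" "?t (Suc j) = Suc k" "?t (Suc k) = Suc i" "?t (Suc n) = Suc n"
    using d n by (auto simp: Transposition.transpose_def)
  have l: "perm_aut n ?t [(l, s)] = [(?t (Suc l) - 1, s)]" if "l < n" "?t (Suc l) \<noteq> Suc n" for l
    using perm_aut_letter[OF t, of "(l, s)"] that vals(4)
    by (simp add: perm_letter_def Let_def edge_def word_mult_def letter_inv_def del: cycle_of_list.simps)
  show "perm_aut n ?t [(i, s)] = [(j, s)]" "perm_aut n ?t [(j, s)] = [(k, s)]" "perm_aut n ?t [(k, s)] = [(i, s)]"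
    using l[of i] l[of j] l[of k] vals n by (simp_all del: cycle_of_list.simps)
  have "?t (Suc l) = Suc l" if "l \<noteq> i" "l \<noteq> j" "l \<noteq> k"
    using that by (auto simp: Transposition.transpose_def)
  then show "l < n \<Longrightarrow> l \<noteq> i \<Longrightarrow> l \<noteq> j \<Longrightarrow> l \<noteq> k \<Longrightarrow> perm_aut n ?t [(l, s)] = [(l, s)]"
    using l[of l] by (simp del: cycle_of_list.simps)
qed

text \<open>A three-cycle of generators that moves \<open>i\<close> to \<open>j\<close> and \<open>j\<close> to \<open>k\<close> conjugates one transvection
  into the next one. If it acts trivially, then both transvections act in the same way.\<close>

lemma transvection_conjugate:
  assumes d: "distinct [i, j, k]" and n: "i < n" "j < n" "k < n"
  defines "\<alpha> \<equiv> perm_aut n (three_cycle (Suc i) (Suc j) (Suc k))"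
  shows "cmp n \<alpha> (transvection n (i, s) (j, s)) = cmp n (transvection n (j, s) (k, s)) \<alpha>"
proof -
  let ?A = "transvection n (i, s) (j, s)" and ?B = "transvection n (j, s) (k, s)"
  have iA: "diff_gens n (i, s) (j, s)" and iB: "diff_gens n (j, s) (k, s)"
    using d n by (auto simp: diff_gens_def)
  have "{Suc i, Suc j, Suc k} \<subseteq> {1..Suc n}"
    using n by auto
  then have t: "three_cycle (Suc i) (Suc j) (Suc k) permutes {1..Suc n}"
    using three_cycle_alt[of "Suc i" "Suc j" "Suc k" "Suc n"] d alt_group_carrier by simp
  have h: "\<alpha> \<in> End n"
    unfolding \<alpha>_def by (rule perm_aut_hom[OF t])
  note hA = transvection_hom[OF iA] and hB = transvection_hom[OF iB]
  note val = perm_aut_three_cycle[OF d n, folded \<alpha>_def]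
  have pos: "cmp n \<alpha> ?A [(l, s)] = cmp n ?B \<alpha> [(l, s)]" if l: "l < n" for l
  proof -
    have pairs: "\<alpha> [(i, s), (j, s)] = [(j, s), (k, s)]"
      using hom_pair[OF h iA] val d by (simp add: word_mult_def letter_inv_def)
    consider "l = i" | "l = j" | "l = k" | "l \<noteq> i" "l \<noteq> j" "l \<noteq> k"
      by blast
    then show ?thesis
    proof cases
      case 1
      then show ?thesis
        using l transvection_letter(1)[OF iA] transvection_letter(1)[OF iB] pairs val by (simp add: cmp_apply)
    next
      case 2
      then show ?thesis
        using l transvection_letter(3)[OF iA, of "(j, s)"] transvection_letter(3)[OF iB, of "(k, s)"] n d val
        by (simp add: cmp_apply)
    next
      case 3
      then show ?thesis
        using l transvection_letter(3)[OF iA, of "(k, s)"] transvection_letter(3)[OF iB, of "(i, s)"] n d val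
        by (simp add: cmp_apply)
    next
      case 4
      then show ?thesis
        using l transvection_letter(3)[OF iA, of "(l, s)"] transvection_letter(3)[OF iB, of "(l, s)"] val(4)
        by (simp add: cmp_apply)
    qed
  qed
  show ?thesis
  proof (rule hom_eqI[OF cmp_hom[OF h hA] cmp_hom[OF hB h]])
    fix a :: letter
    assume a: "fst a < n"
    have "a = (fst a, s) \<or> a = letter_inv (fst a, s)"
      by (cases a) (auto simp: letter_inv_def)
    then show "cmp n \<alpha> ?A [a] = cmp n ?B \<alpha> [a]"
      using pos[OF a] hom_letter_inv[OF cmp_hom[OF h hA], of "(fst a, s)"]
        hom_letter_inv[OF cmp_hom[OF hB h], of "(fst a, s)"] a by (metis fst_conv)
  qed (simp_all add: compose_def)
qed

text \<open>The commutator relation between transvections. If the two transvections on the left act in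
  the same way, then the last factor on the right acts trivially.\<close>

lemma transvection_commutator:
  assumes i: "diff_gens n e f" "diff_gens n f g" "diff_gens n e g"
  shows "cmp n (transvection n f g) (transvection n e f) =
    cmp n (cmp n (transvection n e f) (transvection n f g)) (transvection n e g)"
proof -
  let ?A = "transvection n e f" and ?B = "transvection n f g" and ?C = "transvection n e g"
  note h = transvection_hom[OF i(1)] transvection_hom[OF i(2)] transvection_hom[OF i(3)]
  have n: "fst e < n" "fst f < n" "fst g < n" and ne: "fst e \<noteq> fst f" "fst f \<noteq> fst g" "fst e \<noteq> fst g"
    using i by (auto simp: diff_gens_def)
  note neq = neq_inv[OF ne(1)] neq_inv[OF ne(2)] neq_inv[OF ne(3)]
  have AB: "cmp n ?A ?B \<in> End n"
    by (rule cmp_hom[OF h(1,2)])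
  have B: "?B [e] = [e]" "?B [f] = [f, g]" "?B [g] = [g]"
    using transvection_letter[OF i(2)] n ne by auto
  have A: "?A [e] = [e, f]" "?A [f] = [f]" "?A [g] = [g]"
    using transvection_letter[OF i(1)] n ne by auto
  have pos: "cmp n ?B ?A [e] = cmp n (cmp n ?A ?B) ?C [e]"
  proof -
    have "cmp n ?B ?A [e] = [e, f, g]"
      using A B n hom_pair[OF h(2) i(1)] neq by (simp add: cmp_apply word_mult_def)
    moreover have "cmp n (cmp n ?A ?B) ?C [e] = word_mult (cmp n ?A ?B [e]) (cmp n ?A ?B [g])"
      by (rule cmp_transvection(1)[OF AB i(3)])
    moreover have "cmp n ?A ?B [e] = [e, f]" "cmp n ?A ?B [g] = [g]"
      using A B n by (simp_all add: cmp_apply)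
    ultimately show ?thesis
      using neq by (simp add: word_mult_def)
  qed
  show ?thesis
  proof (rule hom_eqI[OF cmp_hom[OF h(2,1)] cmp_hom[OF AB h(3)]])
    fix a :: letter
    assume a: "fst a < n"
    have Ca: "cmp n (cmp n ?A ?B) ?C [a] = cmp n ?A ?B [a]" if "fst a \<noteq> fst e" "fst a < n" for a
      using cmp_transvection(3)[OF AB i(3) that(2,1)] .
    have f: "cmp n ?B ?A [f] = cmp n (cmp n ?A ?B) ?C [f]"
    proof -
      have "?A [f, g] = [f, g]"
        using hom_pair[OF h(1) i(2)] A neq by (simp add: word_mult_def)
      then show ?thesis
        using Ca[of f] A B n ne by (simp add: cmp_apply)
    qed
    have inv: "cmp n ?B ?A [letter_inv x] = cmp n (cmp n ?A ?B) ?C [letter_inv x]"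
      if "cmp n ?B ?A [x] = cmp n (cmp n ?A ?B) ?C [x]" "fst x < n" for x
      using hom_letter_inv[OF cmp_hom[OF h(2,1)] that(2)] hom_letter_inv[OF cmp_hom[OF AB h(3)] that(2)] that(1)
      by (simp only:)
    consider "a = e" | "a = letter_inv e" | "a = f" | "a = letter_inv f" | "fst a \<noteq> fst e" "fst a \<noteq> fst f"
      using same_fst[of a e] same_fst[of a f] by blast
    then show "cmp n ?B ?A [a] = cmp n (cmp n ?A ?B) ?C [a]"
    proof cases
      case 5
      then show ?thesis
        using Ca[of a] a transvection_letter(3)[OF i(1) a] transvection_letter(3)[OF i(2) a]
        by (simp add: cmp_apply)
    qed (use pos f inv[OF pos n(1)] inv[OF f n(2)] in simp_all)
  qed (simp_all add: compose_def)
qed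

theorem theoremB:
  fixes n m :: nat
    and X :: "'i cube_data"
    and \<Phi> :: "(word \<Rightarrow> word) \<Rightarrow> ('i \<times> pt) set \<Rightarrow> ('i \<times> pt) set"
  assumes "n \<ge> 4"
    and "CAT0_cube_complex X"
    and "\<And>v. v \<in> vertices X \<Longrightarrow> finite (neighbours X v) \<and> card (neighbours X v) \<le> m"
    and "strongly_simplicial_action (SAut n) X \<Phi>"
    and "m < n"
  shows "\<forall>g\<in>carrier (SAut n). \<Phi> g = (\<lambda>x\<in>points X. x)"
proof -
  have complex: "cube_complex X"
    using assms(2) by (simp add: CAT0_cube_complex_def)
  have cat0: "cat0_complex X"
    by (intro cat0_complex.intro glued_cubes.intro cat0_complex_axioms.intro complex assms(2))
  have simplicial: "simplicial_action (SAut n) X \<Phi>"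
    and strong: "\<forall>k. \<forall>c\<in>cells X k. \<forall>g\<in>carrier (SAut n). \<Phi> g ` c = c \<longrightarrow> (\<forall>p\<in>c. \<Phi> g p = p)"
    using assms(4) unfolding strongly_simplicial_action_def by blast+
  have hom: "\<Phi> \<in> hom (SAut n) (Isom X)"
    and cubical: "\<forall>g\<in>carrier (SAut n). maps_cubes_to_cubes X (\<Phi> g)"
    using simplicial unfolding simplicial_action_def by blast+
  interpret S: isometric_action "SAut n" X \<Phi>
    by (intro isometric_action.intro isometric_action_axioms.intro group_SAut cat0 hom)
  let ?H = "alt_group (Suc n)" and ?\<phi> = "\<lambda>\<pi>. \<Phi> (perm_aut n \<pi>)"
  have hom\<phi>: "?\<phi> \<in> hom ?H (Isom X)"
  proof (rule homI)
    show "?\<phi> \<pi> \<in> carrier (Isom X)" if "\<pi> \<in> carrier ?H" for \<pi>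
      by (rule S.act_carrier[OF perm_aut_SAut[OF that]])
    show "?\<phi> (\<pi> \<otimes>\<^bsub>?H\<^esub> \<rho>) = ?\<phi> \<pi> \<otimes>\<^bsub>Isom X\<^esub> ?\<phi> \<rho>" if "\<pi> \<in> carrier ?H" "\<rho> \<in> carrier ?H" for \<pi> \<rho>
      unfolding hom_mult[OF perm_aut_alt_hom that]
      by (rule hom_mult[OF hom perm_aut_SAut[OF that(1)] perm_aut_SAut[OF that(2)]])
  qed
  have strong\<phi>: "strongly_simplicial_action ?H X ?\<phi>"
    unfolding strongly_simplicial_action_def simplicial_action_def
    using hom\<phi> cubical strong perm_aut_SAut by blast
  interpret A: cubical_action ?H X ?\<phi>
    by (intro cubical_action.intro isometric_action.intro isometric_action_axioms.intro
        cubical_action_axioms.intro alt_group_is_group cat0 hom\<phi> strong\<phi>)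
  have fin_neighbours: "finite (neighbours X v)" if "v \<in> vertices X" for v
    using assms(3)[OF that] by blast
  have alt_fixes: "\<Phi> (perm_aut n \<pi>) p = p" if \<pi>: "\<pi> \<in> carrier ?H" and p: "p \<in> points X" for \<pi> p
  proof -
    have "0 < card (carrier ?H)"
      using alt_group_card_carrier[of "Suc n"] assms(1) by (intro gr0I) auto
    then have finH: "finite (carrier ?H)"
      by (rule card_ge_0_finite)
    have "points X \<noteq> {}"
      using p by blast
    then obtain q where q: "q \<in> points X" "\<forall>h\<in>carrier ?H. ?\<phi> h q = q"
      using A.fixed_point[OF finH _ fin_neighbours] by blast
    have "\<forall>h\<in>carrier ?H. ?\<phi> h w = w"
      if v: "v \<in> vertices X" "\<forall>h\<in>carrier ?H. ?\<phi> h v = v" and w: "w \<in> neighbours X v" for v w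
    proof
      fix h
      assume h: "h \<in> carrier ?H"
      note sub = S.neighbours_points[of v]
      show "?\<phi> h w = w"
      proof (rule alternating_action_trivial[where \<Omega> = "neighbours X v" and N = "Suc n" and act = ?\<phi>, OF _ _ _ _ _ _ h w])
        show "5 \<le> Suc n" "finite (neighbours X v)" "card (neighbours X v) < Suc n"
          using assms(1,5) assms(3)[OF v(1)] by auto
        show "?\<phi> \<sigma> x \<in> neighbours X v" if \<sigma>: "\<sigma> \<in> carrier ?H" and x: "x \<in> neighbours X v" for \<sigma> x
        proof -
          have fix_v: "?\<phi> \<sigma> v = v"
            using v(2) \<sigma> by blast
          have "?\<phi> \<sigma> x \<noteq> ?\<phi> \<sigma> v"
          proof
            assume "?\<phi> \<sigma> x = ?\<phi> \<sigma> v"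
            then have "x = v"
              using bij_betw_imp_inj_on[OF A.act_isom(1)[OF \<sigma>]] sub x S.vertices_points[OF v(1)]
              by (auto dest: inj_onD)
            then show False
              using x unfolding neighbours_def by blast
          qed
          from S.cubical_map_neighbours[OF A.cubical[OF \<sigma>] x this] show ?thesis
            unfolding fix_v .
        qed
        show "?\<phi> (\<sigma> \<circ> \<tau>) x = ?\<phi> \<sigma> (?\<phi> \<tau> x)"
          if "\<sigma> \<in> carrier ?H" "\<tau> \<in> carrier ?H" "x \<in> neighbours X v" for \<sigma> \<tau> x
          using A.act_mult[OF that(1,2)] that(3) sub unfolding alt_group_mult by blast
        show "?\<phi> id x = x" if "x \<in> neighbours X v" for x
          using A.act_one that sub unfolding alt_group_one by blast
      qed
    qed
    then show ?thesis
      using A.fixes_everything[OF _ q p] \<pi> by blast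
  qed
  have inj: "p = q" if "g \<in> carrier (SAut n)" "p \<in> points X" "q \<in> points X" "\<Phi> g p = \<Phi> g q" for g p q
    using bij_betw_imp_inj_on[OF S.act_isom(1)[OF that(1)]] that(2-4) by (auto dest: inj_onD)
  have act_cmp: "\<Phi> (cmp n g h) p = \<Phi> g (\<Phi> h p)"
    if "g \<in> carrier (SAut n)" "h \<in> carrier (SAut n)" "p \<in> points X" for g h p
    using S.act_mult[OF that] SAut_mult[OF that(1,2)] by simp
  define K where "K = {g \<in> carrier (SAut n). \<forall>p\<in>points X. \<Phi> g p = p}"
  have sub: "subgroup K (SAut n)"
  proof (rule group.subgroupI[OF group_SAut])
    show "K \<subseteq> carrier (SAut n)"
      unfolding K_def by blast
    show "K \<noteq> {}"
      unfolding K_def using S.act_one S.one_closed by blast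
    show "inv\<^bsub>SAut n\<^esub> g \<in> K" if "g \<in> K" for g
    proof -
      have g: "g \<in> carrier (SAut n)" and fix_g: "\<And>p. p \<in> points X \<Longrightarrow> \<Phi> g p = p"
        using that unfolding K_def by blast+
      have "\<Phi> (inv\<^bsub>SAut n\<^esub> g) p = p" if p: "p \<in> points X" for p
        using S.act_mult[OF S.inv_closed[OF g] g p] S.act_one[OF p] S.l_inv[OF g] fix_g[OF p] by simp
      then show ?thesis
        unfolding K_def using S.inv_closed[OF g] by blast
    qed
    show "g \<otimes>\<^bsub>SAut n\<^esub> h \<in> K" if "g \<in> K" "h \<in> K" for g h
      using that S.act_mult S.m_closed unfolding K_def by simp
  qed
  \<comment> \<open>Three-cycles of generators preserve the signs of letters, hence the restriction to a single sign.\<close>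
  have same_sign: "transvection n (i, s) (k, s) \<in> K" if ik: "i < n" "k < n" "i \<noteq> k" for i k s
  proof -
    obtain j where j: "j < n" "j \<noteq> i" "j \<noteq> k"
    proof -
      have "\<not> {..<n} \<subseteq> {i, k}"
        using card_mono[of "{i, k}" "{..<n}"] card_insert_le_m1[of 2 "{k}" i] assms(1) by auto
      then show thesis
        using that by blast
    qed
    let ?A = "transvection n (i, s) (j, s)" and ?B = "transvection n (j, s) (k, s)"
      and ?C = "transvection n (i, s) (k, s)" and ?t = "three_cycle (Suc i) (Suc j) (Suc k)"
    let ?\<alpha> = "perm_aut n ?t"
    have d: "distinct [i, j, k]"
      using ik j by simp
    have g: "diff_gens n (i, s) (j, s)" "diff_gens n (j, s) (k, s)" "diff_gens n (i, s) (k, s)"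
      using ik j by (simp_all add: diff_gens_def)
    have ABC: "?A \<in> carrier (SAut n)" "?B \<in> carrier (SAut n)" "?C \<in> carrier (SAut n)"
      by (rule transvection_SAut[OF g(1)], rule transvection_SAut[OF g(2)], rule transvection_SAut[OF g(3)])
    have "distinct [Suc i, Suc j, Suc k]" "{Suc i, Suc j, Suc k} \<subseteq> {1..Suc n}"
      using d ik j by auto
    then have t: "?t \<in> carrier ?H"
      by (rule three_cycle_alt)
    note \<alpha> = perm_aut_SAut[OF t]
    have AB: "\<Phi> ?A p = \<Phi> ?B p" if p: "p \<in> points X" for p
    proof -
      have "\<Phi> ?A p = \<Phi> ?\<alpha> (\<Phi> ?A p)"
        using alt_fixes[OF t S.act_isom(4)[OF ABC(1) p]] by simp
      also have "\<dots> = \<Phi> (cmp n ?\<alpha> ?A) p"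
        by (rule act_cmp[OF \<alpha> ABC(1) p, symmetric])
      also have "\<dots> = \<Phi> (cmp n ?B ?\<alpha>) p"
        unfolding transvection_conjugate[OF d ik(1) j(1) ik(2)] by (rule refl)
      also have "\<dots> = \<Phi> ?B p"
        unfolding act_cmp[OF ABC(2) \<alpha> p] alt_fixes[OF t p] by (rule refl)
      finally show ?thesis .
    qed
    have "\<Phi> ?C p = p" if p: "p \<in> points X" for p
    proof -
      note C = S.act_isom(4)[OF ABC(3) p]
      note A = S.act_isom(4)[OF ABC(1)]
      have cAB: "cmp n ?A ?B \<in> carrier (SAut n)"
        using S.m_closed[OF ABC(1,2)] SAut_mult[OF ABC(1,2)] by simp
      have "\<Phi> ?A (\<Phi> ?A p) = \<Phi> (cmp n ?B ?A) p"
        unfolding act_cmp[OF ABC(2,1) p] by (rule AB[OF A[OF p]])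
      also have "\<dots> = \<Phi> (cmp n (cmp n ?A ?B) ?C) p"
        unfolding transvection_commutator[OF g] by (rule refl)
      also have "\<dots> = \<Phi> ?A (\<Phi> ?A (\<Phi> ?C p))"
        unfolding act_cmp[OF cAB ABC(3) p] act_cmp[OF ABC(1,2) C] AB[OF C] by (rule refl)
      finally have "\<Phi> ?A p = \<Phi> ?A (\<Phi> ?C p)"
        by (rule inj[OF ABC(1) A[OF p] A[OF C]])
      then have "p = \<Phi> ?C p"
        by (rule inj[OF ABC(1) p C])
      then show ?thesis
        by (rule sym)
    qed
    then show ?thesis
      unfolding K_def using ABC(3) by blast
  qed
  interpret transvection_subgroup n K
  proof (intro transvection_subgroup.intro sub)
    fix b c
    assume bc: "diff_gens n b c"
    have tv: "transvection n (fst b, snd b) (fst c, snd b) \<in> K"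
      by (rule same_sign) (use bc in \<open>simp_all add: diff_gens_def\<close>)
    show "transvection n b c \<in> K"
    proof (cases "snd b = snd c")
      case True
      then have "(fst b, snd b) = b" "(fst c, snd b) = c"
        by (simp_all add: prod_eq_iff)
      then show ?thesis
        using tv by (simp only:)
    next
      case False
      then have inv: "letter_inv c = (fst c, snd b)"
        by (simp add: letter_inv_def)
      have bc': "diff_gens n b (letter_inv c)"
        using bc by simp
      \<comment> \<open>Letters of opposite sign: this is the inverse of a transvection which is already in \<open>K\<close>.\<close>
      let ?T = "transvection n b (letter_inv c)" and ?T' = "transvection n b c"
      have T: "?T \<in> K"
        using tv unfolding inv prod.collapse .
      note c = transvection_SAut[OF bc'] transvection_SAut[OF bc]
      have "cmp n ?T ?T' = (\<lambda>w\<in>F n. w)"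
      proof (rule hom_eqI[OF cmp_hom[OF transvection_hom[OF bc'] transvection_hom[OF bc]]])
        show "(\<lambda>w\<in>F n. w) \<in> End n"
          using group.id_in_auto[OF group_free_group] by (rule autoD)
        show "cmp n ?T ?T' [a] = (\<lambda>w\<in>F n. w) [a]" if "fst a < n" for a
          using transvection_cancel[OF bc' that] that by (simp add: cmp_apply)
      qed (simp_all add: compose_def)
      then have "cmp n ?T ?T' = \<one>\<^bsub>SAut n\<^esub>"
        by (simp add: SAut_one)
      then have "\<Phi> ?T' p = p" if p: "p \<in> points X" for p
        using act_cmp[OF c p] S.act_one[OF p] T S.act_isom(4)[OF c(2) p] unfolding K_def by simp
      then show ?thesis
        unfolding K_def using c(2) by blast
    qed
  qed
  show ?thesis
  proof
    fix g
    assume g: "g \<in> carrier (SAut n)"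
    then have "g \<in> K"
      by (rule transvections_generate_SAut)
    then have "\<forall>p\<in>points X. \<Phi> g p = p"
      unfolding K_def by blast
    then show "\<Phi> g = (\<lambda>x\<in>points X. x)"
      using S.act_isom(2)[OF g] by (intro extensionalityI[of _ "points X"]) simp_all
  qed
qed

end
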